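(* Let $K$ be a field, let $\lambda = (\lambda_1\ge \cdots\ge \lambda_m)$ be a partition with $\lambda_m\ge m$, put $n=\lambda_1$ and $R=K[x_1,\ldots,x_n]$, and let $I=(x_ix_j \mid 1\le i\le m,\ i\le j\le \lambda_i)\subseteq R$ be the associated strongly stable ideal generated in degree two. Let $\widehat I$ be its LCM-dual and $m_I$ the least common multiple of the minimal monomial generators of $I$. Suppose $m > 1$. Then: (1) the Castelnuovo-Mumford regularity of $R/\widehat{I}$ is $\deg(m_I) -3 = \lambda_1 + m -3=n+m-3$; (2) the projective dimension of $R/\widehat{I}$ is $3$; (3) $R/\widehat{I}$ has a linear free resolution.
   Context: LCM-dual: for a monomial ideal $I$ with minimal monomial generators $f_1,\ldots,f_\nu$ and $m_I=\operatorname{lcm}(f_1,\ldots,f_\nu)$, $\widehat I$ is the ideal generated by $m_I/f_1,\ldots,m_I/f_\nu$. (The ideal $I$ here is the specialization $\overline I_{\lambda-\mu}$, obtained by substituting $y_j\mapsto x_j$, of the generalized Ferrers ideal $I_{\lambda-\mu}=(x_iy_j\mid 1\le i\le m,\ i-1<j\le\lambda_i)$ with $\mu=(0,1,\ldots,m-1)$.) $R$ is standard graded. For a finitely generated graded $R$-module $M$ with graded Betti numbers $\beta_{ij}(M)$, the projective dimension is $\max\{i:\beta_{ij}(M)\ne0\text{ for some }j\}$ and the regularity is $\max\{j-i:\beta_{ij}(M)\neq0\}$. That $R/\widehat I$ has a linear free resolution means that $\widehat I$ is generated in a single degree $d$ and $\beta_{ij}(R/\widehat I)=0$ for $i\ge1$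 unless $j=d+i-1$.
   Formalization: Claim (2) fails when λ_2 = 2, i.e. λ = (n,2): for λ = (2,2), R/Î = K[x_1,x_2]/(x_1,x_2)^2 has projective dimension 2. Proved instead: projective dimension 3 if λ_2 ≠ 2 and 2 if λ_2 = 2; (1) and (3) hold in all cases. *)

theory Defs
  imports "HOL-Library.Poly_Mapping" "HOL-Algebra.QuotRing" "HOL-Algebra.Module"
begin

section \<open>Polynomial rings\<close>

text \<open>
  A monomial is identified with its exponent vector, of type \<open>nat \<Rightarrow>\<^sub>0 nat\<close>. The order \<open>\<le>\<close> that
  the library puts on this type is lexicographic, so divisibility of monomials is defined separately.
\<close>

type_synonym expo = "nat \<Rightarrow>\<^sub>0 nat"
type_synonym 'k mpoly = "expo \<Rightarrow>\<^sub>0 'k"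

definition monom :: "expo \<Rightarrow> 'k::field mpoly" where
  "monom t = Poly_Mapping.single t 1"

definition mvar :: "nat \<Rightarrow> 'k::field mpoly" where
  "mvar i = monom (Poly_Mapping.single i 1)"

definition expo_dvd :: "expo \<Rightarrow> expo \<Rightarrow> bool" where
  "expo_dvd s t \<longleftrightarrow> (\<forall>i. Poly_Mapping.lookup s i \<le> Poly_Mapping.lookup t i)"

definition tdeg :: "expo \<Rightarrow> nat" where
  "tdeg t = (\<Sum>i\<in>Poly_Mapping.keys t. Poly_Mapping.lookup t i)"

definition expo_lcm :: "expo set \<Rightarrow> expo" where
  "expo_lcm S = Abs_poly_mapping (\<lambda>i. Max (insert 0 ((\<lambda>t. Poly_Mapping.lookup t i) ` S)))"

lemma lookup_expo_lcm:
  assumes "finite S"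
  shows "Poly_Mapping.lookup (expo_lcm S) i =
           Max (insert 0 ((\<lambda>t. Poly_Mapping.lookup t i) ` S))"
proof -
  have "{i. Max (insert 0 ((\<lambda>t. Poly_Mapping.lookup t i) ` S)) \<noteq> 0}
          \<subseteq> (\<Union>t\<in>S. Poly_Mapping.keys t)"
  proof
    fix i assume i: "i \<in> {i. Max (insert 0 ((\<lambda>t. Poly_Mapping.lookup t i) ` S)) \<noteq> 0}"
    have "Max (insert 0 ((\<lambda>t. Poly_Mapping.lookup t i) ` S))
            \<in> insert 0 ((\<lambda>t. Poly_Mapping.lookup t i) ` S)"
      using assms by (intro Max_in) auto
    then show "i \<in> (\<Union>t\<in>S. Poly_Mapping.keys t)"
      using i by (auto simp: in_keys_iff)
  qed
  then have "finite {i. Max (insert 0 ((\<lambda>t. Poly_Mapping.lookup t i) ` S)) \<noteq> 0}"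
    using assms by (meson finite_UN finite_keys finite_subset)
  then show ?thesis
    unfolding expo_lcm_def by simp
qed

text \<open>The ring \<open>K[x\<^sub>1,\<dots>,x\<^sub>n]\<close>.\<close>

definition poly_ring :: "nat \<Rightarrow> 'k::field mpoly ring" where
  "poly_ring n =
     \<lparr>carrier = {p. \<forall>t\<in>Poly_Mapping.keys p. Poly_Mapping.keys t \<subseteq> {1..n}},
      mult = (*), one = 1, zero = 0, add = (+)\<rparr>"

lemma poly_ring_simps [simp]:
  "mult (poly_ring n) = (*)" "one (poly_ring n) = 1" "zero (poly_ring n) = 0"
  "add (poly_ring n) = (+)"
  by (simp_all add: poly_ring_def)

lemma poly_ring_closed:
  fixes p q :: "'k::field mpoly"
  shows "(0 :: 'k mpoly) \<in> carrier (poly_ring n)"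
    and "(1 :: 'k mpoly) \<in> carrier (poly_ring n)"
    and "p \<in> carrier (poly_ring n) \<Longrightarrow> - p \<in> carrier (poly_ring n)"
    and "p \<in> carrier (poly_ring n) \<Longrightarrow> q \<in> carrier (poly_ring n) \<Longrightarrow>
           p + q \<in> carrier (poly_ring n)"
    and "p \<in> carrier (poly_ring n) \<Longrightarrow> q \<in> carrier (poly_ring n) \<Longrightarrow>
           p * q \<in> carrier (poly_ring n)"
proof -
  show "(0 :: 'k mpoly) \<in> carrier (poly_ring n)" "(1 :: 'k mpoly) \<in> carrier (poly_ring n)"
    by (simp_all add: poly_ring_def)
next
  assume "p \<in> carrier (poly_ring n)"
  then show "- p \<in> carrier (poly_ring n)"
    by (simp add: poly_ring_def keys_minus)
next
  assume pq: "p \<in> carrier (poly_ring n)" "q \<in> carrier (poly_ring n)"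
  then show "p + q \<in> carrier (poly_ring n)"
    unfolding poly_ring_def using Poly_Mapping.keys_add[of p q] by auto
  show "p * q \<in> carrier (poly_ring n)"
    unfolding poly_ring_def
  proof (simp, intro ballI)
    fix t assume "t \<in> Poly_Mapping.keys (p * q)"
    then obtain a b where ab: "t = a + b" "a \<in> Poly_Mapping.keys p" "b \<in> Poly_Mapping.keys q"
      using Poly_Mapping.keys_mult[of p q] by blast
    then have "Poly_Mapping.keys a \<subseteq> {1..n}" "Poly_Mapping.keys b \<subseteq> {1..n}"
      using pq by (simp_all add: poly_ring_def)
    then show "Poly_Mapping.keys t \<subseteq> {Suc 0..n}"
      using Poly_Mapping.keys_add[of a b] ab(1) by auto
  qed
qed

lemma poly_ring_cring: "cring (poly_ring n :: 'k::field mpoly ring)"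
proof (rule cringI)
  show "abelian_group (poly_ring n :: 'k mpoly ring)"
  proof (rule abelian_groupI)
    fix p :: "'k mpoly" assume "p \<in> carrier (poly_ring n)"
    then show "\<exists>q\<in>carrier (poly_ring n). q \<oplus>\<^bsub>poly_ring n\<^esub> p = \<zero>\<^bsub>poly_ring n\<^esub>"
      by (intro bexI[of _ "- p"]) (simp_all add: poly_ring_closed)
  qed (simp_all add: poly_ring_closed ac_simps)
  show "comm_monoid (poly_ring n :: 'k mpoly ring)"
    by (rule comm_monoidI) (simp_all add: poly_ring_closed ac_simps)
qed (simp add: distrib_right)

definition homogeneous :: "int \<Rightarrow> 'k::field mpoly \<Rightarrow> bool" where
  "homogeneous d p \<longleftrightarrow> (\<forall>t\<in>Poly_Mapping.keys p. int (tdeg t) = d)"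


section \<open>Graded modules, minimal graded free resolutions and Betti numbers\<close>

record ('a, 'b) graded_module = "('a, 'b) module" +
  component :: "int \<Rightarrow> 'b set"

definition quot_module :: "nat \<Rightarrow> 'k::field mpoly set \<Rightarrow> ('k mpoly, 'k mpoly set) graded_module"
  where
  "quot_module n J =
     \<lparr>carrier = carrier (poly_ring n Quot J), mult = mult (poly_ring n Quot J),
      one = one (poly_ring n Quot J), zero = zero (poly_ring n Quot J),
      add = add (poly_ring n Quot J),
      smult = (\<lambda>r Y. (J +>\<^bsub>poly_ring n\<^esub> r) \<otimes>\<^bsub>poly_ring n Quot J\<^esub> Y),
      component = (\<lambda>d. {J +>\<^bsub>poly_ring n\<^esub> p | p. p \<in> carrier (poly_ring n) \<and> homogeneous d p})\<rparr>"

lemma quot_module_module: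
  fixes J :: "'k::field mpoly set"
  assumes "ideal J (poly_ring n)"
  shows "module (poly_ring n) (quot_module n J)"
proof -
  interpret R: cring "poly_ring n :: 'k mpoly ring" by (rule poly_ring_cring)
  interpret J: ideal J "poly_ring n" by fact
  interpret Q: cring "poly_ring n Quot J" by (rule J.quotient_is_cring[OF R.is_cring])
  interpret h: ring_hom_cring "poly_ring n" "poly_ring n Quot J" "(+>\<^bsub>poly_ring n\<^esub>) J"
    by (rule J.rcos_ring_hom_cring[OF R.is_cring])
  have sel: "carrier (quot_module n J) = carrier (poly_ring n Quot J)"
    "add (quot_module n J) = add (poly_ring n Quot J)"
    "zero (quot_module n J) = zero (poly_ring n Quot J)"
    "smult (quot_module n J) r Y = (J +>\<^bsub>poly_ring n\<^esub> r) \<otimes>\<^bsub>poly_ring n Quot J\<^esub> Y" for r Y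
    by (simp_all only: quot_module_def partial_object.simps monoid.simps ring.simps module.simps)
  show ?thesis
  proof (rule moduleI)
    show "abelian_group (quot_module n J)"
    proof (rule abelian_groupI, unfold sel)
      fix x assume "x \<in> carrier (poly_ring n Quot J)"
      then show "\<exists>y\<in>carrier (poly_ring n Quot J).
          y \<oplus>\<^bsub>poly_ring n Quot J\<^esub> x = \<zero>\<^bsub>poly_ring n Quot J\<^esub>"
        using Q.l_neg Q.a_inv_closed by blast
    next
      fix x y assume "x \<in> carrier (poly_ring n Quot J)" "y \<in> carrier (poly_ring n Quot J)"
      then show "x \<oplus>\<^bsub>poly_ring n Quot J\<^esub> y = y \<oplus>\<^bsub>poly_ring n Quot J\<^esub> x"
        by (rule Q.a_comm)
    qed (assumption | rule Q.add.m_closed Q.zero_closed Q.a_assoc Q.l_zero)+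
  next
    fix a b :: "'k mpoly" and x
    assume abx: "a \<in> carrier (poly_ring n)" "b \<in> carrier (poly_ring n)"
      "x \<in> carrier (quot_module n J)"
    show "(a \<oplus>\<^bsub>poly_ring n\<^esub> b) \<odot>\<^bsub>quot_module n J\<^esub> x
        = a \<odot>\<^bsub>quot_module n J\<^esub> x \<oplus>\<^bsub>quot_module n J\<^esub> b \<odot>\<^bsub>quot_module n J\<^esub> x"
      unfolding sel h.hom_add[OF abx(1,2)] using abx unfolding sel by (intro Q.l_distr h.hom_closed)
    show "(a \<otimes>\<^bsub>poly_ring n\<^esub> b) \<odot>\<^bsub>quot_module n J\<^esub> x
        = a \<odot>\<^bsub>quot_module n J\<^esub> (b \<odot>\<^bsub>quot_module n J\<^esub> x)"
      unfolding sel h.hom_mult[OF abx(1,2)] using abx unfolding sel by (intro Q.m_assoc h.hom_closed)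
  next
    fix a :: "'k mpoly" and x y
    assume "a \<in> carrier (poly_ring n)" "x \<in> carrier (quot_module n J)"
      "y \<in> carrier (quot_module n J)"
    then show "a \<odot>\<^bsub>quot_module n J\<^esub> (x \<oplus>\<^bsub>quot_module n J\<^esub> y)
        = a \<odot>\<^bsub>quot_module n J\<^esub> x \<oplus>\<^bsub>quot_module n J\<^esub> a \<odot>\<^bsub>quot_module n J\<^esub> y"
      unfolding sel by (intro Q.r_distr h.hom_closed)
  next
    fix a :: "'k mpoly" and x
    assume "a \<in> carrier (poly_ring n)" "x \<in> carrier (quot_module n J)"
    then show "a \<odot>\<^bsub>quot_module n J\<^esub> x \<in> carrier (quot_module n J)"
      unfolding sel by (intro Q.m_closed h.hom_closed)
  next
    fix x assume "x \<in> carrier (quot_module n J)"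
    then show "\<one>\<^bsub>poly_ring n\<^esub> \<odot>\<^bsub>quot_module n J\<^esub> x = x"
      unfolding sel h.hom_one by (rule Q.l_one)
  qed (rule R.is_cring)
qed

text \<open>
  Data of a graded free resolution \<open>\<cdots> \<rightarrow> F\<^sub>1 \<rightarrow> F\<^sub>0 \<rightarrow> M \<rightarrow> 0\<close>. Here \<open>F\<^sub>i\<close> is the direct sum of the
  \<open>R(-gdeg i k)\<close> for \<open>k < rk i\<close>, the matrix of \<open>F\<^sub>i\<^sub>+\<^sub>1 \<rightarrow> F\<^sub>i\<close> has the entry \<open>diff i a b\<close> in row \<open>a\<close>
  and column \<open>b\<close>, and \<open>aug k\<close> is the image in \<open>M\<close> of the \<open>k\<close>-th basis element of \<open>F\<^sub>0\<close>.
\<close>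

record ('p, 'b) free_complex =
  rk :: "nat \<Rightarrow> nat"
  gdeg :: "nat \<Rightarrow> nat \<Rightarrow> int"
  diff :: "nat \<Rightarrow> nat \<Rightarrow> nat \<Rightarrow> 'p"
  aug :: "nat \<Rightarrow> 'b"

text \<open>The free module of rank \<open>r\<close>; vectors are padded with zeros beyond position \<open>r\<close>.\<close>

definition free_mod :: "nat \<Rightarrow> nat \<Rightarrow> (nat \<Rightarrow> 'k::field mpoly) set" where
  "free_mod n r = {v. (\<forall>k<r. v k \<in> carrier (poly_ring n)) \<and> (\<forall>k\<ge>r. v k = 0)}"

definition diff_map ::
  "('k::field mpoly, 'b) free_complex \<Rightarrow> nat \<Rightarrow> (nat \<Rightarrow> 'k mpoly) \<Rightarrow> nat \<Rightarrow> 'k mpoly"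
  where
  "diff_map F i v = (\<lambda>a. if a < rk F i then (\<Sum>b<rk F (Suc i). diff F i a b * v b) else 0)"

definition aug_map ::
  "('k::field mpoly, 'b) graded_module \<Rightarrow> ('k mpoly, 'b) free_complex \<Rightarrow> (nat \<Rightarrow> 'k mpoly) \<Rightarrow> 'b" where
  "aug_map M F v = (\<Oplus>\<^bsub>M\<^esub>k\<in>{..<rk F 0}. v k \<odot>\<^bsub>M\<^esub> aug F k)"

definition graded_free_resolution ::
  "nat \<Rightarrow> ('k::field mpoly, 'b) graded_module \<Rightarrow> ('k mpoly, 'b) free_complex \<Rightarrow> bool" where
  "graded_free_resolution n M F \<longleftrightarrow>
     (\<forall>k<rk F 0. aug F k \<in> component M (gdeg F 0 k)) \<and>
     (\<forall>i. \<forall>a<rk F i. \<forall>b<rk F (Suc i).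
        diff F i a b \<in> carrier (poly_ring n) \<and>
        homogeneous (gdeg F (Suc i) b - gdeg F i a) (diff F i a b)) \<and>
     aug_map M F ` free_mod n (rk F 0) = carrier M \<and>
     {v \<in> free_mod n (rk F 0). aug_map M F v = \<zero>\<^bsub>M\<^esub>} = diff_map F 0 ` free_mod n (rk F 1) \<and>
     (\<forall>i. {v \<in> free_mod n (rk F (Suc i)). diff_map F i v = (\<lambda>_. 0)}
            = diff_map F (Suc i) ` free_mod n (rk F (Suc (Suc i))))"

text \<open>
  Minimality: the image of each differential lies in \<open>(x\<^sub>1,\<dots>,x\<^sub>n)F\<^sub>i\<close>, i.e. no matrix entry has a
  constant term.
\<close>

definition minimal_graded_free_resolution ::
  "nat \<Rightarrow> ('k::field mpoly, 'b) graded_module \<Rightarrow> ('k mpoly, 'b) free_complex \<Rightarrow> bool" where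
  "minimal_graded_free_resolution n M F \<longleftrightarrow>
     graded_free_resolution n M F \<and>
     (\<forall>i. \<forall>a<rk F i. \<forall>b<rk F (Suc i). Poly_Mapping.lookup (diff F i a b) 0 = 0)"

text \<open>
  The number of copies of \<open>R(-j)\<close> in homological degree \<open>i\<close> of the minimal graded free resolution,
  which exists for finitely generated \<open>M\<close> and is unique up to isomorphism.
\<close>

definition betti :: "nat \<Rightarrow> ('k::field mpoly, 'b) graded_module \<Rightarrow> nat \<Rightarrow> int \<Rightarrow> nat" where
  "betti n M i j =
     (let F = SOME F. minimal_graded_free_resolution n M F
      in card {k. k < rk F i \<and> gdeg F i k = j})"

definition proj_dim :: "nat \<Rightarrow> ('k::field mpoly, 'b) graded_module \<Rightarrow> nat" where
  "proj_dim n M = Max {i. \<exists>j. betti n M i j \<noteq> 0}"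

definition regularity :: "nat \<Rightarrow> ('k::field mpoly, 'b) graded_module \<Rightarrow> int" where
  "regularity n M = Max {j - int i | i j. betti n M i j \<noteq> 0}"

definition generated_in_degree :: "nat \<Rightarrow> int \<Rightarrow> 'k::field mpoly set \<Rightarrow> bool" where
  "generated_in_degree n d J \<longleftrightarrow> J = genideal (poly_ring n) {f \<in> J. homogeneous d f}"

text \<open>\<open>R/J\<close> has a linear free resolution.\<close>

definition linear_resolution :: "nat \<Rightarrow> 'k::field mpoly set \<Rightarrow> bool" where
  "linear_resolution n J \<longleftrightarrow>
     (\<exists>d. generated_in_degree n d J \<and>
        (\<forall>i\<ge>1. \<forall>j. j \<noteq> d + int i - 1 \<longrightarrow> betti n (quot_module n J) i j = 0))"


section \<open>Monomial ideals and the LCM-dual\<close>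

definition min_gens :: "'k::field mpoly set \<Rightarrow> expo set" where
  "min_gens I = {t. monom t \<in> I \<and> (\<forall>s. monom s \<in> I \<longrightarrow> expo_dvd s t \<longrightarrow> s = t)}"

definition lcm_gens :: "'k::field mpoly set \<Rightarrow> expo" where
  "lcm_gens I = expo_lcm (min_gens I)"

text \<open>On exponents, \<open>m\<^sub>I / f\<close> is a difference; the truncated subtraction is exact as \<open>f\<close> divides \<open>m\<^sub>I\<close>.\<close>

definition lcm_dual :: "nat \<Rightarrow> 'k::field mpoly set \<Rightarrow> 'k mpoly set" where
  "lcm_dual n I = genideal (poly_ring n) {monom (lcm_gens I - t) | t. t \<in> min_gens I}"

definition specialized_ferrers_ideal :: "nat \<Rightarrow> nat \<Rightarrow> (nat \<Rightarrow> nat) \<Rightarrow> 'k::field mpoly set" where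
  "specialized_ferrers_ideal n m lam =
     genideal (poly_ring n) {mvar i * mvar j | i j. 1 \<le> i \<and> i \<le> m \<and> i \<le> j \<and> j \<le> lam i}"

text \<open>
  For \<open>lam = (n, 2)\<close>, i.e. \<open>m = 2\<close> and \<open>lam 2 = 2\<close>, the quotient by the LCM-dual has projective
  dimension 2 and not 3: if \<open>n = 2\<close>, then \<open>I = (x\<^sub>1,x\<^sub>2)\<^sup>2\<close> is its own LCM-dual, in a polynomial ring
  of dimension 2. For \<open>m > 1\<close> this is the only case in which the value 3 is not attained.
\<close>

end

theory Submission
  imports Defs
begin

text \<open>
  The minimal generators of \<open>I\<close> are the monomials \<open>x\<^sub>i x\<^sub>j\<close> for the boxes \<open>(i, j)\<close> of the shifted diagram
  \<open>1 \<le> i \<le> m\<close>, \<open>i \<le> j \<le> lam i\<close>. In their least common multiple \<open>M\<close> the variables up to \<open>x\<^sub>m\<close> have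
  exponent 2 (because of the squares \<open>x\<^sub>i x\<^sub>i\<close>) and the others have exponent 1, so \<open>M\<close> has degree \<open>n + m\<close>.

  The quotients \<open>M / x\<^sub>i x\<^sub>j\<close> that generate the dual have a cellular resolution on the diagram itself.
  Take the boxes as vertices, join horizontally or vertically adjacent boxes by an edge and fill every
  2 by 2 square of boxes. Label each cell by the least common multiple of the labels of its
  vertices: a horizontal edge in row \<open>i\<close> gets \<open>M / x\<^sub>i\<close>, a vertical edge in column \<open>j\<close> gets \<open>M / x\<^sub>j\<close>, a
  square gets \<open>M\<close>. So the labels have degree \<open>n + m - 2\<close>, \<open>n + m - 1\<close> and \<open>n + m\<close>. The labels of an
  edge or a square and of a facet of it differ by a single variable, hence the resolution
  \<open>0 \<rightarrow> R\<^bsup>squares\<^esup> \<rightarrow> R\<^bsup>edges\<^esup> \<rightarrow> R\<^bsup>boxes\<^esup> \<rightarrow> R\<close>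
  is minimal and linear. It has length 3 if there is a square and length 2 otherwise, and there is no
  square exactly if \<open>lam 2 = 2\<close> (lemma \<open>squares_exist_iff\<close>).

  Exactness is proved by hand in each degree. A cycle on squares vanishes row by row (\<open>exact_squares\<close>).
  A cycle on edges becomes, once the variables are divided out, a discrete closed 1-form on the
  diagram, which is integrated down the columns (\<open>exact_edges\<close>). A syzygy of the generators is reduced
  from the last box on in reading order, because the colon ideal of the generators of earlier boxes with
  respect to the generator of a box is generated by at most two variables, which belong to the edges to
  the left and up (\<open>last_coefficient\<close>, \<open>exact_boxes\<close>).

  Betti numbers are read off from an arbitrary minimal resolution, so the constructed one determines
  them only together with uniqueness. For this, a minimal resolution \<open>F\<close> and any resolution \<open>G\<close> of the same
  cyclic module are compared by chain maps in both directions. Their composite is homotopic to the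
  identity of \<open>F\<close>, and as the differentials of \<open>F\<close> have no constant terms, the constant terms of the
  two chain maps satisfy \<open>\<psi>\<phi> = 1\<close>; so \<open>F\<close> has at most as many basis elements as \<open>G\<close> in every bidegree
  (\<open>minimal_resolution_ranks_le\<close>).
\<close>

section \<open>Monomials and terms of polynomials\<close>

lemma expo_dvd_iff_add: "expo_dvd s t \<longleftrightarrow> (\<exists>u. t = s + u)"
proof
  assume "expo_dvd s t"
  then have "t = s + (t - s)"
    by (intro poly_mapping_eqI) (simp add: expo_dvd_def lookup_add lookup_minus)
  then show "\<exists>u. t = s + u" ..
qed (auto simp: expo_dvd_def lookup_add)

lemma expo_dvd_add_diff: "expo_dvd s t \<Longrightarrow> s + (t - s) = t"
  by (auto simp: expo_dvd_iff_add)

lemma expo_dvd_antisym: "expo_dvd s t \<Longrightarrow> expo_dvd t s \<Longrightarrow> s = t"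
  by (auto simp: expo_dvd_def intro: poly_mapping_eqI order_antisym)

lemma expo_dvd_trans: "expo_dvd s t \<Longrightarrow> expo_dvd t u \<Longrightarrow> expo_dvd s u"
  unfolding expo_dvd_def using order_trans by blast

lemma tdeg_eq_sum:
  assumes "finite A" "Poly_Mapping.keys t \<subseteq> A"
  shows "tdeg t = (\<Sum>i\<in>A. Poly_Mapping.lookup t i)"
  unfolding tdeg_def using assms by (intro sum.mono_neutral_left) (auto simp: in_keys_iff)

lemma tdeg_add: "tdeg (s + t) = tdeg s + tdeg t"
proof -
  let ?A = "Poly_Mapping.keys s \<union> Poly_Mapping.keys t"
  have "Poly_Mapping.keys (s + t) \<subseteq> ?A"
    by (rule Poly_Mapping.keys_add)
  then show ?thesis
    by (simp add: tdeg_eq_sum[of ?A] lookup_add sum.distrib)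
qed

lemma tdeg_zero [simp]: "tdeg 0 = 0"
  by (simp add: tdeg_def)

lemma tdeg_zero_iff: "tdeg u = 0 \<longleftrightarrow> u = 0"
  by (auto simp: tdeg_def in_keys_iff intro: poly_mapping_eqI)

lemma expo_dvd_same_degree: "expo_dvd s t \<Longrightarrow> tdeg s = tdeg t \<Longrightarrow> s = t"
  by (auto simp: expo_dvd_iff_add tdeg_add tdeg_zero_iff)

lemma tdeg_single [simp]: "tdeg (Poly_Mapping.single i e) = e"
  by (simp add: tdeg_def)

lemma keys_monom [simp]: "Poly_Mapping.keys (monom t :: 'k::field mpoly) = {t}"
  by (simp add: monom_def)

lemma monom_add: "(monom (s + t) :: 'k::field mpoly) = monom s * monom t"
  by (simp add: monom_def mult_single)

lemma monom_nonzero [simp]: "(monom t :: 'k::field mpoly) \<noteq> 0"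
  using keys_monom[of t, where 'k = 'k] by (metis insert_not_empty keys_zero)

lemma mvar_nonzero [simp]: "(mvar i :: 'k::field mpoly) \<noteq> 0"
  by (simp add: mvar_def)

lemma lookup_monom_mult:
  fixes p :: "'k::field mpoly"
  shows "Poly_Mapping.lookup (monom s * p) u
           = (if expo_dvd s u then Poly_Mapping.lookup p (u - s) else 0)"
proof -
  have "Poly_Mapping.lookup (monom s * p) u
          = (\<Sum>l. (\<Sum>q. Poly_Mapping.lookup p q when u = l + q) when l = s)"
    unfolding lookup_mult
    by (rule Sum_any.cong) (simp add: monom_def lookup_single when_def)
  also have "\<dots> = (\<Sum>q. Poly_Mapping.lookup p q when u = s + q)"
    by simp
  also have "\<dots> = (if expo_dvd s u then Poly_Mapping.lookup p (u - s) else 0)"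
  proof (cases "expo_dvd s u")
    case True
    then have "u = s + q \<longleftrightarrow> q = u - s" for q
      using expo_dvd_add_diff[OF True] by (metis add_diff_cancel_left')
    then show ?thesis
      using True by simp
  next
    case False
    then have "u \<noteq> s + q" for q
      by (auto simp: expo_dvd_iff_add)
    then show ?thesis
      using False by simp
  qed
  finally show ?thesis .
qed

lemma lookup_mult_zero:
  fixes p q :: "'k::field mpoly"
  shows "Poly_Mapping.lookup (p * q) 0 = Poly_Mapping.lookup p 0 * Poly_Mapping.lookup q 0"
proof -
  have sum0: "(0::expo) = l + r \<longleftrightarrow> l = 0 \<and> r = 0" for l r :: expo
    by (metis add.left_neutral add_is_0 lookup_add lookup_zero poly_mapping_eqI)
  have "Poly_Mapping.lookup (p * q) 0
          = (\<Sum>l. Poly_Mapping.lookup p l * Poly_Mapping.lookup q 0 when l = 0)"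
    unfolding lookup_mult
    by (rule Sum_any.cong) (auto simp: sum0 when_def)
  then show ?thesis
    by simp
qed

text \<open>
  The terms of \<open>p\<close> that the monomial \<open>s\<close> divides, divided by \<open>s\<close>; the other terms are dropped, which
  makes the operation total.
\<close>

definition monom_quot :: "expo \<Rightarrow> 'k::field mpoly \<Rightarrow> 'k mpoly" where
  "monom_quot s p = Poly_Mapping.map_key (\<lambda>t. s + t) p"

lemma inj_add_expo: "inj (\<lambda>t. s + t :: expo)"
  by (simp add: inj_on_def)

lemma lookup_monom_quot: "Poly_Mapping.lookup (monom_quot s p) t = Poly_Mapping.lookup p (s + t)"
  unfolding monom_quot_def by (simp add: map_key.rep_eq[OF inj_add_expo])

lemma monom_mult_monom_quot:
  fixes p :: "'k::field mpoly"
  assumes "\<And>t. t \<in> Poly_Mapping.keys p \<Longrightarrow> expo_dvd s t"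
  shows "monom s * monom_quot s p = p"
proof (rule poly_mapping_eqI)
  fix t
  show "Poly_Mapping.lookup (monom s * monom_quot s p) t = Poly_Mapping.lookup p t"
    using assms[of t]
    by (auto simp: lookup_monom_mult lookup_monom_quot expo_dvd_add_diff in_keys_iff)
qed

definition restrict_terms :: "(expo \<Rightarrow> bool) \<Rightarrow> 'k::field mpoly \<Rightarrow> 'k mpoly" where
  "restrict_terms P p = Poly_Mapping.mapp (\<lambda>t c. c when P t) p"

lemma lookup_restrict_terms: "Poly_Mapping.lookup (restrict_terms P p) t = (Poly_Mapping.lookup p t when P t)"
  by (simp add: restrict_terms_def lookup_mapp when_def in_keys_iff)

lemma keys_restrict_terms: "Poly_Mapping.keys (restrict_terms P p) = {t \<in> Poly_Mapping.keys p. P t}"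
  by (auto simp: in_keys_iff lookup_restrict_terms)

lemma restrict_terms_add: "restrict_terms P (p + q) = restrict_terms P p + restrict_terms P q"
  by (intro poly_mapping_eqI) (simp add: lookup_restrict_terms lookup_add when_def)

lemma restrict_terms_sum: "restrict_terms P (\<Sum>x\<in>A. f x) = (\<Sum>x\<in>A. restrict_terms P (f x))"
  by (intro poly_mapping_eqI) (simp add: lookup_restrict_terms lookup_sum when_def)

lemma restrict_terms_minus: "restrict_terms P (p - q) = restrict_terms P p - restrict_terms P q"
  by (intro poly_mapping_eqI) (simp add: lookup_restrict_terms lookup_minus when_def)

lemma restrict_terms_split: "restrict_terms P p + restrict_terms (\<lambda>t. \<not> P t) p = p"
  by (intro poly_mapping_eqI) (simp add: lookup_restrict_terms lookup_add when_def)

lemma restrict_terms_id: "(\<And>t. t \<in> Poly_Mapping.keys p \<Longrightarrow> P t) \<Longrightarrow> restrict_terms P p = p"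
  by (intro poly_mapping_eqI) (auto simp: lookup_restrict_terms when_def in_keys_iff)

lemma restrict_terms_none: "(\<And>t. t \<in> Poly_Mapping.keys p \<Longrightarrow> \<not> P t) \<Longrightarrow> restrict_terms P p = 0"
  by (intro poly_mapping_eqI) (auto simp: lookup_restrict_terms when_def in_keys_iff)

lemma carrier_poly_ring_iff:
  "p \<in> carrier (poly_ring n) \<longleftrightarrow> (\<forall>t\<in>Poly_Mapping.keys p. Poly_Mapping.keys t \<subseteq> {1..n})"
  by (simp add: poly_ring_def)

lemma carrier_restrict_terms: "p \<in> carrier (poly_ring n) \<Longrightarrow> restrict_terms P p \<in> carrier (poly_ring n)"
  by (auto simp: carrier_poly_ring_iff keys_restrict_terms)

lemma keys_expo_mono: "expo_dvd s t \<Longrightarrow> Poly_Mapping.keys s \<subseteq> Poly_Mapping.keys t"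
  by (auto simp: expo_dvd_def in_keys_iff) (metis less_le_trans)

lemma carrier_monom_quot:
  assumes "p \<in> carrier (poly_ring n)"
  shows "monom_quot s p \<in> carrier (poly_ring n)"
  unfolding carrier_poly_ring_iff
proof
  fix t assume "t \<in> Poly_Mapping.keys (monom_quot s p)"
  then have "s + t \<in> Poly_Mapping.keys p"
    by (simp add: in_keys_iff lookup_monom_quot)
  then have "Poly_Mapping.keys (s + t) \<subseteq> {1..n}"
    using assms by (simp add: carrier_poly_ring_iff)
  moreover have "expo_dvd t (s + t)"
    by (simp add: expo_dvd_def lookup_add)
  ultimately show "Poly_Mapping.keys t \<subseteq> {1..n}"
    using keys_expo_mono by blast
qed

lemma carrier_monom_iff:
  "(monom t :: 'k::field mpoly) \<in> carrier (poly_ring n) \<longleftrightarrow> Poly_Mapping.keys t \<subseteq> {1..n}"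
  by (simp add: carrier_poly_ring_iff)

lemma carrier_mvar: "1 \<le> i \<Longrightarrow> i \<le> n \<Longrightarrow> (mvar i :: 'k::field mpoly) \<in> carrier (poly_ring n)"
  by (simp add: mvar_def carrier_monom_iff)

lemma carrier_sum:
  assumes "\<And>x. x \<in> A \<Longrightarrow> f x \<in> carrier (poly_ring n)"
  shows "(\<Sum>x\<in>A. f x) \<in> carrier (poly_ring n)"
  using assms by (induction A rule: infinite_finite_induct) (auto simp: poly_ring_closed)

lemma carrier_minus:
  "p \<in> carrier (poly_ring n) \<Longrightarrow> q \<in> carrier (poly_ring n) \<Longrightarrow> p - q \<in> carrier (poly_ring n)"
  using poly_ring_closed(4)[of p n "- q"] poly_ring_closed(3)[of q n] by simp

lemma homogeneous_zero [simp]: "homogeneous d 0"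
  by (simp add: homogeneous_def)

lemma homogeneous_monom [simp]:
  "homogeneous d (monom t :: 'k::field mpoly) \<longleftrightarrow> int (tdeg t) = d"
  by (simp add: homogeneous_def)

lemma homogeneous_mvar [simp]: "homogeneous d (mvar i :: 'k::field mpoly) \<longleftrightarrow> d = 1"
  by (auto simp: mvar_def)

lemma homogeneous_uminus [simp]: "homogeneous d (- p) \<longleftrightarrow> homogeneous d p"
  by (simp add: homogeneous_def keys_minus)

lemma homogeneous_mult:
  assumes "homogeneous d p" "homogeneous e q"
  shows "homogeneous (d + e) (p * q)"
  unfolding homogeneous_def
proof
  fix t assume "t \<in> Poly_Mapping.keys (p * q)"
  then obtain a b where "t = a + b" "a \<in> Poly_Mapping.keys p" "b \<in> Poly_Mapping.keys q"
    using Poly_Mapping.keys_mult[of p q] by blast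
  then show "int (tdeg t) = d + e"
    using assms by (simp add: homogeneous_def tdeg_add)
qed

lemma homogeneous_constant_term:
  assumes "homogeneous d p" "Poly_Mapping.lookup p 0 \<noteq> 0"
  shows "d = 0"
  using assms by (force simp: homogeneous_def in_keys_iff)

definition hom_part :: "int \<Rightarrow> 'k::field mpoly \<Rightarrow> 'k mpoly" where
  "hom_part d = restrict_terms (\<lambda>t. int (tdeg t) = d)"

lemma homogeneous_hom_part [simp]: "homogeneous d (hom_part d p)"
  by (simp add: homogeneous_def hom_part_def keys_restrict_terms)

lemma hom_part_homogeneous: "homogeneous d p \<Longrightarrow> hom_part d p = p"
  unfolding hom_part_def homogeneous_def by (rule restrict_terms_id) blast

lemma carrier_hom_part: "p \<in> carrier (poly_ring n) \<Longrightarrow> hom_part d p \<in> carrier (poly_ring n)"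
  unfolding hom_part_def by (rule carrier_restrict_terms)

text \<open>
  Split \<open>p\<close> into its part of degree \<open>e - d\<close> and the rest: multiplication by \<open>a\<close> shifts all degrees by \<open>d\<close>,
  so the rest does not contribute in degree \<open>e\<close>.
\<close>

lemma hom_part_mult:
  assumes "homogeneous d a"
  shows "hom_part e (a * p) = a * hom_part (e - d) p"
proof -
  define r where "r = restrict_terms (\<lambda>t. int (tdeg t) \<noteq> e - d) p"
  have p: "p = hom_part (e - d) p + r"
    unfolding hom_part_def r_def by (rule restrict_terms_split[symmetric])
  have "hom_part e (a * hom_part (e - d) p) = a * hom_part (e - d) p"
    using homogeneous_mult[OF assms homogeneous_hom_part[of "e - d" p]]
    by (intro hom_part_homogeneous) simp
  moreover have "hom_part e (a * r) = 0"
    unfolding hom_part_def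
  proof (rule restrict_terms_none)
    fix t assume "t \<in> Poly_Mapping.keys (a * r)"
    then obtain s u where "t = s + u" "s \<in> Poly_Mapping.keys a" "u \<in> Poly_Mapping.keys r"
      using Poly_Mapping.keys_mult[of a r] by blast
    then show "int (tdeg t) \<noteq> e"
      using assms by (auto simp: homogeneous_def tdeg_add r_def keys_restrict_terms)
  qed
  ultimately show ?thesis
    by (subst p) (simp add: distrib_left hom_part_def restrict_terms_add)
qed

section \<open>Divisibility by variables\<close>

lemma monom_quot_monom_mult: "monom_quot s (monom s * q) = (q :: 'k::field mpoly)"
  by (intro poly_mapping_eqI) (simp add: lookup_monom_quot lookup_monom_mult expo_dvd_iff_add)

definition var_quot :: "nat \<Rightarrow> 'k::field mpoly \<Rightarrow> 'k mpoly" where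
  "var_quot i = monom_quot (Poly_Mapping.single i 1)"

lemma mvar_mult_var_quot: "mvar i dvd p \<Longrightarrow> mvar i * var_quot i p = p"
  by (auto simp: var_quot_def mvar_def monom_quot_monom_mult elim!: dvdE)

lemma var_quot_zero [simp]: "var_quot i 0 = 0"
  by (intro poly_mapping_eqI) (simp add: var_quot_def lookup_monom_quot)

lemma carrier_var_quot: "p \<in> carrier (poly_ring n) \<Longrightarrow> var_quot i p \<in> carrier (poly_ring n)"
  by (simp add: var_quot_def carrier_monom_quot)

lemma single_expo_dvd_iff: "expo_dvd (Poly_Mapping.single i (Suc 0)) t \<longleftrightarrow> 0 < Poly_Mapping.lookup t i"
  by (auto simp: expo_dvd_def lookup_single when_def)

lemma mvar_dvd_iff:
  fixes p :: "'k::field mpoly"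
  shows "mvar i dvd p \<longleftrightarrow> (\<forall>t\<in>Poly_Mapping.keys p. 0 < Poly_Mapping.lookup t i)"
proof
  assume "mvar i dvd p"
  then obtain q where "p = monom (Poly_Mapping.single i 1) * q"
    by (auto simp: mvar_def elim: dvdE)
  then show "\<forall>t\<in>Poly_Mapping.keys p. 0 < Poly_Mapping.lookup t i"
    by (auto simp: in_keys_iff lookup_monom_mult single_expo_dvd_iff split: if_splits)
next
  assume "\<forall>t\<in>Poly_Mapping.keys p. 0 < Poly_Mapping.lookup t i"
  then have "monom (Poly_Mapping.single i 1) * monom_quot (Poly_Mapping.single i 1) p = p"
    by (intro monom_mult_monom_quot) (simp only: single_expo_dvd_iff One_nat_def)
  then show "mvar i dvd p"
    unfolding mvar_def by (metis dvd_triv_left)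
qed

text \<open>
  Compare exponents of \<open>x\<^sub>a\<close>: a term of \<open>p\<close>, multiplied by another variable, becomes divisible by \<open>x\<^sub>a\<close> only
  if it was so before.
\<close>

lemma mvar_coprime:
  fixes p q :: "'k::field mpoly"
  assumes "mvar b * p = mvar a * q" "a \<noteq> b"
  shows "mvar a dvd p"
  unfolding mvar_dvd_iff
proof
  fix t assume "t \<in> Poly_Mapping.keys p"
  then have "Poly_Mapping.single b 1 + t \<in> Poly_Mapping.keys (mvar b * p)"
    by (simp add: in_keys_iff mvar_def lookup_monom_mult expo_dvd_iff_add)
  moreover have "\<forall>u\<in>Poly_Mapping.keys (mvar b * p). 0 < Poly_Mapping.lookup u a"
    unfolding mvar_dvd_iff[symmetric] assms(1) by simp
  ultimately show "0 < Poly_Mapping.lookup t a"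
    using assms(2) by (auto simp: lookup_add lookup_single when_def)
qed

section \<open>Matrices over the polynomial ring\<close>

definition mat_vec :: "nat \<Rightarrow> nat \<Rightarrow> (nat \<Rightarrow> nat \<Rightarrow> 'k::field mpoly) \<Rightarrow> (nat \<Rightarrow> 'k mpoly) \<Rightarrow> nat \<Rightarrow> 'k mpoly"
  where "mat_vec r c A v = (\<lambda>a. if a < r then (\<Sum>b<c. A a b * v b) else 0)"

definition unit_vec :: "nat \<Rightarrow> nat \<Rightarrow> 'k::field mpoly" where
  "unit_vec b = (\<lambda>k. if k = b then 1 else 0)"

definition poly_matrix :: "nat \<Rightarrow> nat \<Rightarrow> nat \<Rightarrow> (nat \<Rightarrow> nat \<Rightarrow> 'k::field mpoly) \<Rightarrow> bool" where
  "poly_matrix n r c A \<longleftrightarrow> (\<forall>a<r. \<forall>b<c. A a b \<in> carrier (poly_ring n))"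

definition graded_matrix ::
  "nat \<Rightarrow> nat \<Rightarrow> nat \<Rightarrow> (nat \<Rightarrow> int) \<Rightarrow> (nat \<Rightarrow> int) \<Rightarrow> (nat \<Rightarrow> nat \<Rightarrow> 'k::field mpoly) \<Rightarrow> bool" where
  "graded_matrix n r c dr dc A \<longleftrightarrow>
     poly_matrix n r c A \<and> (\<forall>a<r. \<forall>b<c. homogeneous (dc b - dr a) (A a b))"

text \<open>
  Linearity in the form in which it is used below: a linear map is determined by the images of the basis
  vectors (lemma \<open>linear_map_ext\<close>), and this form is inherited by composites with matrices.
\<close>

definition linear_map :: "nat \<Rightarrow> nat \<Rightarrow> ((nat \<Rightarrow> 'k::field mpoly) \<Rightarrow> nat \<Rightarrow> 'k mpoly) \<Rightarrow> bool" where
  "linear_map n c L \<longleftrightarrow> (\<forall>v\<in>free_mod n c. \<forall>a. L v a = (\<Sum>b<c. v b * L (unit_vec b) a))"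

lemma diff_map_mat_vec: "diff_map F i = mat_vec (rk F i) (rk F (Suc i)) (diff F i)"
  by (simp add: diff_map_def mat_vec_def fun_eq_iff)

lemma unit_vec_in_free_mod: "b < c \<Longrightarrow> unit_vec b \<in> free_mod n c"
  by (auto simp: free_mod_def unit_vec_def poly_ring_closed)

lemma mat_vec_unit_vec: "b < c \<Longrightarrow> mat_vec r c A (unit_vec b) = (\<lambda>a. if a < r then A a b else 0)"
  by (auto simp: mat_vec_def unit_vec_def fun_eq_iff if_distrib[of "(*) _"] cong: if_cong)

lemma mat_vec_in_free_mod: "poly_matrix n r c A \<Longrightarrow> v \<in> free_mod n c \<Longrightarrow> mat_vec r c A v \<in> free_mod n r"
  by (auto simp: poly_matrix_def free_mod_def mat_vec_def intro!: carrier_sum poly_ring_closed)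

lemma mat_vec_zero [simp]: "mat_vec r c A (\<lambda>_. 0) = (\<lambda>_. 0)"
  by (simp add: mat_vec_def fun_eq_iff)

lemma mat_vec_diff: "mat_vec r c A (\<lambda>a. v a - w a) = (\<lambda>a. mat_vec r c A v a - mat_vec r c A w a)"
  by (simp add: mat_vec_def fun_eq_iff right_diff_distrib sum_subtractf)

lemma free_mod_diff:
  "v \<in> free_mod n r \<Longrightarrow> w \<in> free_mod n r \<Longrightarrow> (\<lambda>a. v a - w a) \<in> free_mod n r"
  by (simp add: free_mod_def carrier_minus)

lemma linear_map_mat_vec: "linear_map n c (mat_vec r c A)"
  unfolding linear_map_def
proof (intro ballI allI)
  fix v :: "nat \<Rightarrow> 'a mpoly" and a
  have "(\<Sum>b<c. v b * mat_vec r c A (unit_vec b) a) = (\<Sum>b<c. v b * (if a < r then A a b else 0))"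
    by (intro sum.cong) (auto simp: mat_vec_unit_vec)
  then show "mat_vec r c A v a = (\<Sum>b<c. v b * mat_vec r c A (unit_vec b) a)"
    by (simp add: mat_vec_def mult.commute)
qed

lemma linear_map_id: "linear_map n c (\<lambda>v. v)"
proof -
  have "v a = (\<Sum>b<c. v b * unit_vec b a)" if "v \<in> free_mod n c" for v :: "nat \<Rightarrow> 'a mpoly" and a
  proof -
    have "(\<Sum>b<c. v b * unit_vec b a) = (\<Sum>b<c. if b = a then v b else 0)"
      by (rule sum.cong) (auto simp: unit_vec_def)
    also have "\<dots> = v a"
      using that by (auto simp: free_mod_def)
    finally show ?thesis ..
  qed
  then show ?thesis
    by (simp add: linear_map_def)
qed

lemma linear_map_diff: "linear_map n c L \<Longrightarrow> linear_map n c L' \<Longrightarrow> linear_map n c (\<lambda>v a. L v a - L' v a)"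
  by (simp add: linear_map_def right_diff_distrib sum_subtractf)

lemma linear_map_comp:
  assumes "linear_map n c L"
  shows "linear_map n c (\<lambda>v. mat_vec r c' A (L v))"
  unfolding linear_map_def
proof (intro ballI allI)
  fix v :: "nat \<Rightarrow> 'a mpoly" and a
  assume v: "v \<in> free_mod n c"
  have L: "L v k = (\<Sum>b<c. v b * L (unit_vec b) k)" for k
    using assms v by (simp add: linear_map_def)
  have "(\<Sum>k<c'. A a k * L v k) = (\<Sum>b<c. v b * (\<Sum>k<c'. A a k * L (unit_vec b) k))"
    unfolding L sum_distrib_left by (subst sum.swap) (simp add: ac_simps)
  then show "mat_vec r c' A (L v) a = (\<Sum>b<c. v b * mat_vec r c' A (L (unit_vec b)) a)"
    by (simp add: mat_vec_def)
qed

lemma linear_map_ext: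
  assumes "linear_map n c L" "linear_map n c L'" "\<And>b. b < c \<Longrightarrow> L (unit_vec b) = L' (unit_vec b)" "v \<in> free_mod n c"
  shows "L v = L' v"
  using assms by (simp add: linear_map_def fun_eq_iff)

text \<open>
  The component of degree \<open>e\<close> of a vector in the graded free module whose \<open>a\<close>-th basis element has
  degree \<open>d a\<close>.
\<close>

definition hom_part_vec :: "int \<Rightarrow> (nat \<Rightarrow> int) \<Rightarrow> (nat \<Rightarrow> 'k::field mpoly) \<Rightarrow> nat \<Rightarrow> 'k mpoly" where
  "hom_part_vec e d w = (\<lambda>a. hom_part (e - d a) (w a))"

lemma hom_part_zero [simp]: "hom_part e 0 = 0"
  by (simp add: hom_part_homogeneous)

lemma hom_part_sum: "hom_part e (\<Sum>x\<in>A. f x) = (\<Sum>x\<in>A. hom_part e (f x))"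
  by (simp add: hom_part_def restrict_terms_sum)

lemma hom_part_vec_in_free_mod: "w \<in> free_mod n r \<Longrightarrow> hom_part_vec e d w \<in> free_mod n r"
  by (auto simp: free_mod_def hom_part_vec_def carrier_hom_part)

lemma hom_part_vec_idem: "hom_part_vec e d (hom_part_vec e d w) = hom_part_vec e d w"
  by (simp add: hom_part_vec_def hom_part_homogeneous)

text \<open>
  Vectors that equal their component of degree \<open>e\<close> serve as columns of graded matrices.
\<close>

lemma homogeneous_of_hom_part_vec: "hom_part_vec e d w = w \<Longrightarrow> homogeneous (e - d a) (w a)"
  using homogeneous_hom_part[of "e - d a" "w a"] by (simp add: hom_part_vec_def fun_eq_iff)

lemma mat_vec_hom_part_vec:
  assumes "graded_matrix n r c dr dc A"
  shows "mat_vec r c A (hom_part_vec e dc w) = hom_part_vec e dr (mat_vec r c A w)"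
proof
  fix a
  show "mat_vec r c A (hom_part_vec e dc w) a = hom_part_vec e dr (mat_vec r c A w) a"
  proof (cases "a < r")
    case True
    have "A a b * hom_part (e - dc b) (w b) = hom_part (e - dr a) (A a b * w b)" if "b < c" for b
    proof -
      have "homogeneous (dc b - dr a) (A a b)"
        using assms True that by (simp add: graded_matrix_def)
      from hom_part_mult[OF this, of "e - dr a"] show ?thesis
        by simp
    qed
    then show ?thesis
      using True by (simp add: mat_vec_def hom_part_vec_def hom_part_sum)
  qed (simp add: mat_vec_def hom_part_vec_def)
qed

lemma hom_part_vec_column:
  assumes "graded_matrix n r c dr dc A" "b < c"
  shows "hom_part_vec (dc b) dr (mat_vec r c A (unit_vec b)) = mat_vec r c A (unit_vec b)"
  using assms by (auto simp: mat_vec_unit_vec hom_part_vec_def graded_matrix_def fun_eq_iff hom_part_homogeneous)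

section \<open>Graded resolutions of cyclic modules\<close>

lemma a_inv_poly_ring:
  fixes p :: "'k::field mpoly"
  assumes "p \<in> carrier (poly_ring n)"
  shows "a_inv (poly_ring n) p = - p"
proof -
  interpret R: cring "poly_ring n :: 'k mpoly ring" by (rule poly_ring_cring)
  show ?thesis
    using assms by (intro R.minus_equality) (auto simp: poly_ring_closed)
qed

lemma ideal_poly_ringD:
  fixes J :: "'k::field mpoly set"
  assumes "ideal J (poly_ring n)"
  shows "0 \<in> J"
    and "p \<in> J \<Longrightarrow> p \<in> carrier (poly_ring n)"
    and "p \<in> J \<Longrightarrow> q \<in> J \<Longrightarrow> p + q \<in> J"
    and "p \<in> J \<Longrightarrow> q \<in> J \<Longrightarrow> p - q \<in> J"
    and "p \<in> J \<Longrightarrow> q \<in> carrier (poly_ring n) \<Longrightarrow> q * p \<in> J"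
proof -
  interpret J: ideal J "poly_ring n" by fact
  note sub = additive_subgroup.a_closed[OF ideal.axioms(1)[OF assms]]
    additive_subgroup.zero_closed[OF ideal.axioms(1)[OF assms]]
    additive_subgroup.a_inv_closed[OF ideal.axioms(1)[OF assms]]
  show "0 \<in> J" using sub(2) by simp
  show *: "p \<in> carrier (poly_ring n)" if "p \<in> J" for p using that by (rule J.Icarr)
  show **: "p + q \<in> J" if "p \<in> J" "q \<in> J" for p q using sub(1)[OF that] by simp
  show "p - q \<in> J" if "p \<in> J" "q \<in> J"
    using **[OF that(1), of "- q"] sub(3)[OF that(2)] *[OF that(2)]
    by (simp add: a_inv_poly_ring)
  show "q * p \<in> J" if "p \<in> J" "q \<in> carrier (poly_ring n)"
    using J.I_l_closed[OF that] by simp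
qed

lemma ideal_sum:
  fixes J :: "'k::field mpoly set"
  assumes "ideal J (poly_ring n)" "\<And>x. x \<in> A \<Longrightarrow> f x \<in> J"
  shows "(\<Sum>x\<in>A. f x) \<in> J"
  using assms(2)
  by (induction A rule: infinite_finite_induct) (auto simp: ideal_poly_ringD[OF assms(1)])

lemma coset_eq_iff:
  fixes J :: "'k::field mpoly set"
  assumes "ideal J (poly_ring n)"
  shows "J +>\<^bsub>poly_ring n\<^esub> p = J +>\<^bsub>poly_ring n\<^esub> q \<longleftrightarrow> p - q \<in> J"
proof
  note J = ideal_poly_ringD[OF assms]
  have coset: "J +>\<^bsub>poly_ring n\<^esub> r = (\<lambda>h. h + r) ` J" for r
    by (auto simp: a_r_coset_def' )
  {
    assume "J +>\<^bsub>poly_ring n\<^esub> p = J +>\<^bsub>poly_ring n\<^esub> q"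
    then have "0 + p \<in> (\<lambda>h. h + q) ` J"
      unfolding coset using J(1) by blast
    then show "p - q \<in> J"
      by auto
  next
    assume pq: "p - q \<in> J"
    have "h + p = (h + (p - q)) + q" "h + q = (h - (p - q)) + p" for h
      by simp_all
    then show "J +>\<^bsub>poly_ring n\<^esub> p = J +>\<^bsub>poly_ring n\<^esub> q"
      unfolding coset using J(3,4) pq by blast
  }
qed

lemma quot_module_sel:
  "carrier (quot_module n J) = {J +>\<^bsub>poly_ring n\<^esub> p | p. p \<in> carrier (poly_ring n)}"
  "zero (quot_module n J) = J"
  "component (quot_module n J) d =
     {J +>\<^bsub>poly_ring n\<^esub> p | p. p \<in> carrier (poly_ring n) \<and> homogeneous d p}"
  by (auto simp: quot_module_def FactRing_def A_RCOSETS_def')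

lemma quot_module_ops:
  fixes J :: "'k::field mpoly set"
  assumes "ideal J (poly_ring n)" "p \<in> carrier (poly_ring n)" "q \<in> carrier (poly_ring n)"
  shows "add (quot_module n J) (J +>\<^bsub>poly_ring n\<^esub> p) (J +>\<^bsub>poly_ring n\<^esub> q)
           = J +>\<^bsub>poly_ring n\<^esub> (p + q)"
    and "smult (quot_module n J) p (J +>\<^bsub>poly_ring n\<^esub> q) = J +>\<^bsub>poly_ring n\<^esub> (p * q)"
proof -
  interpret R: cring "poly_ring n :: 'k mpoly ring" by (rule poly_ring_cring)
  interpret J: ideal J "poly_ring n" by fact
  interpret h: ring_hom_cring "poly_ring n" "poly_ring n Quot J" "(+>\<^bsub>poly_ring n\<^esub>) J"
    by (rule J.rcos_ring_hom_cring[OF R.is_cring])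
  show "add (quot_module n J) (J +>\<^bsub>poly_ring n\<^esub> p) (J +>\<^bsub>poly_ring n\<^esub> q)
           = J +>\<^bsub>poly_ring n\<^esub> (p + q)"
    using h.hom_add[OF assms(2,3)] by (simp add: quot_module_def)
  show "smult (quot_module n J) p (J +>\<^bsub>poly_ring n\<^esub> q) = J +>\<^bsub>poly_ring n\<^esub> (p * q)"
    using h.hom_mult[OF assms(2,3)] by (simp add: quot_module_def)
qed

text \<open>
  In a quotient of the polynomial ring the augmentation can be computed with representatives. This turns
  statements about the augmentation into membership in \<open>J\<close>.
\<close>

lemma aug_map_quot:
  fixes J :: "'k::field mpoly set"
  assumes J: "ideal J (poly_ring n)"
    and p: "\<And>k. k < rk F 0 \<Longrightarrow> p k \<in> carrier (poly_ring n) \<and> aug F k = J +>\<^bsub>poly_ring n\<^esub> p k"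
    and v: "v \<in> free_mod n (rk F 0)"
  shows "aug_map (quot_module n J) F v = J +>\<^bsub>poly_ring n\<^esub> (\<Sum>k<rk F 0. v k * p k)"
proof -
  let ?M = "quot_module n J"
  interpret M: module "poly_ring n" ?M by (rule quot_module_module[OF J])
  have vp: "v k * p k \<in> carrier (poly_ring n)" if "k < rk F 0" for k
    using p[OF that] v that by (auto simp: free_mod_def intro: poly_ring_closed)
  have smult_aug: "v k \<odot>\<^bsub>?M\<^esub> aug F k = J +>\<^bsub>poly_ring n\<^esub> (v k * p k)" if "k < rk F 0" for k
    using p[OF that] v that by (simp add: free_mod_def quot_module_ops(2)[OF J])
  have "(\<Oplus>\<^bsub>?M\<^esub>k\<in>{..<s}. v k \<odot>\<^bsub>?M\<^esub> aug F k) = J +>\<^bsub>poly_ring n\<^esub> (\<Sum>k<s. v k * p k)"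
    if "s \<le> rk F 0" for s
    using that
  proof (induction s)
    case 0
    have "J = J +>\<^bsub>poly_ring n\<^esub> 0"
      by (auto simp: a_r_coset_def')
    then show ?case
      by (simp add: quot_module_sel)
  next
    case (Suc s)
    have "v k \<odot>\<^bsub>?M\<^esub> aug F k \<in> carrier ?M" if "k < Suc s" for k
    proof -
      have "k < rk F 0"
        using that Suc.prems by simp
      then show ?thesis
        using vp smult_aug unfolding quot_module_sel by blast
    qed
    then have "(\<Oplus>\<^bsub>?M\<^esub>k\<in>{..<Suc s}. v k \<odot>\<^bsub>?M\<^esub> aug F k)
        = v s \<odot>\<^bsub>?M\<^esub> aug F s \<oplus>\<^bsub>?M\<^esub> (\<Oplus>\<^bsub>?M\<^esub>k\<in>{..<s}. v k \<odot>\<^bsub>?M\<^esub> aug F k)"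
      unfolding lessThan_Suc by (intro M.finsum_insert) auto
    also have "\<dots> = (J +>\<^bsub>poly_ring n\<^esub> (v s * p s)) \<oplus>\<^bsub>?M\<^esub> (J +>\<^bsub>poly_ring n\<^esub> (\<Sum>k<s. v k * p k))"
      using Suc smult_aug by simp
    also have "\<dots> = J +>\<^bsub>poly_ring n\<^esub> (v s * p s + (\<Sum>k<s. v k * p k))"
      using Suc.prems by (intro quot_module_ops(1)[OF J] carrier_sum vp) auto
    finally show ?case
      by (simp add: add.commute)
  qed
  then show ?thesis
    by (simp add: aug_map_def)
qed

lemma aug_representatives:
  assumes "graded_free_resolution n (quot_module n J) F"
  shows "\<exists>p. \<forall>k<rk F 0. p k \<in> carrier (poly_ring n) \<and> homogeneous (gdeg F 0 k) (p k) \<and>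
           aug F k = J +>\<^bsub>poly_ring n\<^esub> p k"
proof -
  have "\<exists>p. k < rk F 0 \<longrightarrow> p \<in> carrier (poly_ring n) \<and> homogeneous (gdeg F 0 k) p \<and>
      aug F k = J +>\<^bsub>poly_ring n\<^esub> p" for k
    using assms by (auto simp: graded_free_resolution_def quot_module_sel)
  then have "\<exists>p. \<forall>k. k < rk F 0 \<longrightarrow> p k \<in> carrier (poly_ring n) \<and> homogeneous (gdeg F 0 k) (p k) \<and>
      aug F k = J +>\<^bsub>poly_ring n\<^esub> p k"
    by (intro choice allI)
  then show ?thesis
    by blast
qed

text \<open>
  The kernel of the map that leaves the \<open>i\<close>-th module of an augmented complex. With this notation,
  exactness has the same form in all degrees.
\<close>

definition cycles ::
  "nat \<Rightarrow> ('k::field mpoly, 'b) graded_module \<Rightarrow> ('k mpoly, 'b) free_complex \<Rightarrow> nat \<Rightarrow> (nat \<Rightarrow> 'k mpoly) set"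
  where
  "cycles n M F i = (case i of
       0 \<Rightarrow> {v \<in> free_mod n (rk F 0). aug_map M F v = \<zero>\<^bsub>M\<^esub>}
     | Suc k \<Rightarrow> {v \<in> free_mod n (rk F (Suc k)). diff_map F k v = (\<lambda>_. 0)})"

lemma cycles_eq_image:
  "graded_free_resolution n M F \<Longrightarrow> cycles n M F i = diff_map F i ` free_mod n (rk F (Suc i))"
  by (cases i) (simp_all add: graded_free_resolution_def cycles_def)

lemma graded_matrix_diff:
  "graded_free_resolution n M F
     \<Longrightarrow> graded_matrix n (rk F i) (rk F (Suc i)) (gdeg F i) (gdeg F (Suc i)) (diff F i)"
  by (simp add: graded_free_resolution_def graded_matrix_def poly_matrix_def)

lemma diff_map_in_cycles:
  "graded_free_resolution n M F \<Longrightarrow> v \<in> free_mod n (rk F (Suc i)) \<Longrightarrow> diff_map F i v \<in> cycles n M F i"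
  by (simp add: cycles_eq_image)

text \<open>
  The inductive step of the comparison theorem. Each \<open>\<phi> (d e\<^sub>b)\<close> is a cycle of \<open>G\<close>, hence a boundary \<open>d w\<close>.
  Replacing \<open>w\<close> by its homogeneous component of the degree of \<open>e\<^sub>b\<close> does not change \<open>d w\<close>, since that
  vector is homogeneous itself, and makes the lifted map a graded matrix.
\<close>

lemma lift_step:
  assumes F: "graded_free_resolution n M F" and G: "graded_free_resolution n M G"
    and \<phi>: "graded_matrix n (rk G i) (rk F i) (gdeg G i) (gdeg F i) \<phi>"
    and cycles: "\<And>v. v \<in> cycles n M F i \<Longrightarrow> mat_vec (rk G i) (rk F i) \<phi> v \<in> cycles n M G i"
  shows "\<exists>\<psi>. graded_matrix n (rk G (Suc i)) (rk F (Suc i)) (gdeg G (Suc i)) (gdeg F (Suc i)) \<psi> \<and>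
           (\<forall>v\<in>free_mod n (rk F (Suc i)).
              diff_map G i (mat_vec (rk G (Suc i)) (rk F (Suc i)) \<psi> v) = mat_vec (rk G i) (rk F i) \<phi> (diff_map F i v))"
proof -
  note gF = graded_matrix_diff[OF F, of i] and gG = graded_matrix_diff[OF G, of i]
  have "\<exists>w\<in>free_mod n (rk G (Suc i)).
      diff_map G i w = mat_vec (rk G i) (rk F i) \<phi> (diff_map F i (unit_vec b)) \<and>
      hom_part_vec (gdeg F (Suc i) b) (gdeg G (Suc i)) w = w"
    if b: "b < rk F (Suc i)" for b
  proof -
    let ?e = "gdeg F (Suc i) b" and ?v = "mat_vec (rk G i) (rk F i) \<phi> (diff_map F i (unit_vec b))"
    have "?v \<in> cycles n M G i"
      by (intro cycles diff_map_in_cycles[OF F] unit_vec_in_free_mod b)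
    then obtain w where w: "w \<in> free_mod n (rk G (Suc i))" "?v = diff_map G i w"
      by (auto simp: cycles_eq_image[OF G])
    have "diff_map G i (hom_part_vec ?e (gdeg G (Suc i)) w) = hom_part_vec ?e (gdeg G i) (diff_map G i w)"
      unfolding diff_map_mat_vec by (rule mat_vec_hom_part_vec[OF gG])
    also have "\<dots> = hom_part_vec ?e (gdeg G i) ?v"
      by (simp add: w)
    also have "\<dots> = ?v"
      unfolding diff_map_mat_vec mat_vec_hom_part_vec[OF \<phi>, symmetric] hom_part_vec_column[OF gF b] ..
    finally show ?thesis
      using w(1)
      by (intro bexI[of _ "hom_part_vec ?e (gdeg G (Suc i)) w"])
         (simp_all add: hom_part_vec_in_free_mod hom_part_vec_idem)
  qed
  then obtain W where W: "\<And>b. b < rk F (Suc i) \<Longrightarrow> W b \<in> free_mod n (rk G (Suc i)) \<and>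
      diff_map G i (W b) = mat_vec (rk G i) (rk F i) \<phi> (diff_map F i (unit_vec b)) \<and>
      hom_part_vec (gdeg F (Suc i) b) (gdeg G (Suc i)) (W b) = W b"
    by metis
  define \<psi> where "\<psi> = (\<lambda>a b. W b a)"
  have "homogeneous (gdeg F (Suc i) b - gdeg G (Suc i) a) (W b a)" if "b < rk F (Suc i)" for a b
    using W[OF that] by (intro homogeneous_of_hom_part_vec) simp
  then have "graded_matrix n (rk G (Suc i)) (rk F (Suc i)) (gdeg G (Suc i)) (gdeg F (Suc i)) \<psi>"
    using W by (auto simp: graded_matrix_def poly_matrix_def \<psi>_def free_mod_def)
  moreover have "diff_map G i (mat_vec (rk G (Suc i)) (rk F (Suc i)) \<psi> v) = mat_vec (rk G i) (rk F i) \<phi> (diff_map F i v)"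
    if v: "v \<in> free_mod n (rk F (Suc i))" for v
  proof (rule linear_map_ext[OF _ _ _ v])
    show "linear_map n (rk F (Suc i)) (\<lambda>v. diff_map G i (mat_vec (rk G (Suc i)) (rk F (Suc i)) \<psi> v))"
      and "linear_map n (rk F (Suc i)) (\<lambda>v. mat_vec (rk G i) (rk F i) \<phi> (diff_map F i v))"
      unfolding diff_map_mat_vec by (intro linear_map_comp linear_map_mat_vec)+
    fix b assume b: "b < rk F (Suc i)"
    have "mat_vec (rk G (Suc i)) (rk F (Suc i)) \<psi> (unit_vec b) = W b"
      using W[OF b] by (auto simp: mat_vec_unit_vec[OF b] \<psi>_def free_mod_def fun_eq_iff)
    then show "diff_map G i (mat_vec (rk G (Suc i)) (rk F (Suc i)) \<psi> (unit_vec b))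
        = mat_vec (rk G i) (rk F i) \<phi> (diff_map F i (unit_vec b))"
      using W[OF b] by simp
  qed
  ultimately show ?thesis
    by blast
qed

text \<open>
  The start of the comparison: the generator \<open>aug F b\<close> of the quotient has a preimage in the free module
  of \<open>G\<close>, because the augmentation of \<open>G\<close> is onto. As \<open>J\<close> is homogeneous, the component of the right degree
  of this preimage is a preimage as well.
\<close>

lemma lift_base:
  fixes J :: "'k::field mpoly set"
  assumes J: "ideal J (poly_ring n)" and hJ: "\<And>p d. p \<in> J \<Longrightarrow> hom_part d p \<in> J"
    and F: "graded_free_resolution n (quot_module n J) F"
    and G: "graded_free_resolution n (quot_module n J) G"
  shows "\<exists>\<phi>. graded_matrix n (rk G 0) (rk F 0) (gdeg G 0) (gdeg F 0) \<phi> \<and>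
           (\<forall>v\<in>free_mod n (rk F 0).
              aug_map (quot_module n J) G (mat_vec (rk G 0) (rk F 0) \<phi> v) = aug_map (quot_module n J) F v)"
proof -
  let ?M = "quot_module n J"
  obtain p where p: "\<And>k. k < rk F 0 \<Longrightarrow> p k \<in> carrier (poly_ring n) \<and> homogeneous (gdeg F 0 k) (p k) \<and>
      aug F k = J +>\<^bsub>poly_ring n\<^esub> p k"
    using aug_representatives[OF F] by blast
  obtain q where q: "\<And>k. k < rk G 0 \<Longrightarrow> q k \<in> carrier (poly_ring n) \<and> homogeneous (gdeg G 0 k) (q k) \<and>
      aug G k = J +>\<^bsub>poly_ring n\<^esub> q k"
    using aug_representatives[OF G] by blast
  have augF: "aug_map ?M F v = J +>\<^bsub>poly_ring n\<^esub> (\<Sum>k<rk F 0. v k * p k)"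
    if "v \<in> free_mod n (rk F 0)" for v
    using p that by (intro aug_map_quot[OF J]) auto
  have augG: "aug_map ?M G v = J +>\<^bsub>poly_ring n\<^esub> (\<Sum>k<rk G 0. v k * q k)"
    if "v \<in> free_mod n (rk G 0)" for v
    using q that by (intro aug_map_quot[OF J]) auto
  have "\<exists>w\<in>free_mod n (rk G 0). (\<Sum>a<rk G 0. w a * q a) - p b \<in> J \<and>
      hom_part_vec (gdeg F 0 b) (gdeg G 0) w = w" if b: "b < rk F 0" for b
  proof -
    let ?e = "gdeg F 0 b"
    have "J +>\<^bsub>poly_ring n\<^esub> p b \<in> carrier ?M"
      using p[OF b] by (auto simp: quot_module_sel)
    then have "J +>\<^bsub>poly_ring n\<^esub> p b \<in> aug_map ?M G ` free_mod n (rk G 0)"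
      using G by (simp add: graded_free_resolution_def)
    then obtain w where w: "w \<in> free_mod n (rk G 0)" "J +>\<^bsub>poly_ring n\<^esub> p b = aug_map ?M G w"
      by blast
    from w(2)[symmetric] have "(\<Sum>a<rk G 0. w a * q a) - p b \<in> J"
      unfolding augG[OF w(1)] coset_eq_iff[OF J] .
    from hJ[OF this, of ?e] have "hom_part ?e (\<Sum>a<rk G 0. w a * q a) - hom_part ?e (p b) \<in> J"
      by (simp add: hom_part_def restrict_terms_minus)
    moreover have "hom_part ?e (\<Sum>a<rk G 0. w a * q a) = (\<Sum>a<rk G 0. hom_part_vec ?e (gdeg G 0) w a * q a)"
      unfolding hom_part_sum hom_part_vec_def
    proof (rule sum.cong[OF refl])
      fix a assume "a \<in> {..<rk G 0}"
      then have "homogeneous (gdeg G 0 a) (q a)"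
        using q by simp
      from hom_part_mult[OF this, of ?e "w a"]
      show "hom_part ?e (w a * q a) = hom_part (?e - gdeg G 0 a) (w a) * q a"
        by (simp add: mult.commute)
    qed
    moreover have "hom_part ?e (p b) = p b"
      using p[OF b] by (simp add: hom_part_homogeneous)
    ultimately show ?thesis
      using w(1)
      by (intro bexI[of _ "hom_part_vec ?e (gdeg G 0) w"])
         (simp_all add: hom_part_vec_in_free_mod hom_part_vec_idem)
  qed
  then have "\<forall>b. \<exists>w. b < rk F 0 \<longrightarrow> w \<in> free_mod n (rk G 0) \<and>
      (\<Sum>a<rk G 0. w a * q a) - p b \<in> J \<and> hom_part_vec (gdeg F 0 b) (gdeg G 0) w = w"
    by blast
  from choice[OF this] obtain W where W: "\<And>b. b < rk F 0 \<Longrightarrow> W b \<in> free_mod n (rk G 0) \<and>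
      (\<Sum>a<rk G 0. W b a * q a) - p b \<in> J \<and> hom_part_vec (gdeg F 0 b) (gdeg G 0) (W b) = W b"
    by blast
  define \<phi> where "\<phi> = (\<lambda>a b. W b a)"
  have "homogeneous (gdeg F 0 b - gdeg G 0 a) (W b a)" if "b < rk F 0" for a b
    using W[OF that] by (intro homogeneous_of_hom_part_vec) simp
  then have g\<phi>: "graded_matrix n (rk G 0) (rk F 0) (gdeg G 0) (gdeg F 0) \<phi>"
    using W by (auto simp: graded_matrix_def poly_matrix_def \<phi>_def free_mod_def)
  moreover have "aug_map ?M G (mat_vec (rk G 0) (rk F 0) \<phi> v) = aug_map ?M F v"
    if v: "v \<in> free_mod n (rk F 0)" for v
  proof -
    let ?w = "mat_vec (rk G 0) (rk F 0) \<phi> v"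
    have "?w \<in> free_mod n (rk G 0)"
      using g\<phi> v by (intro mat_vec_in_free_mod) (auto simp: graded_matrix_def)
    moreover have "(\<Sum>a<rk G 0. ?w a * q a) - (\<Sum>b<rk F 0. v b * p b) \<in> J"
    proof -
      have "(\<Sum>a<rk G 0. ?w a * q a) = (\<Sum>a<rk G 0. \<Sum>b<rk F 0. v b * (W b a * q a))"
        by (simp add: mat_vec_def \<phi>_def sum_distrib_left ac_simps)
      also have "\<dots> = (\<Sum>b<rk F 0. v b * (\<Sum>a<rk G 0. W b a * q a))"
        by (subst sum.swap) (simp add: sum_distrib_left)
      finally have "(\<Sum>a<rk G 0. ?w a * q a) - (\<Sum>b<rk F 0. v b * p b)
          = (\<Sum>b<rk F 0. v b * ((\<Sum>a<rk G 0. W b a * q a) - p b))"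
        by (simp add: sum_subtractf right_diff_distrib)
      also have "\<dots> \<in> J"
        using W v by (intro ideal_sum[OF J] ideal_poly_ringD(5)[OF J]) (auto simp: free_mod_def)
      finally show ?thesis .
    qed
    ultimately show ?thesis
      by (simp add: augF[OF v] augG coset_eq_iff[OF J])
  qed
  ultimately show ?thesis
    by blast
qed

text \<open>
  The recursion carries along that \<open>\<phi> i\<close> maps cycles to cycles; this is exactly what \<open>lift_step\<close> consumes,
  and the commuting square that it produces yields the same property one degree higher.
\<close>

lemma chain_map_exists:
  fixes J :: "'k::field mpoly set"
  assumes J: "ideal J (poly_ring n)" and hJ: "\<And>p d. p \<in> J \<Longrightarrow> hom_part d p \<in> J"
    and F: "graded_free_resolution n (quot_module n J) F"
    and G: "graded_free_resolution n (quot_module n J) G"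
  obtains \<phi> where "\<And>i. graded_matrix n (rk G i) (rk F i) (gdeg G i) (gdeg F i) (\<phi> i)"
    and "\<And>v. v \<in> free_mod n (rk F 0) \<Longrightarrow>
           aug_map (quot_module n J) G (mat_vec (rk G 0) (rk F 0) (\<phi> 0) v) = aug_map (quot_module n J) F v"
    and "\<And>i v. v \<in> free_mod n (rk F (Suc i)) \<Longrightarrow>
           diff_map G i (mat_vec (rk G (Suc i)) (rk F (Suc i)) (\<phi> (Suc i)) v)
             = mat_vec (rk G i) (rk F i) (\<phi> i) (diff_map F i v)"
proof -
  let ?M = "quot_module n J"
  let ?P = "\<lambda>i \<phi>. graded_matrix n (rk G i) (rk F i) (gdeg G i) (gdeg F i) \<phi> \<and>
      (\<forall>v\<in>cycles n ?M F i. mat_vec (rk G i) (rk F i) \<phi> v \<in> cycles n ?M G i) \<and>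
      (i = 0 \<longrightarrow> (\<forall>v\<in>free_mod n (rk F 0).
         aug_map ?M G (mat_vec (rk G 0) (rk F 0) \<phi> v) = aug_map ?M F v))"
  let ?Q = "\<lambda>i \<phi> \<psi>. \<forall>v\<in>free_mod n (rk F (Suc i)).
      diff_map G i (mat_vec (rk G (Suc i)) (rk F (Suc i)) \<psi> v) = mat_vec (rk G i) (rk F i) \<phi> (diff_map F i v)"
  have "\<exists>f. \<forall>i. ?P i (f i) \<and> ?Q i (f i) (f (Suc i))"
  proof (rule dependent_nat_choice[of ?P ?Q])
    obtain \<phi> where \<phi>: "graded_matrix n (rk G 0) (rk F 0) (gdeg G 0) (gdeg F 0) \<phi>"
      "\<forall>v\<in>free_mod n (rk F 0). aug_map ?M G (mat_vec (rk G 0) (rk F 0) \<phi> v) = aug_map ?M F v"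
      using lift_base[OF J hJ F G] by blast
    then have "mat_vec (rk G 0) (rk F 0) \<phi> v \<in> cycles n ?M G 0" if "v \<in> cycles n ?M F 0" for v
      using that by (auto simp: cycles_def graded_matrix_def intro: mat_vec_in_free_mod)
    then show "\<exists>\<phi>. ?P 0 \<phi>"
      using \<phi> by blast
  next
    fix \<phi> i
    assume P: "?P i \<phi>"
    then obtain \<psi> where \<psi>: "graded_matrix n (rk G (Suc i)) (rk F (Suc i)) (gdeg G (Suc i)) (gdeg F (Suc i)) \<psi>"
      "?Q i \<phi> \<psi>"
      using lift_step[OF F G, of i \<phi>] by blast
    then have "mat_vec (rk G (Suc i)) (rk F (Suc i)) \<psi> v \<in> cycles n ?M G (Suc i)" if "v \<in> cycles n ?M F (Suc i)" for v
      using that by (auto simp: cycles_def graded_matrix_def intro: mat_vec_in_free_mod)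
    then show "\<exists>\<psi>. ?P (Suc i) \<psi> \<and> ?Q i \<phi> \<psi>"
      using \<psi> by blast
  qed
  then obtain \<phi> where \<phi>: "\<forall>i. ?P i (\<phi> i) \<and> ?Q i (\<phi> i) (\<phi> (Suc i))"
    by (rule exE)
  show thesis
  proof (rule that[of \<phi>])
    show "graded_matrix n (rk G i) (rk F i) (gdeg G i) (gdeg F i) (\<phi> i)" for i
      using \<phi> by blast
    show "aug_map ?M G (mat_vec (rk G 0) (rk F 0) (\<phi> 0) v) = aug_map ?M F v"
      if "v \<in> free_mod n (rk F 0)" for v
      using \<phi> that by blast
    show "diff_map G i (mat_vec (rk G (Suc i)) (rk F (Suc i)) (\<phi> (Suc i)) v)
             = mat_vec (rk G i) (rk F i) (\<phi> i) (diff_map F i v)"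
      if "v \<in> free_mod n (rk F (Suc i))" for i v
      using \<phi> that by blast
  qed
qed

text \<open>
  The lifting argument without degrees, for the null homotopy: there only the absence of constant terms
  in the differentials matters.
\<close>

lemma lift_ungraded:
  assumes F: "graded_free_resolution n M F"
    and L: "linear_map n c L" "\<And>b. b < c \<Longrightarrow> L (unit_vec b) \<in> cycles n M F i"
  shows "\<exists>h. poly_matrix n (rk F (Suc i)) c h \<and>
           (\<forall>v\<in>free_mod n c. L v = diff_map F i (mat_vec (rk F (Suc i)) c h v))"
proof -
  have "\<forall>b<c. \<exists>w\<in>free_mod n (rk F (Suc i)). L (unit_vec b) = diff_map F i w"
    using L(2) by (auto simp: cycles_eq_image[OF F])
  then obtain W where W: "\<And>b. b < c \<Longrightarrow> W b \<in> free_mod n (rk F (Suc i)) \<and> L (unit_vec b) = diff_map F i (W b)"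
    by metis
  define h where "h = (\<lambda>a b. W b a)"
  have "L v = diff_map F i (mat_vec (rk F (Suc i)) c h v)" if v: "v \<in> free_mod n c" for v
  proof (rule linear_map_ext[OF L(1) _ _ v])
    show "linear_map n c (\<lambda>v. diff_map F i (mat_vec (rk F (Suc i)) c h v))"
      unfolding diff_map_mat_vec by (intro linear_map_comp linear_map_mat_vec)
    fix b assume b: "b < c"
    have "mat_vec (rk F (Suc i)) c h (unit_vec b) = W b"
      using W[OF b] by (auto simp: mat_vec_unit_vec[OF b] h_def free_mod_def fun_eq_iff)
    then show "L (unit_vec b) = diff_map F i (mat_vec (rk F (Suc i)) c h (unit_vec b))"
      using W[OF b] by simp
  qed
  moreover have "poly_matrix n (rk F (Suc i)) c h"
    using W by (auto simp: poly_matrix_def h_def free_mod_def)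
  ultimately show ?thesis
    by blast
qed

text \<open>
  Gaussian elimination: an equation \<open>t\<close> with a nonzero coefficient at \<open>b0\<close> is used to eliminate the unknown
  \<open>b0\<close> from the other equations, which leaves one equation and one unknown less.
\<close>

lemma homogeneous_system_nontrivial:
  fixes A :: "'t \<Rightarrow> 's \<Rightarrow> 'k::field"
  assumes "finite T" "finite S" "card T < card S"
  shows "\<exists>x. (\<exists>b\<in>S. x b \<noteq> 0) \<and> (\<forall>a\<in>T. (\<Sum>b\<in>S. A a b * x b) = 0)"
  using assms
proof (induction T arbitrary: S A rule: finite_induct)
  case empty
  then obtain b where "b \<in> S"
    by fastforce
  then show ?case
    by (intro exI[of _ "\<lambda>_. 1"]) auto
next
  case (insert t T)
  show ?case
  proof (cases "\<forall>b\<in>S. A t b = 0")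
    case True
    have "card T < card S"
      using insert by simp
    then show ?thesis
      using insert.IH[OF insert.prems(1), of A] True by auto
  next
    case False
    then obtain b0 where b0: "b0 \<in> S" "A t b0 \<noteq> 0"
      by blast
    define S' where "S' = S - {b0}"
    define A' where "A' = (\<lambda>a b. A a b - A a b0 * A t b / A t b0)"
    have S: "S = insert b0 S'" "b0 \<notin> S'" "finite S'"
      using b0 insert.prems by (auto simp: S'_def)
    have "card T < card S'"
      using insert S by simp
    from insert.IH[OF S(3) this, of A'] obtain x where
      x: "\<exists>b\<in>S'. x b \<noteq> 0" "\<forall>a\<in>T. (\<Sum>b\<in>S'. A' a b * x b) = 0"
      by blast
    define y where "y = x(b0 := - (\<Sum>b\<in>S'. A t b * x b) / A t b0)"
    have y: "(\<Sum>b\<in>S. A a b * y b) = (\<Sum>b\<in>S'. A a b * x b) - A a b0 * (\<Sum>b\<in>S'. A t b * x b) / A t b0" for a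
    proof -
      have "(\<Sum>b\<in>S'. A a b * y b) = (\<Sum>b\<in>S'. A a b * x b)"
        using S(2) by (intro sum.cong) (auto simp: y_def)
      then show ?thesis
        using S(2,3) by (simp add: S(1) y_def)
    qed
    have "(\<Sum>b\<in>S. A t b * y b) = 0"
      using b0 by (simp add: y)
    moreover have "(\<Sum>b\<in>S. A a b * y b) = 0" if "a \<in> T" for a
    proof -
      have "(\<Sum>b\<in>S'. A' a b * x b) = (\<Sum>b\<in>S'. A a b * x b) - A a b0 * (\<Sum>b\<in>S'. A t b * x b) / A t b0"
      proof -
        have "A' a b * x b = A a b * x b - A a b0 / A t b0 * (A t b * x b)" for b
          by (simp add: A'_def left_diff_distrib)
        then show ?thesis
          by (simp add: sum_subtractf sum_distrib_left[symmetric] sum_divide_distrib[symmetric])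
      qed
      then show ?thesis
        using x(2) that y by simp
    qed
    moreover have "\<exists>b\<in>S. y b \<noteq> 0"
      using x(1) S by (auto simp: y_def)
    ultimately show ?thesis
      by (intro exI[of _ y]) auto
  qed
qed

lemma card_le_of_left_inverse:
  fixes A :: "'t \<Rightarrow> 's \<Rightarrow> 'k::field"
  assumes "finite T" "finite S"
    and inv: "\<And>b c. b \<in> S \<Longrightarrow> c \<in> S \<Longrightarrow> (\<Sum>a\<in>T. B b a * A a c) = (if b = c then 1 else 0)"
  shows "card S \<le> card T"
proof (rule ccontr)
  assume "\<not> card S \<le> card T"
  then obtain x b where x: "b \<in> S" "x b \<noteq> 0" "\<forall>a\<in>T. (\<Sum>c\<in>S. A a c * x c) = 0"
    using homogeneous_system_nontrivial[OF assms(1,2), of A] by (metis not_le)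
  have "x b = (\<Sum>c\<in>S. (if b = c then 1 else 0) * x c)"
    using x(1) assms(2) by (simp add: if_distrib[of "\<lambda>z. z * _"] cong: if_cong)
  also have "\<dots> = (\<Sum>c\<in>S. (\<Sum>a\<in>T. B b a * A a c) * x c)"
    using inv x(1) by (intro sum.cong) auto
  also have "\<dots> = (\<Sum>c\<in>S. \<Sum>a\<in>T. B b a * (A a c * x c))"
    by (simp add: sum_distrib_right mult.assoc)
  also have "\<dots> = (\<Sum>a\<in>T. B b a * (\<Sum>c\<in>S. A a c * x c))"
    by (subst sum.swap) (simp add: sum_distrib_left)
  also have "\<dots> = 0"
    using x(3) by simp
  finally show False
    using x(2) by simp
qed

text \<open>
  For chain maps \<open>\<phi> : F \<rightarrow> G\<close> and \<open>\<psi> : G \<rightarrow> F\<close> over the identity of the quotient, \<open>\<psi>\<phi> - id\<close> is null homotopic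
  on \<open>F\<close>. The differentials of \<open>F\<close> have entries in the ideal of the variables, so all entries of \<open>\<psi>\<phi> - id\<close> lie in the ideal of the variables. Modulo the variables \<open>\<psi>\<phi>\<close> is therefore the
  identity. Entries of \<open>\<phi>\<close> between basis elements of different degrees have no constant term, so this
  identity restricts to each degree \<open>j\<close>, where it bounds the number of basis elements of \<open>F\<close>.
\<close>

theorem minimal_resolution_ranks_le:
  fixes J :: "'k::field mpoly set"
  assumes J: "ideal J (poly_ring n)" and hJ: "\<And>p d. p \<in> J \<Longrightarrow> hom_part d p \<in> J"
    and F: "minimal_graded_free_resolution n (quot_module n J) F"
    and G: "graded_free_resolution n (quot_module n J) G"
  shows "card {k. k < rk F i \<and> gdeg F i k = j} \<le> card {k. k < rk G i \<and> gdeg G i k = j}"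
proof -
  let ?M = "quot_module n J"
  have F': "graded_free_resolution n ?M F"
    using F by (simp add: minimal_graded_free_resolution_def)
  obtain \<phi> where \<phi>: "\<And>i. graded_matrix n (rk G i) (rk F i) (gdeg G i) (gdeg F i) (\<phi> i)"
    "\<And>v. v \<in> free_mod n (rk F 0) \<Longrightarrow>
           aug_map ?M G (mat_vec (rk G 0) (rk F 0) (\<phi> 0) v) = aug_map ?M F v"
    "\<And>i v. v \<in> free_mod n (rk F (Suc i)) \<Longrightarrow>
           diff_map G i (mat_vec (rk G (Suc i)) (rk F (Suc i)) (\<phi> (Suc i)) v)
             = mat_vec (rk G i) (rk F i) (\<phi> i) (diff_map F i v)"
    using chain_map_exists[OF J hJ F' G] by metis
  obtain \<psi> where \<psi>: "\<And>i. graded_matrix n (rk F i) (rk G i) (gdeg F i) (gdeg G i) (\<psi> i)"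
    "\<And>v. v \<in> free_mod n (rk G 0) \<Longrightarrow>
           aug_map ?M F (mat_vec (rk F 0) (rk G 0) (\<psi> 0) v) = aug_map ?M G v"
    "\<And>i v. v \<in> free_mod n (rk G (Suc i)) \<Longrightarrow>
           diff_map F i (mat_vec (rk F (Suc i)) (rk G (Suc i)) (\<psi> (Suc i)) v)
             = mat_vec (rk F i) (rk G i) (\<psi> i) (diff_map G i v)"
    using chain_map_exists[OF J hJ G F'] by metis
  define E where "E = (\<lambda>i v a. mat_vec (rk F i) (rk G i) (\<psi> i) (mat_vec (rk G i) (rk F i) (\<phi> i) v) a - v a)"
  have \<phi>c: "poly_matrix n (rk G i) (rk F i) (\<phi> i)" and \<psi>c: "poly_matrix n (rk F i) (rk G i) (\<psi> i)" for i
    using \<phi>(1) \<psi>(1) by (auto simp: graded_matrix_def)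
  have dc: "poly_matrix n (rk F i) (rk F (Suc i)) (diff F i)" for i
    using graded_matrix_diff[OF F'] by (auto simp: graded_matrix_def)
  have Elin: "linear_map n (rk F i) (E i)" for i
    unfolding E_def by (intro linear_map_diff linear_map_comp linear_map_mat_vec linear_map_id)
  have Efree: "E i v \<in> free_mod n (rk F i)" if "v \<in> free_mod n (rk F i)" for i v
    unfolding E_def using that by (intro free_mod_diff mat_vec_in_free_mod[OF \<phi>c] mat_vec_in_free_mod[OF \<psi>c])
  have Ed: "diff_map F i (E (Suc i) v) = E i (diff_map F i v)" if v: "v \<in> free_mod n (rk F (Suc i))" for i v
  proof -
    have "mat_vec (rk G (Suc i)) (rk F (Suc i)) (\<phi> (Suc i)) v \<in> free_mod n (rk G (Suc i))"
      by (rule mat_vec_in_free_mod[OF \<phi>c v])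
    then show ?thesis
      unfolding E_def diff_map_mat_vec mat_vec_diff
      using \<phi>(3)[OF v] \<psi>(3) by (simp add: diff_map_mat_vec)
  qed
  \<comment> \<open>A null homotopy \<open>h\<close> of \<open>E = \<psi>\<phi> - id\<close>, built degree by degree. To go on from one degree to the
      next it is enough that \<open>E = d h\<close> holds on cycles, where the other term \<open>h d\<close> of a homotopy vanishes.\<close>
  have htpy0: "\<exists>h. poly_matrix n (rk F (Suc 0)) (rk F 0) h \<and>
      (\<forall>v\<in>free_mod n (rk F 0). E 0 v = diff_map F 0 (mat_vec (rk F (Suc 0)) (rk F 0) h v))"
  proof (rule lift_ungraded[OF F' Elin])
    fix b assume "b < rk F 0"
    then have b: "(unit_vec b :: nat \<Rightarrow> 'k mpoly) \<in> free_mod n (rk F 0)"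
      by (rule unit_vec_in_free_mod)
    define u where "u = mat_vec (rk F 0) (rk G 0) (\<psi> 0) (mat_vec (rk G 0) (rk F 0) (\<phi> 0) (unit_vec b))"
    have u: "u \<in> free_mod n (rk F 0)"
      unfolding u_def by (intro mat_vec_in_free_mod[OF \<phi>c] mat_vec_in_free_mod[OF \<psi>c] b)
    have eq: "aug_map ?M F u = aug_map ?M F (unit_vec b)"
      unfolding u_def using \<psi>(2)[OF mat_vec_in_free_mod[OF \<phi>c b]] \<phi>(2)[OF b] by simp
    obtain p where p: "\<And>k. k < rk F 0 \<Longrightarrow> p k \<in> carrier (poly_ring n) \<and> aug F k = J +>\<^bsub>poly_ring n\<^esub> p k"
      using aug_representatives[OF F'] by blast
    have aug: "aug_map ?M F v = J +>\<^bsub>poly_ring n\<^esub> (\<Sum>k<rk F 0. v k * p k)" if "v \<in> free_mod n (rk F 0)" for v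
      using p that by (intro aug_map_quot[OF J])
    have "(\<Sum>k<rk F 0. E 0 (unit_vec b) k * p k) - 0 \<in> J"
      using eq unfolding aug[OF u] aug[OF b] coset_eq_iff[OF J]
      by (simp add: E_def u_def left_diff_distrib sum_subtractf)
    then have "aug_map ?M F (E 0 (unit_vec b)) = J +>\<^bsub>poly_ring n\<^esub> 0"
      unfolding aug[OF Efree[OF b]] coset_eq_iff[OF J] .
    also have "\<dots> = J"
      by (auto simp: a_r_coset_def')
    finally show "E 0 (unit_vec b) \<in> cycles n ?M F 0"
      by (simp add: cycles_def quot_module_sel Efree[OF b])
  qed
  have step: "\<exists>h'. poly_matrix n (rk F (Suc (Suc i))) (rk F (Suc i)) h' \<and>
      (\<forall>v\<in>free_mod n (rk F (Suc i)).
         (\<lambda>a. E (Suc i) v a - mat_vec (rk F (Suc i)) (rk F i) h (diff_map F i v) a)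
           = diff_map F (Suc i) (mat_vec (rk F (Suc (Suc i))) (rk F (Suc i)) h' v))"
    if h: "poly_matrix n (rk F (Suc i)) (rk F i) h"
      and hE: "\<forall>v\<in>cycles n ?M F i. E i v = diff_map F i (mat_vec (rk F (Suc i)) (rk F i) h v)" for i h
  proof (rule lift_ungraded[OF F'])
    show "linear_map n (rk F (Suc i)) (\<lambda>v a. E (Suc i) v a - mat_vec (rk F (Suc i)) (rk F i) h (diff_map F i v) a)"
      unfolding diff_map_mat_vec by (intro linear_map_diff Elin linear_map_comp linear_map_mat_vec)
    fix b assume "b < rk F (Suc i)"
    then have b: "(unit_vec b :: nat \<Rightarrow> 'k mpoly) \<in> free_mod n (rk F (Suc i))"
      by (rule unit_vec_in_free_mod)
    let ?d = "diff_map F i (unit_vec b)"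
    have d: "?d \<in> cycles n ?M F i" "?d \<in> free_mod n (rk F i)"
      using diff_map_in_cycles[OF F' b] mat_vec_in_free_mod[OF dc b] by (simp_all add: diff_map_mat_vec)
    have "diff_map F i (\<lambda>a. E (Suc i) (unit_vec b) a - mat_vec (rk F (Suc i)) (rk F i) h ?d a) = (\<lambda>_. 0)"
      unfolding diff_map_mat_vec mat_vec_diff
      using Ed[OF b] hE d(1) by (simp add: diff_map_mat_vec)
    then show "(\<lambda>a. E (Suc i) (unit_vec b) a - mat_vec (rk F (Suc i)) (rk F i) h ?d a) \<in> cycles n ?M F (Suc i)"
      by (simp add: cycles_def free_mod_diff Efree[OF b] mat_vec_in_free_mod[OF h d(2)])
  qed
  have htpy: "\<exists>h. poly_matrix n (rk F (Suc i)) (rk F i) h \<and>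
      (\<forall>v\<in>cycles n ?M F i. E i v = diff_map F i (mat_vec (rk F (Suc i)) (rk F i) h v))" for i
  proof (induction i)
    case 0
    then show ?case
      using htpy0 by (auto simp: cycles_def)
  next
    case (Suc i)
    then obtain h where h: "poly_matrix n (rk F (Suc i)) (rk F i) h"
      "\<forall>v\<in>cycles n ?M F i. E i v = diff_map F i (mat_vec (rk F (Suc i)) (rk F i) h v)"
      by blast
    obtain h' where h': "poly_matrix n (rk F (Suc (Suc i))) (rk F (Suc i)) h'"
      "\<forall>v\<in>free_mod n (rk F (Suc i)).
         (\<lambda>a. E (Suc i) v a - mat_vec (rk F (Suc i)) (rk F i) h (diff_map F i v) a)
           = diff_map F (Suc i) (mat_vec (rk F (Suc (Suc i))) (rk F (Suc i)) h' v)"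
      using step[OF h] by blast
    have "E (Suc i) v = diff_map F (Suc i) (mat_vec (rk F (Suc (Suc i))) (rk F (Suc i)) h' v)"
      if "v \<in> cycles n ?M F (Suc i)" for v
    proof -
      have v: "v \<in> free_mod n (rk F (Suc i))" "diff_map F i v = (\<lambda>_. 0)"
        using that by (simp_all add: cycles_def)
      then have "(\<lambda>a. E (Suc i) v a - mat_vec (rk F (Suc i)) (rk F i) h (diff_map F i v) a)
          = diff_map F (Suc i) (mat_vec (rk F (Suc (Suc i))) (rk F (Suc i)) h' v)"
        using h'(2) by blast
      then show ?thesis
        unfolding v(2) by simp
    qed
    then show ?case
      using h'(1) by blast
  qed
  let ?c = "\<lambda>p. Poly_Mapping.lookup p (0::expo)"
  have dmin: "?c (mat_vec (rk F i) (rk F (Suc i)) (diff F i) v a) = 0" for i v a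
    using F by (auto simp: mat_vec_def minimal_graded_free_resolution_def lookup_sum lookup_mult_zero)
  \<comment> \<open>In positive degrees \<open>E = d h' + h d\<close>; both terms contain a differential of \<open>F\<close> and so have no constant terms.\<close>
  have const: "?c (E i (unit_vec b) a) = 0" if b: "b < rk F i" for a b
  proof (cases i)
    case 0
    then obtain h where "E 0 (unit_vec b) = diff_map F 0 (mat_vec (rk F (Suc 0)) (rk F 0) h (unit_vec b))"
      using htpy0 b unit_vec_in_free_mod by blast
    then show ?thesis
      by (simp add: 0 diff_map_mat_vec dmin)
  next
    case (Suc i')
    then have b': "(unit_vec b :: nat \<Rightarrow> 'k mpoly) \<in> free_mod n (rk F (Suc i'))"
      using b unit_vec_in_free_mod by blast
    obtain h where h: "poly_matrix n (rk F (Suc i')) (rk F i') h"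
      "\<forall>v\<in>cycles n ?M F i'. E i' v = diff_map F i' (mat_vec (rk F (Suc i')) (rk F i') h v)"
      using htpy by blast
    obtain h' where h': "(\<lambda>a. E (Suc i') (unit_vec b) a - mat_vec (rk F (Suc i')) (rk F i') h (diff_map F i' (unit_vec b)) a)
           = diff_map F (Suc i') (mat_vec (rk F (Suc (Suc i'))) (rk F (Suc i')) h' (unit_vec b))"
      using step[OF h] b' by blast
    have "E i (unit_vec b) a = mat_vec (rk F (Suc i')) (rk F i') h (diff_map F i' (unit_vec b)) a
        + diff_map F (Suc i') (mat_vec (rk F (Suc (Suc i'))) (rk F (Suc i')) h' (unit_vec b)) a"
      using fun_cong[OF h', of a] Suc by (simp add: diff_eq_eq add.commute)
    moreover have "?c (mat_vec (rk F (Suc i')) (rk F i') h (diff_map F i' (unit_vec b)) a) = 0"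
      by (simp add: mat_vec_def[of "rk F (Suc i')" "rk F i'" h] lookup_sum lookup_mult_zero diff_map_mat_vec dmin)
    ultimately show ?thesis
      by (simp add: lookup_add diff_map_mat_vec dmin)
  qed
  show ?thesis
  proof (rule card_le_of_left_inverse[of _ _ "\<lambda>b a. ?c (\<psi> i b a)" "\<lambda>a c. ?c (\<phi> i a c)"])
    fix b c assume "b \<in> {k. k < rk F i \<and> gdeg F i k = j}" "c \<in> {k. k < rk F i \<and> gdeg F i k = j}"
    then have bc: "b < rk F i" "c < rk F i" "gdeg F i b = j" "gdeg F i c = j"
      by auto
    have "mat_vec (rk F i) (rk G i) (\<psi> i) (mat_vec (rk G i) (rk F i) (\<phi> i) (unit_vec c)) b
        = (\<Sum>a<rk G i. \<psi> i b a * \<phi> i a c)"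
      using bc by (simp add: mat_vec_unit_vec) (simp add: mat_vec_def)
    then have "(\<Sum>a<rk G i. ?c (\<psi> i b a) * ?c (\<phi> i a c)) = (if b = c then 1 else 0)"
      using const[OF bc(2), of b]
      by (simp add: E_def lookup_minus lookup_sum lookup_mult_zero unit_vec_def lookup_one split: if_splits)
    moreover have "?c (\<psi> i b a) * ?c (\<phi> i a c) = 0" if "a < rk G i" "gdeg G i a \<noteq> j" for a
    proof -
      have "homogeneous (gdeg F i c - gdeg G i a) (\<phi> i a c)"
        using \<phi>(1)[of i] bc(2) that(1) unfolding graded_matrix_def by blast
      then show ?thesis
        using homogeneous_constant_term[of _ "\<phi> i a c"] bc that by fastforce
    qed
    ultimately show "(\<Sum>a\<in>{k. k < rk G i \<and> gdeg G i k = j}. ?c (\<psi> i b a) * ?c (\<phi> i a c))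
        = (if b = c then 1 else 0)"
      by (subst sum.mono_neutral_left[of "{..<rk G i}"]) auto
  qed auto
qed

corollary betti_eq_rank:
  fixes J :: "'k::field mpoly set"
  assumes J: "ideal J (poly_ring n)" and hJ: "\<And>p d. p \<in> J \<Longrightarrow> hom_part d p \<in> J"
    and G: "minimal_graded_free_resolution n (quot_module n J) G"
  shows "betti n (quot_module n J) i j = card {k. k < rk G i \<and> gdeg G i k = j}"
proof -
  define F where "F = (SOME F. minimal_graded_free_resolution n (quot_module n J) F)"
  have F: "minimal_graded_free_resolution n (quot_module n J) F"
    unfolding F_def using G by (rule someI)
  have "betti n (quot_module n J) i j = card {k. k < rk F i \<and> gdeg F i k = j}"
    by (simp add: betti_def F_def Let_def)
  also have "\<dots> = card {k. k < rk G i \<and> gdeg G i k = j}"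
    using minimal_resolution_ranks_le[OF J hJ F] minimal_resolution_ranks_le[OF J hJ G] F G
    by (intro order_antisym) (auto simp: minimal_graded_free_resolution_def)
  finally show ?thesis .
qed

section \<open>Monomial ideals\<close>

lemma poly_ideal_intro:
  fixes J :: "'k::field mpoly set"
  assumes "J \<subseteq> carrier (poly_ring n)" "0 \<in> J"
    and add: "\<And>p q. p \<in> J \<Longrightarrow> q \<in> J \<Longrightarrow> p + q \<in> J"
    and mult: "\<And>p q. p \<in> J \<Longrightarrow> q \<in> carrier (poly_ring n) \<Longrightarrow> q * p \<in> J"
  shows "ideal J (poly_ring n)"
proof -
  interpret R: cring "poly_ring n :: 'k mpoly ring" by (rule poly_ring_cring)
  have neg: "- p \<in> J" if "p \<in> J" for p
    using mult[OF that, of "- 1"] by (simp add: poly_ring_closed)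
  show ?thesis
  proof (rule idealI)
    show "subgroup J (add_monoid (poly_ring n :: 'k mpoly ring))"
    proof
      fix p assume p: "p \<in> J"
      have "inv\<^bsub>add_monoid (poly_ring n)\<^esub> p = - p"
        using a_inv_poly_ring[of p n] p assms(1) by (auto simp: a_inv_def)
      then show "inv\<^bsub>add_monoid (poly_ring n)\<^esub> p \<in> J"
        using neg[OF p] by simp
    qed (use assms in auto)
  next
    fix p q assume "p \<in> J" "q \<in> carrier (poly_ring n :: 'k mpoly ring)"
    then show "q \<otimes>\<^bsub>poly_ring n\<^esub> p \<in> J" "p \<otimes>\<^bsub>poly_ring n\<^esub> q \<in> J"
      using mult[of p q] by (simp_all add: mult.commute)
  qed (rule R.ring_axioms)
qed

lemma genideal_ideal:
  fixes X :: "'k::field mpoly set"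
  assumes "X \<subseteq> carrier (poly_ring n)"
  shows "ideal (genideal (poly_ring n) X) (poly_ring n)" "X \<subseteq> genideal (poly_ring n) X"
proof -
  interpret R: cring "poly_ring n :: 'k mpoly ring" by (rule poly_ring_cring)
  show "ideal (genideal (poly_ring n) X) (poly_ring n)" "X \<subseteq> genideal (poly_ring n) X"
    using assms by (rule R.genideal_ideal, rule R.genideal_self)
qed

lemma genideal_least:
  fixes X :: "'k::field mpoly set"
  assumes "ideal J (poly_ring n)" "X \<subseteq> J"
  shows "genideal (poly_ring n) X \<subseteq> J"
proof -
  interpret R: cring "poly_ring n :: 'k mpoly ring" by (rule poly_ring_cring)
  show ?thesis using assms by (rule R.genideal_minimal)
qed

text \<open>
  The family \<open>g\<close> may repeat values, so that the elements of a finite set of cells can index the generators.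
\<close>

lemma genideal_eq_combinations:
  fixes g :: "'c \<Rightarrow> 'k::field mpoly"
  assumes fin: "finite V" and g: "\<And>x. x \<in> V \<Longrightarrow> g x \<in> carrier (poly_ring n)"
  shows "genideal (poly_ring n) (g ` V)
           = {\<Sum>x\<in>V. g x * f x | f. \<forall>x\<in>V. f x \<in> carrier (poly_ring n)}" (is "_ = ?S")
proof
  have gV: "g ` V \<subseteq> carrier (poly_ring n)"
    using g by blast
  have "ideal ?S (poly_ring n)"
  proof (rule poly_ideal_intro)
    show "?S \<subseteq> carrier (poly_ring n)"
      using g by (auto intro!: carrier_sum poly_ring_closed)
    show "0 \<in> ?S"
      by (rule CollectI, rule exI[of _ "\<lambda>_. 0"]) (simp add: poly_ring_closed)
    fix p q :: "'k mpoly" assume p: "p \<in> ?S"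
    then obtain f where f: "p = (\<Sum>x\<in>V. g x * f x)" "\<forall>x\<in>V. f x \<in> carrier (poly_ring n)"
      by blast
    {
      assume "q \<in> ?S"
      then obtain f' where "q = (\<Sum>x\<in>V. g x * f' x)" "\<forall>x\<in>V. f' x \<in> carrier (poly_ring n)"
        by blast
      then show "p + q \<in> ?S"
        using f by (intro CollectI exI[of _ "\<lambda>x. f x + f' x"])
          (simp add: poly_ring_closed distrib_left sum.distrib)
    next
      assume "q \<in> carrier (poly_ring n)"
      then show "q * p \<in> ?S"
        using f by (intro CollectI exI[of _ "\<lambda>x. q * f x"])
          (simp add: poly_ring_closed sum_distrib_left ac_simps)
    }
  qed
  moreover have "g ` V \<subseteq> ?S"
  proof safe
    fix x assume "x \<in> V"
    then show "\<exists>f. g x = (\<Sum>x\<in>V. g x * f x) \<and> (\<forall>x\<in>V. f x \<in> carrier (poly_ring n))"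
      using fin by (intro exI[of _ "\<lambda>y. if y = x then 1 else 0"])
        (auto simp: poly_ring_closed if_distrib[of "(*) _"] cong: if_cong)
  qed
  ultimately show "genideal (poly_ring n) (g ` V) \<subseteq> ?S"
    by (rule genideal_least)
  note J = ideal_poly_ringD[OF genideal_ideal(1)[OF gV]]
  show "?S \<subseteq> genideal (poly_ring n) (g ` V)"
  proof clarify
    fix f :: "'c \<Rightarrow> 'k mpoly" assume f: "\<forall>x\<in>V. f x \<in> carrier (poly_ring n)"
    show "(\<Sum>x\<in>V. g x * f x) \<in> genideal (poly_ring n) (g ` V)"
    proof (rule ideal_sum[OF genideal_ideal(1)[OF gV]])
      fix x assume x: "x \<in> V"
      then have "g x \<in> genideal (poly_ring n) (g ` V)"
        using genideal_ideal(2)[OF gV] by blast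
      then show "g x * f x \<in> genideal (poly_ring n) (g ` V)"
        using J(5)[of "g x" "f x"] f x by (simp add: mult.commute)
    qed
  qed
qed

text \<open>
  The set of polynomials all of whose terms are multiples of generators is closed under the ideal
  operations; conversely such a polynomial is the sum of its terms, and each of these is in the ideal.
\<close>

lemma genideal_monomials:
  assumes G: "\<And>g. g \<in> G \<Longrightarrow> Poly_Mapping.keys g \<subseteq> {1..n}"
  shows "genideal (poly_ring n) (monom ` G :: 'k::field mpoly set)
           = {p \<in> carrier (poly_ring n). \<forall>t\<in>Poly_Mapping.keys p. \<exists>g\<in>G. expo_dvd g t}" (is "?J = ?S")
proof
  have gG: "(monom ` G :: 'k mpoly set) \<subseteq> carrier (poly_ring n)"
    using G by (auto simp: carrier_monom_iff)
  have "ideal ?S (poly_ring n)"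
  proof (rule poly_ideal_intro)
    fix p q assume pq: "p \<in> ?S" "q \<in> ?S"
    then show "p + q \<in> ?S"
      using Poly_Mapping.keys_add[of p q] by (auto simp: poly_ring_closed)
  next
    fix p q :: "'k mpoly" assume p: "p \<in> ?S" and q: "q \<in> carrier (poly_ring n)"
    have "\<exists>g\<in>G. expo_dvd g t" if t: "t \<in> Poly_Mapping.keys (q * p)" for t
    proof -
      obtain a b where ab: "t = a + b" "b \<in> Poly_Mapping.keys p"
        using t Poly_Mapping.keys_mult[of q p] by blast
      then obtain g where "g \<in> G" "expo_dvd g b"
        using p by blast
      moreover have "expo_dvd b t"
        by (simp add: ab expo_dvd_def lookup_add)
      ultimately show ?thesis
        using expo_dvd_trans by blast
    qed
    then show "q * p \<in> ?S"
      using p q by (simp add: poly_ring_closed)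
  qed (auto simp: poly_ring_closed)
  moreover have "monom ` G \<subseteq> ?S"
    using gG by (auto simp: expo_dvd_def)
  ultimately show "?J \<subseteq> ?S"
    by (rule genideal_least)
  note J = ideal_poly_ringD[OF genideal_ideal(1)[OF gG]]
  show "?S \<subseteq> ?J"
  proof
    fix p assume p: "p \<in> ?S"
    have "p = (\<Sum>t\<in>Poly_Mapping.keys p. restrict_terms ((=) t) p)"
    proof (rule poly_mapping_eqI)
      fix u
      have "Poly_Mapping.lookup (\<Sum>t\<in>Poly_Mapping.keys p. restrict_terms ((=) t) p) u
          = (\<Sum>t\<in>Poly_Mapping.keys p. if t = u then Poly_Mapping.lookup p u else 0)"
        by (simp add: lookup_sum lookup_restrict_terms when_def)
      then show "Poly_Mapping.lookup p u = Poly_Mapping.lookup (\<Sum>t\<in>Poly_Mapping.keys p. restrict_terms ((=) t) p) u"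
        by (simp add: in_keys_iff)
    qed
    also have "\<dots> \<in> ?J"
    proof (rule ideal_sum[OF genideal_ideal(1)[OF gG]])
      fix t assume t: "t \<in> Poly_Mapping.keys p"
      then obtain g where g: "g \<in> G" "expo_dvd g t"
        using p by blast
      have "restrict_terms ((=) t) p = monom_quot g (restrict_terms ((=) t) p) * monom g"
        using g by (subst mult.commute, intro monom_mult_monom_quot[symmetric]) (auto simp: keys_restrict_terms)
      moreover have "monom g \<in> ?J"
        using genideal_ideal(2)[OF gG] g by blast
      moreover have "monom_quot g (restrict_terms ((=) t) p) \<in> carrier (poly_ring n)"
        using p by (simp add: carrier_monom_quot carrier_restrict_terms)
      ultimately show "restrict_terms ((=) t) p \<in> ?J"
        using J(5) by metis
    qed
    finally show "p \<in> ?J" .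
  qed
qed

lemma hom_part_genideal_monomials:
  assumes G: "\<And>g. g \<in> G \<Longrightarrow> Poly_Mapping.keys g \<subseteq> {1..n}"
    and "p \<in> genideal (poly_ring n) (monom ` G :: 'k::field mpoly set)"
  shows "hom_part d p \<in> genideal (poly_ring n) (monom ` G)"
proof -
  have "genideal (poly_ring n) (monom ` G :: 'k mpoly set)
      = {p \<in> carrier (poly_ring n). \<forall>t\<in>Poly_Mapping.keys p. \<exists>g\<in>G. expo_dvd g t}"
    by (rule genideal_monomials[OF G])
  with assms(2) show ?thesis
    by (simp add: carrier_hom_part) (simp add: hom_part_def keys_restrict_terms)
qed

text \<open>
  By divisibility of terms the monomials of the ideal are the multiples of the elements of \<open>G\<close>; the
  antichain condition says that no element of \<open>G\<close> is a proper multiple of another.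
\<close>

lemma min_gens_genideal:
  assumes G: "\<And>g. g \<in> G \<Longrightarrow> Poly_Mapping.keys g \<subseteq> {1..n}"
    and anti: "\<And>s t. s \<in> G \<Longrightarrow> t \<in> G \<Longrightarrow> expo_dvd s t \<Longrightarrow> s = t"
  shows "min_gens (genideal (poly_ring n) (monom ` G :: 'k::field mpoly set)) = G"
proof -
  have mem: "(monom t :: 'k mpoly) \<in> genideal (poly_ring n) (monom ` G)
      \<longleftrightarrow> Poly_Mapping.keys t \<subseteq> {1..n} \<and> (\<exists>g\<in>G. expo_dvd g t)" for t
    by (subst genideal_monomials[OF G]) (auto simp: carrier_monom_iff)
  have refl: "expo_dvd t t" for t
    by (simp add: expo_dvd_def)
  show ?thesis
    unfolding min_gens_def mem
  proof safe
    fix t g assume "g \<in> G" "expo_dvd g t"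
      "\<forall>s. Poly_Mapping.keys s \<subseteq> {1..n} \<and> (\<exists>g\<in>G. expo_dvd g s) \<longrightarrow> expo_dvd s t \<longrightarrow> s = t"
    then show "t \<in> G"
      using G refl by metis
  next
    fix t i assume "t \<in> G" "i \<in> Poly_Mapping.keys t"
    then show "i \<in> {1..n}"
      using G by blast
  next
    fix t assume "t \<in> G"
    then show "\<exists>g\<in>G. expo_dvd g t"
      using refl by blast
  next
    fix t s g assume *: "t \<in> G" "expo_dvd s t" "g \<in> G" "expo_dvd g s"
    then have "g = t"
      using anti expo_dvd_trans by blast
    then show "s = t"
      using * expo_dvd_antisym by blast
  qed
qed

section \<open>Resolutions indexed by cells\<close>

text \<open>
  The free module with basis \<open>S\<close>, as functions that vanish outside \<open>S\<close>. In contrast to \<open>free_mod\<close> the basis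
  need not be enumerated, and sums over a large set of cells reduce to the few cells where the
  coefficients do not vanish.
\<close>

definition cell_funs :: "nat \<Rightarrow> 'c set \<Rightarrow> ('c \<Rightarrow> 'k::field mpoly) set" where
  "cell_funs n S = {f. (\<forall>x\<in>S. f x \<in> carrier (poly_ring n)) \<and> (\<forall>x. x \<notin> S \<longrightarrow> f x = 0)}"

text \<open>
  The Betti numbers of \<open>R/J\<close> are counted by the cells of any minimal free resolution whose bases are
  finite sets of cells, with \<open>D x y\<close> the coefficient of the cell \<open>x\<close> in the differential of the cell \<open>y\<close>.
  Enumerating the cells gives a resolution with numbered basis elements, and by \<open>betti_eq_rank\<close> it does
  not matter which minimal resolution is taken.
\<close>

lemma betti_cellular:
  fixes D :: "'c \<Rightarrow> 'c \<Rightarrow> 'k::field mpoly" and dg :: "'c \<Rightarrow> int" and J :: "'k mpoly set"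
  assumes J: "ideal J (poly_ring n)" and hJ: "\<And>p d. p \<in> J \<Longrightarrow> hom_part d p \<in> J"
    and fin: "\<And>i. finite (C i)" and C0: "C 0 = {x0}" and dg0: "dg x0 = 0"
    and D: "\<And>i x y. x \<in> C i \<Longrightarrow> y \<in> C (Suc i) \<Longrightarrow>
              D x y \<in> carrier (poly_ring n) \<and> homogeneous (dg y - dg x) (D x y) \<and>
              Poly_Mapping.lookup (D x y) 0 = 0"
    and J_eq: "J = {\<Sum>y\<in>C 1. D x0 y * f y | f. f \<in> cell_funs n (C 1)}"
    and comp: "\<And>i f x. f \<in> cell_funs n (C (Suc (Suc i))) \<Longrightarrow> x \<in> C i \<Longrightarrow>
              (\<Sum>y\<in>C (Suc i). D x y * (\<Sum>z\<in>C (Suc (Suc i)). D y z * f z)) = 0"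
    and exact: "\<And>i f. f \<in> cell_funs n (C (Suc i)) \<Longrightarrow>
              (\<And>x. x \<in> C i \<Longrightarrow> (\<Sum>y\<in>C (Suc i). D x y * f y) = 0) \<Longrightarrow>
              \<exists>g\<in>cell_funs n (C (Suc (Suc i))). \<forall>y\<in>C (Suc i). f y = (\<Sum>z\<in>C (Suc (Suc i)). D y z * g z)"
  shows "betti n (quot_module n J) i j = card {x \<in> C i. dg x = j}"
proof -
  have "\<forall>i. \<exists>h. bij_betw h {..<card (C i)} (C i)"
    using fin ex_bij_betw_nat_finite by (metis atLeast0LessThan)
  then obtain e where e: "\<And>i. bij_betw (e i) {..<card (C i)} (C i)"
    by metis
  have eC: "e i k \<in> C i" if "k < card (C i)" for i k
    using e[of i] that by (auto simp: bij_betw_def)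
  have ex_index: "\<exists>k<card (C i). x = e i k" if "x \<in> C i" for i x
    using e[of i] that by (auto simp: bij_betw_def)
  have sum_e: "(\<Sum>k<card (C i). f (e i k)) = (\<Sum>x\<in>C i. f x)" for i and f :: "'c \<Rightarrow> 'k mpoly"
    by (rule sum.reindex_bij_betw[OF e])
  define G :: "('k mpoly, 'k mpoly set) free_complex" where
    "G = \<lparr>rk = \<lambda>i. card (C i), gdeg = \<lambda>i k. dg (e i k),
          diff = \<lambda>i a b. D (e i a) (e (Suc i) b), aug = \<lambda>_. J +>\<^bsub>poly_ring n\<^esub> 1\<rparr>"
  have Gsel: "rk G i = card (C i)" "gdeg G i k = dg (e i k)" "diff G i a b = D (e i a) (e (Suc i) b)"
    "aug G k = J +>\<^bsub>poly_ring n\<^esub> 1" for i k a b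
    by (simp_all add: G_def)
  have rk0: "rk G 0 = 1"
    by (simp add: Gsel C0)
  have e0: "e 0 0 = x0"
    using eC[of 0 0] by (simp add: C0)
  \<comment> \<open>The coordinates of a function on cells with respect to the enumeration \<open>e i\<close>.\<close>
  define T where "T = (\<lambda>i (f :: 'c \<Rightarrow> 'k mpoly) k. if k < card (C i) then f (e i k) else 0)"
  have T_free: "T i f \<in> free_mod n (rk G i)" if "f \<in> cell_funs n (C i)" for i f
    using that eC by (auto simp: T_def cell_funs_def free_mod_def Gsel)
  have T_surj: "\<exists>f\<in>cell_funs n (C i). v = T i f" if v: "v \<in> free_mod n (rk G i)" for i v
  proof -
    define f where "f = (\<lambda>x. if x \<in> C i then v (inv_into {..<card (C i)} (e i) x) else 0)"
    have inv: "inv_into {..<card (C i)} (e i) (e i k) = k" if "k < card (C i)" for k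
      using e[of i] that by (auto simp: bij_betw_def)
    have "f (e i k) = v k" if "k < card (C i)" for k
      using that eC inv by (simp add: f_def)
    then have fv: "v = T i f"
      using v by (auto simp: T_def free_mod_def Gsel fun_eq_iff)
    have "f x \<in> carrier (poly_ring n)" if "x \<in> C i" for x
      using ex_index[OF that] v \<open>\<And>k. k < card (C i) \<Longrightarrow> f (e i k) = v k\<close>
      by (auto simp: free_mod_def Gsel)
    then have "f \<in> cell_funs n (C i)"
      by (auto simp: cell_funs_def f_def)
    with fv show ?thesis
      by blast
  qed
  have dT: "diff_map G i (T (Suc i) f) = (\<lambda>a. if a < card (C i) then (\<Sum>y\<in>C (Suc i). D (e i a) y * f y) else 0)"
    for i f
  proof -
    have "(\<Sum>b<card (C (Suc i)). D (e i a) (e (Suc i) b) * T (Suc i) f b) = (\<Sum>y\<in>C (Suc i). D (e i a) y * f y)"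
      for a
      unfolding sum_e[of "\<lambda>y. D (e i a) y * f y" "Suc i", symmetric] by (simp add: T_def)
    then show ?thesis
      by (simp add: diff_map_def Gsel fun_eq_iff)
  qed
  have aug: "aug_map (quot_module n J) G v = J +>\<^bsub>poly_ring n\<^esub> (v 0)"
    if "v \<in> free_mod n (rk G 0)" for v
    using aug_map_quot[OF J, of G "\<lambda>_. 1" v] that by (simp add: Gsel(4) rk0 poly_ring_closed)
  have coset0: "J +>\<^bsub>poly_ring n\<^esub> p = J \<longleftrightarrow> p \<in> J" for p
  proof -
    have "J +>\<^bsub>poly_ring n\<^esub> 0 = J"
      by (auto simp: a_r_coset_def')
    then show ?thesis
      using coset_eq_iff[OF J, of p 0] by simp
  qed
  have v0: "v \<in> free_mod n (rk G 0) \<longleftrightarrow> v 0 \<in> carrier (poly_ring n) \<and> (\<forall>k\<ge>1. v k = 0)" for v :: "nat \<Rightarrow> 'k mpoly"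
    by (auto simp: free_mod_def rk0)
  have "minimal_graded_free_resolution n (quot_module n J) G"
    unfolding minimal_graded_free_resolution_def graded_free_resolution_def
  proof (intro conjI allI impI)
    fix k assume "k < rk G 0"
    then have [simp]: "k = 0"
      by (simp add: rk0)
    show "aug G k \<in> component (quot_module n J) (gdeg G 0 k)"
      by (auto simp: Gsel e0 dg0 quot_module_sel homogeneous_def poly_ring_closed intro!: exI[of _ 1])
  next
    fix i a b assume "a < rk G i" "b < rk G (Suc i)"
    then have "e i a \<in> C i" "e (Suc i) b \<in> C (Suc i)"
      by (simp_all add: Gsel eC)
    then show "diff G i a b \<in> carrier (poly_ring n)"
      "homogeneous (gdeg G (Suc i) b - gdeg G i a) (diff G i a b)"
      "Poly_Mapping.lookup (diff G i a b) 0 = 0"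
      using D by (simp_all add: Gsel)
  next
    show "aug_map (quot_module n J) G ` free_mod n (rk G 0) = carrier (quot_module n J)"
    proof
      show "aug_map (quot_module n J) G ` free_mod n (rk G 0) \<subseteq> carrier (quot_module n J)"
        using aug v0 by (auto simp: quot_module_sel)
      show "carrier (quot_module n J) \<subseteq> aug_map (quot_module n J) G ` free_mod n (rk G 0)"
      proof
        fix X assume "X \<in> carrier (quot_module n J)"
        then obtain p where p: "p \<in> carrier (poly_ring n)" "X = J +>\<^bsub>poly_ring n\<^esub> p"
          by (auto simp: quot_module_sel)
        define v :: "nat \<Rightarrow> 'k mpoly" where "v = (\<lambda>k. if k = 0 then p else 0)"
        have "v \<in> free_mod n (rk G 0)"
          using p by (simp add: v0 v_def)
        moreover from this have "aug_map (quot_module n J) G v = X"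
          using p by (simp add: aug) (simp add: v_def)
        ultimately show "X \<in> aug_map (quot_module n J) G ` free_mod n (rk G 0)"
          by blast
      qed
    qed
  next
    show "{v \<in> free_mod n (rk G 0). aug_map (quot_module n J) G v = \<zero>\<^bsub>quot_module n J\<^esub>}
        = diff_map G 0 ` free_mod n (rk G 1)"
    proof (rule Set.set_eqI)
      fix v
      have "v \<in> {v \<in> free_mod n (rk G 0). aug_map (quot_module n J) G v = \<zero>\<^bsub>quot_module n J\<^esub>}
          \<longleftrightarrow> v \<in> free_mod n (rk G 0) \<and> v 0 \<in> J"
        using aug coset0 by (auto simp: quot_module_sel)
      also have "\<dots> \<longleftrightarrow> (\<exists>f\<in>cell_funs n (C 1). v = diff_map G 0 (T (Suc 0) f))"
      proof
        assume v: "v \<in> free_mod n (rk G 0) \<and> v 0 \<in> J"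
        then obtain f where f: "f \<in> cell_funs n (C 1)" "v 0 = (\<Sum>y\<in>C 1. D x0 y * f y)"
          unfolding J_eq by blast
        have "v = diff_map G 0 (T (Suc 0) f)"
          using v f(2) by (auto simp: dT fun_eq_iff v0 C0 e0)
        then show "\<exists>f\<in>cell_funs n (C 1). v = diff_map G 0 (T (Suc 0) f)"
          using f by blast
      next
        assume "\<exists>f\<in>cell_funs n (C 1). v = diff_map G 0 (T (Suc 0) f)"
        then obtain f where f: "f \<in> cell_funs n (C 1)" "v = diff_map G 0 (T (Suc 0) f)"
          by blast
        have "v 0 = (\<Sum>y\<in>C 1. D x0 y * f y)"
          using f(2) by (simp add: dT C0 e0)
        then have "v 0 \<in> J"
          unfolding J_eq using f(1) by blast
        moreover have "v k = 0" if "k \<ge> 1" for k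
          using that f(2) by (simp add: dT C0)
        ultimately show "v \<in> free_mod n (rk G 0) \<and> v 0 \<in> J"
          using ideal_poly_ringD(2)[OF J] by (auto simp: v0)
      qed
      also have "\<dots> \<longleftrightarrow> v \<in> diff_map G 0 ` free_mod n (rk G 1)"
        using T_free[of _ 1] T_surj[of _ 1] by (auto simp: image_iff)
      finally show "v \<in> {v \<in> free_mod n (rk G 0). aug_map (quot_module n J) G v = \<zero>\<^bsub>quot_module n J\<^esub>}
          \<longleftrightarrow> v \<in> diff_map G 0 ` free_mod n (rk G 1)" .
    qed
  next
    fix i
    show "{v \<in> free_mod n (rk G (Suc i)). diff_map G i v = (\<lambda>_. 0)}
        = diff_map G (Suc i) ` free_mod n (rk G (Suc (Suc i)))"
    proof (intro equalityI subsetI)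
      fix v assume "v \<in> {v \<in> free_mod n (rk G (Suc i)). diff_map G i v = (\<lambda>_. 0)}"
      then obtain f where f: "f \<in> cell_funs n (C (Suc i))" "v = T (Suc i) f" "diff_map G i (T (Suc i) f) = (\<lambda>_. 0)"
        using T_surj by blast
      have "(\<Sum>y\<in>C (Suc i). D x y * f y) = 0" if x: "x \<in> C i" for x
      proof -
        obtain a where a: "a < card (C i)" "x = e i a"
          using ex_index[OF x] by blast
        then show ?thesis
          using fun_cong[OF f(3), of a] by (simp add: dT)
      qed
      then obtain g where g: "g \<in> cell_funs n (C (Suc (Suc i)))"
        "\<forall>y\<in>C (Suc i). f y = (\<Sum>z\<in>C (Suc (Suc i)). D y z * g z)"
        using exact[OF f(1)] by blast
      have "v = diff_map G (Suc i) (T (Suc (Suc i)) g)"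
        unfolding f(2) dT using g(2) eC by (simp add: T_def fun_eq_iff)
      then show "v \<in> diff_map G (Suc i) ` free_mod n (rk G (Suc (Suc i)))"
        using T_free[OF g(1)] by blast
    next
      fix v assume "v \<in> diff_map G (Suc i) ` free_mod n (rk G (Suc (Suc i)))"
      then obtain g where g: "g \<in> cell_funs n (C (Suc (Suc i)))" "v = diff_map G (Suc i) (T (Suc (Suc i)) g)"
        using T_surj by blast
      define f where "f = (\<lambda>y. if y \<in> C (Suc i) then \<Sum>z\<in>C (Suc (Suc i)). D y z * g z else 0)"
      have "f \<in> cell_funs n (C (Suc i))"
        unfolding cell_funs_def f_def using g(1) D
        by (auto simp: cell_funs_def intro!: carrier_sum poly_ring_closed)
      moreover have v: "v = T (Suc i) f"
        unfolding g(2) dT using eC by (auto simp: T_def f_def fun_eq_iff)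
      moreover have "diff_map G i (T (Suc i) f) = (\<lambda>_. 0)"
        using comp[OF g(1)] eC by (simp add: dT f_def fun_eq_iff)
      ultimately show "v \<in> {v \<in> free_mod n (rk G (Suc i)). diff_map G i v = (\<lambda>_. 0)}"
        using T_free by simp
    qed
  qed
  then have "betti n (quot_module n J) i j = card {k. k < card (C i) \<and> dg (e i k) = j}"
    using betti_eq_rank[OF J hJ] by (simp add: Gsel)
  also have "\<dots> = card {x \<in> C i. dg x = j}"
  proof (rule bij_betw_same_card)
    show "bij_betw (e i) {k. k < card (C i) \<and> dg (e i k) = j} {x \<in> C i. dg x = j}"
      using e[of i] ex_index[of _ i] by (auto simp: bij_betw_def inj_on_def)
  qed
  finally show ?thesis .
qed

section \<open>The cells of a shifted diagram\<close>

text \<open>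
  \<open>Hor i j\<close> joins the boxes \<open>(i, j)\<close> and \<open>(i, j + 1)\<close>, \<open>Ver i j\<close> joins \<open>(i, j)\<close> and \<open>(i + 1, j)\<close>, and \<open>Sq i j\<close> has the
  opposite corners \<open>(i, j)\<close> and \<open>(i + 1, j + 1)\<close>. The cell \<open>Apex\<close> is the empty face, the basis element of \<open>R\<close>
  in homological degree 0.
\<close>

datatype cell = Apex | Box nat nat | Hor nat nat | Ver nat nat | Sq nat nat

fun cell_dim :: "cell \<Rightarrow> nat" where
  "cell_dim Apex = 0"
| "cell_dim (Box i j) = 1"
| "cell_dim (Hor i j) = 2"
| "cell_dim (Ver i j) = 2"
| "cell_dim (Sq i j) = 3"

text \<open>
  The coefficient of the first cell in the differential of the second one. It is the quotient of
  their labels up to a sign, and the signs come from the orientation of edges towards larger indices.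
\<close>

fun boundary :: "expo \<Rightarrow> cell \<Rightarrow> cell \<Rightarrow> 'k::field mpoly" where
  "boundary M Apex (Box i j) = monom (M - (Poly_Mapping.single i 1 + Poly_Mapping.single j 1))"
| "boundary M (Box a b) (Hor i j) =
     (if a = i \<and> b = Suc j then mvar b else if a = i \<and> b = j then - mvar b else 0)"
| "boundary M (Box a b) (Ver i j) =
     (if a = Suc i \<and> b = j then mvar a else if a = i \<and> b = j then - mvar a else 0)"
| "boundary M (Hor a b) (Sq i j) =
     (if a = i \<and> b = j then mvar a else if a = Suc i \<and> b = j then - mvar a else 0)"
| "boundary M (Ver a b) (Sq i j) =
     (if a = i \<and> b = Suc j then mvar b else if a = i \<and> b = j then - mvar b else 0)"
| "boundary M _ _ = 0"

text \<open>
  \<open>M\<close> is the exponent of the least common multiple of the monomials \<open>x\<^sub>i x\<^sub>j\<close> of the diagram.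
\<close>

locale shifted_diagram =
  fixes n m :: nat and lam :: "nat \<Rightarrow> nat" and M :: expo
  assumes antitone: "\<And>i j. 1 \<le> i \<Longrightarrow> i \<le> j \<Longrightarrow> j \<le> m \<Longrightarrow> lam j \<le> lam i"
    and rows: "m \<le> lam m" and cols: "n = lam 1" and m1: "m > 1"
    and M: "\<And>k. Poly_Mapping.lookup M k = (if 1 \<le> k \<and> k \<le> m then 2 else if 1 \<le> k \<and> k \<le> n then 1 else 0)"
begin

definition in_shape :: "nat \<Rightarrow> nat \<Rightarrow> bool" where
  "in_shape i j \<longleftrightarrow> 1 \<le> i \<and> i \<le> m \<and> i \<le> j \<and> j \<le> lam i"

fun is_cell :: "cell \<Rightarrow> bool" where
  "is_cell Apex = True"
| "is_cell (Box i j) = in_shape i j"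
| "is_cell (Hor i j) = (in_shape i j \<and> in_shape i (Suc j))"
| "is_cell (Ver i j) = (in_shape i j \<and> in_shape (Suc i) j)"
| "is_cell (Sq i j) = (in_shape i j \<and> in_shape (Suc i) j \<and> in_shape (Suc i) (Suc j))"

definition cells :: "nat \<Rightarrow> cell set" where
  "cells k = {x. is_cell x \<and> cell_dim x = k}"

lemma in_shape_up: "in_shape i j \<Longrightarrow> 1 \<le> k \<Longrightarrow> k \<le> i \<Longrightarrow> in_shape k j"
  using antitone[of k i] by (auto simp: in_shape_def)

lemma in_shape_left: "in_shape i j \<Longrightarrow> i \<le> k \<Longrightarrow> k \<le> j \<Longrightarrow> in_shape i k"
  by (auto simp: in_shape_def)

lemma in_shape_bounds: "in_shape i j \<Longrightarrow> 1 \<le> i \<and> i \<le> m \<and> i \<le> j \<and> j \<le> n"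
  using antitone[of 1 i] cols by (auto simp: in_shape_def)

lemma in_shape_diag: "1 \<le> i \<Longrightarrow> i \<le> m \<Longrightarrow> in_shape i i"
  using antitone[of i m] rows by (auto simp: in_shape_def)

lemma m_le_n: "m \<le> n"
  using in_shape_bounds[OF in_shape_diag[of m]] m1 by simp

lemma finite_cells [simp]: "finite (cells k)"
proof -
  let ?R = "{..m} \<times> {..n}"
  let ?U = "{Apex} \<union> case_prod Box ` ?R \<union> case_prod Hor ` ?R \<union> case_prod Ver ` ?R \<union> case_prod Sq ` ?R"
  have "cells k \<subseteq> ?U"
  proof
    fix x assume "x \<in> cells k"
    then show "x \<in> ?U"
      using in_shape_bounds by (cases x) (auto simp: cells_def image_iff)
  qed
  moreover have "finite ?U"
    by simp
  ultimately show ?thesis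
    by (rule finite_subset)
qed

lemma cells_cases:
  "x \<in> cells 0 \<longleftrightarrow> x = Apex"
  "x \<in> cells (Suc 0) \<longleftrightarrow> (\<exists>i j. x = Box i j \<and> in_shape i j)"
  "x \<in> cells 2 \<longleftrightarrow> (\<exists>i j. x = Hor i j \<and> in_shape i j \<and> in_shape i (Suc j)) \<or> (\<exists>i j. x = Ver i j \<and> in_shape i j \<and> in_shape (Suc i) j)"
  "x \<in> cells 3 \<longleftrightarrow> (\<exists>i j. x = Sq i j \<and> in_shape i j \<and> in_shape (Suc i) j \<and> in_shape (Suc i) (Suc j))"
  by (cases x; auto simp: cells_def)+

lemma cells_empty:
  assumes "4 \<le> k"
  shows "cells k = {}"
proof -
  have "cell_dim x \<noteq> k" for x
    using assms by (cases x) auto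
  then show ?thesis
    by (simp add: cells_def)
qed

lemma zero_row: "\<not> in_shape 0 b"
  by (auto simp: in_shape_def)

lemma cell_funs_zero: "f \<in> cell_funs n (cells k) \<Longrightarrow> \<not> is_cell x \<Longrightarrow> f x = 0"
  by (auto simp: cell_funs_def cells_def)

lemma cell_funs_dim: "f \<in> cell_funs n (cells k) \<Longrightarrow> cell_dim x \<noteq> k \<Longrightarrow> f x = 0"
  by (auto simp: cell_funs_def cells_def)

lemma cell_funs_carrier: "f \<in> cell_funs n (cells k) \<Longrightarrow> f x \<in> carrier (poly_ring n)"
  by (cases "x \<in> cells k") (auto simp: cell_funs_def poly_ring_closed)

section \<open>The differential of the diagram\<close>

text \<open>
  A row of the differential has nonzero entries only at the cofaces of a cell, and functions on cells
  vanish at everything that is not a cell. So a row can be evaluated over all candidates for cofaces,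
  without case distinctions at the border of the diagram.
\<close>

lemma sum_cofaces:
  fixes f :: "cell \<Rightarrow> 'k::field mpoly"
  assumes f: "f \<in> cell_funs n (cells k)" and T: "finite T"
    and out: "\<And>y. cell_dim y = k \<Longrightarrow> y \<notin> T \<Longrightarrow> boundary M x y = (0 :: 'k mpoly)"
  shows "(\<Sum>y\<in>cells k. boundary M x y * f y) = (\<Sum>y\<in>T. boundary M x y * f y)"
proof (rule sum.mono_neutral_cong)
  show "boundary M x y * f y = 0" if "y \<in> cells k - T" for y
    using that out by (simp add: cells_def)
  show "boundary M x y * f y = 0" if "y \<in> T - cells k" for y
    using that f by (simp add: cell_funs_def)
qed (use T in auto)

lemma row_Box:
  fixes g :: "cell \<Rightarrow> 'k::field mpoly"
  assumes g: "g \<in> cell_funs n (cells 2)" and "1 \<le> a" "1 \<le> b"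
  shows "(\<Sum>y\<in>cells 2. boundary M (Box a b) y * g y)
           = mvar b * (g (Hor a (b - 1)) - g (Hor a b)) + mvar a * (g (Ver (a - 1) b) - g (Ver a b))"
proof -
  let ?T = "{Hor a (b - 1), Hor a b, Ver (a - 1) b, Ver a b}"
  have "(\<Sum>y\<in>cells 2. boundary M (Box a b) y * g y) = (\<Sum>y\<in>?T. boundary M (Box a b) y * g y)"
  proof (rule sum_cofaces[OF g])
    fix y assume "cell_dim y = 2" "y \<notin> ?T"
    then show "boundary M (Box a b) y = (0 :: 'k mpoly)"
      by (cases y) auto
  qed simp
  also have "\<dots> = mvar b * (g (Hor a (b - 1)) - g (Hor a b)) + mvar a * (g (Ver (a - 1) b) - g (Ver a b))"
    using assms(2,3) by (cases a; cases b) (simp_all add: algebra_simps)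
  finally show ?thesis .
qed

lemma row_Hor:
  fixes s :: "cell \<Rightarrow> 'k::field mpoly"
  assumes s: "s \<in> cell_funs n (cells 3)" and "1 \<le> a"
  shows "(\<Sum>y\<in>cells 3. boundary M (Hor a b) y * s y) = mvar a * (s (Sq a b) - s (Sq (a - 1) b))"
proof -
  let ?T = "{Sq a b, Sq (a - 1) b}"
  have "(\<Sum>y\<in>cells 3. boundary M (Hor a b) y * s y) = (\<Sum>y\<in>?T. boundary M (Hor a b) y * s y)"
  proof (rule sum_cofaces[OF s])
    fix y assume "cell_dim y = 3" "y \<notin> ?T"
    then show "boundary M (Hor a b) y = (0 :: 'k mpoly)"
      by (cases y) auto
  qed simp
  also have "\<dots> = mvar a * (s (Sq a b) - s (Sq (a - 1) b))"
    using assms(2) by (cases a) (simp_all add: algebra_simps)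
  finally show ?thesis .
qed

lemma row_Ver:
  fixes s :: "cell \<Rightarrow> 'k::field mpoly"
  assumes s: "s \<in> cell_funs n (cells 3)" and "1 \<le> b"
  shows "(\<Sum>y\<in>cells 3. boundary M (Ver a b) y * s y) = mvar b * (s (Sq a (b - 1)) - s (Sq a b))"
proof -
  let ?T = "{Sq a b, Sq a (b - 1)}"
  have "(\<Sum>y\<in>cells 3. boundary M (Ver a b) y * s y) = (\<Sum>y\<in>?T. boundary M (Ver a b) y * s y)"
  proof (rule sum_cofaces[OF s])
    fix y assume "cell_dim y = 3" "y \<notin> ?T"
    then show "boundary M (Ver a b) y = (0 :: 'k mpoly)"
      by (cases y) auto
  qed simp
  also have "\<dots> = mvar b * (s (Sq a (b - 1)) - s (Sq a b))"
    using assms(2) by (cases b) (simp_all add: algebra_simps)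
  finally show ?thesis .
qed

lemma M_split:
  assumes "in_shape i j"
  shows "M - (Poly_Mapping.single i 1 + Poly_Mapping.single j 1) + (Poly_Mapping.single i 1 + Poly_Mapping.single j 1) = M"
proof -
  have "expo_dvd (Poly_Mapping.single i 1 + Poly_Mapping.single j 1) M"
    using in_shape_bounds[OF assms] m_le_n
    by (auto simp: expo_dvd_def M lookup_add lookup_single when_def)
  from expo_dvd_add_diff[OF this] show ?thesis
    by (simp add: add.commute)
qed

text \<open>
  Why the composite of the first two differentials vanishes: at both ends of an edge, the label of the box
  times the coefficient of the box in the edge is the label of the edge.
\<close>

lemma boundary_Apex_mult:
  assumes "in_shape i j"
  shows "boundary M Apex (Box i j) * mvar i = (monom (M - Poly_Mapping.single j 1) :: 'k::field mpoly)"
    and "boundary M Apex (Box i j) * mvar j = (monom (M - Poly_Mapping.single i 1) :: 'k::field mpoly)"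
proof -
  let ?m = "M - (Poly_Mapping.single i 1 + Poly_Mapping.single j 1)"
  have "?m + Poly_Mapping.single i 1 = M - Poly_Mapping.single j 1"
    "?m + Poly_Mapping.single j 1 = M - Poly_Mapping.single i 1"
    using M_split[OF assms] by (metis add.assoc add.commute add_diff_cancel_right')+
  then show "boundary M Apex (Box i j) * mvar i = (monom (M - Poly_Mapping.single j 1) :: 'k mpoly)"
    "boundary M Apex (Box i j) * mvar j = (monom (M - Poly_Mapping.single i 1) :: 'k mpoly)"
    by (simp_all add: mvar_def monom_add[symmetric])
qed

lemma column_Apex:
  assumes z: "z \<in> cells 2"
  shows "(\<Sum>y\<in>cells (Suc 0). boundary M Apex y * boundary M y z) = (0 :: 'k::field mpoly)"
proof -
  have eq: "(\<Sum>y\<in>cells (Suc 0). boundary M Apex y * boundary M y z) = (\<Sum>y\<in>T. boundary M Apex y * boundary M y z :: 'k mpoly)"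
    if "T \<subseteq> cells (Suc 0)" "\<And>y. y \<in> cells (Suc 0) \<Longrightarrow> y \<notin> T \<Longrightarrow> boundary M y z = (0 :: 'k mpoly)" for T
    using that by (intro sum.mono_neutral_right) auto
  from z consider i j where "z = Hor i j" "in_shape i j" "in_shape i (Suc j)" | i j where "z = Ver i j" "in_shape i j" "in_shape (Suc i) j"
    unfolding cells_cases by blast
  then show ?thesis
  proof cases
    case 1
    have "(\<Sum>y\<in>cells (Suc 0). boundary M Apex y * boundary M y z) = (\<Sum>y\<in>{Box i j, Box i (Suc j)}. boundary M Apex y * boundary M y z :: 'k mpoly)"
      by (rule eq) (use 1 in \<open>auto simp: cells_cases split: if_splits\<close>)
    also have "\<dots> = boundary M Apex (Box i (Suc j)) * mvar (Suc j) - boundary M Apex (Box i j) * mvar j"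
      by (simp add: 1)
    also have "\<dots> = 0"
      unfolding boundary_Apex_mult[OF 1(2)] boundary_Apex_mult[OF 1(3)] by simp
    finally show ?thesis .
  next
    case 2
    have "(\<Sum>y\<in>cells (Suc 0). boundary M Apex y * boundary M y z) = (\<Sum>y\<in>{Box i j, Box (Suc i) j}. boundary M Apex y * boundary M y z :: 'k mpoly)"
      by (rule eq) (use 2 in \<open>auto simp: cells_cases split: if_splits\<close>)
    also have "\<dots> = boundary M Apex (Box (Suc i) j) * mvar (Suc i) - boundary M Apex (Box i j) * mvar i"
      by (simp add: 2)
    also have "\<dots> = 0"
      unfolding boundary_Apex_mult[OF 2(2)] boundary_Apex_mult[OF 2(3)] by simp
    finally show ?thesis .
  qed
qed

lemma boundary_boundary_Apex:
  fixes g :: "cell \<Rightarrow> 'k::field mpoly"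
  shows "(\<Sum>y\<in>cells (Suc 0). boundary M Apex y * (\<Sum>z\<in>cells 2. boundary M y z * g z)) = 0"
proof -
  have "(\<Sum>y\<in>cells (Suc 0). boundary M Apex y * (\<Sum>z\<in>cells 2. boundary M y z * g z))
      = (\<Sum>z\<in>cells 2. (\<Sum>y\<in>cells (Suc 0). boundary M Apex y * boundary M y z) * g z)"
    unfolding sum_distrib_left sum_distrib_right by (subst sum.swap) (simp add: mult.assoc)
  then show ?thesis
    by (simp add: column_Apex)
qed

lemma boundary_carrier:
  assumes "is_cell x"
  shows "(boundary M x y :: 'k::field mpoly) \<in> carrier (poly_ring n)"
proof -
  have M_minus: "(monom (M - t) :: 'k mpoly) \<in> carrier (poly_ring n)" for t
    unfolding carrier_monom_iff
  proof
    fix k assume "k \<in> Poly_Mapping.keys (M - t)"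
    then have "0 < Poly_Mapping.lookup M k"
      by (simp add: in_keys_iff lookup_minus)
    then show "k \<in> {1..n}"
      using m_le_n by (auto simp: M split: if_splits)
  qed
  have var: "(mvar a :: 'k mpoly) \<in> carrier (poly_ring n)" "(mvar b :: 'k mpoly) \<in> carrier (poly_ring n)"
    if "in_shape a b" for a b
    using in_shape_bounds[OF that] m_le_n by (auto intro: carrier_mvar)
  show ?thesis
  proof (cases x)
    case Apex
    then show ?thesis
      using M_minus by (cases y) (simp_all add: poly_ring_closed)
  next
    case (Box a b)
    then have "in_shape a b" using assms by simp
    then show ?thesis
      using var[of a b] by (cases y) (auto simp: Box intro: poly_ring_closed)
  next
    case (Hor a b)
    then have "in_shape a b" using assms by simp
    then show ?thesis
      using var[of a b] by (cases y) (auto simp: Hor intro: poly_ring_closed)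
  next
    case (Ver a b)
    then have "in_shape a b" using assms by simp
    then show ?thesis
      using var[of a b] by (cases y) (auto simp: Ver intro: poly_ring_closed)
  qed (simp add: poly_ring_closed)
qed

text \<open>
  The row formulas for edges hold for index pairs that are not edges too, because such a pair is not a side
  of a square; the four squares around a box then cancel identically.
\<close>

lemma boundary_boundary_Box:
  fixes s :: "cell \<Rightarrow> 'k::field mpoly"
  assumes s: "s \<in> cell_funs n (cells 3)" and x: "x \<in> cells (Suc 0)"
  shows "(\<Sum>y\<in>cells 2. boundary M x y * (\<Sum>z\<in>cells 3. boundary M y z * s z)) = 0"
proof -
  obtain a b where ab: "x = Box a b" "in_shape a b"
    using x unfolding cells_cases by blast
  then have pos: "1 \<le> a" "1 \<le> b"
    by (auto simp: in_shape_def)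
  define g where "g = (\<lambda>y. if y \<in> cells 2 then \<Sum>z\<in>cells 3. boundary M y z * s z else 0)"
  have g: "g \<in> cell_funs n (cells 2)"
    unfolding cell_funs_def g_def
    using boundary_carrier cell_funs_carrier[OF s]
    by (auto simp: cells_def intro!: carrier_sum poly_ring_closed(5))
  have gH: "g (Hor c d) = mvar c * (s (Sq c d) - s (Sq (c - 1) d))" if "1 \<le> c" for c d
  proof (cases "Hor c d \<in> cells 2")
    case True
    then show ?thesis
      using row_Hor[OF s that] by (simp add: g_def)
  next
    case False
    then have H: "\<not> (in_shape c d \<and> in_shape c (Suc d))"
      by (simp add: cells_def)
    have "\<not> is_cell (Sq c d)" "\<not> is_cell (Sq (c - 1) d)"
      using H that in_shape_up[of "Suc c" "Suc d" c] by auto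
    then show ?thesis
      using False cell_funs_zero[OF s] by (simp add: g_def)
  qed
  have gV: "g (Ver c d) = mvar d * (s (Sq c (d - 1)) - s (Sq c d))" if "1 \<le> d" for c d
  proof (cases "Ver c d \<in> cells 2")
    case True
    then show ?thesis
      using row_Ver[OF s that] by (simp add: g_def)
  next
    case False
    then have H: "\<not> (in_shape c d \<and> in_shape (Suc c) d)"
      by (simp add: cells_def)
    have "in_shape c d" if "in_shape (Suc c) d" "in_shape c e" for e
      using that in_shape_up[of "Suc c" d c] in_shape_def by auto
    then have "\<not> is_cell (Sq c d)" "\<not> is_cell (Sq c (d - 1))"
      using H that by auto
    then show ?thesis
      using False cell_funs_zero[OF s] by (simp add: g_def)
  qed
  have "(\<Sum>y\<in>cells 2. boundary M x y * (\<Sum>z\<in>cells 3. boundary M y z * s z)) = (\<Sum>y\<in>cells 2. boundary M (Box a b) y * g y)"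
    by (simp add: g_def ab)
  also have "\<dots> = 0"
    unfolding row_Box[OF g pos] gH[OF pos(1)] gV[OF pos(2)] by (simp add: algebra_simps)
  finally show ?thesis .
qed

section \<open>Exactness\<close>

text \<open>
  A horizontal edge has only a square above and one below it, and both enter with the same variable up
  to sign. Hence the values on vertically adjacent squares agree, and those above the first row are zero.
\<close>

lemma exact_squares:
  fixes s :: "cell \<Rightarrow> 'k::field mpoly"
  assumes s: "s \<in> cell_funs n (cells 3)"
    and ker: "\<And>x. x \<in> cells 2 \<Longrightarrow> (\<Sum>y\<in>cells 3. boundary M x y * s y) = 0"
  shows "s y = 0"
proof -
  have "s (Sq a b) = 0" for a b
  proof (induction a)
    case 0
    then show ?case
      using cell_funs_zero[OF s] by (simp add: zero_row)
  next
    case (Suc a)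
    show ?case
    proof (cases "is_cell (Sq (Suc a) b)")
      case True
      then have "Hor (Suc a) b \<in> cells 2"
        using in_shape_up[of "Suc (Suc a)" "Suc b" "Suc a"] by (simp add: cells_def)
      from ker[OF this] have "mvar (Suc a) * s (Sq (Suc a) b) = 0"
        unfolding row_Hor[OF s, of "Suc a", simplified] by (simp add: Suc)
      then show ?thesis
        by simp
    qed (rule cell_funs_zero[OF s])
  qed
  then show ?thesis
    using cell_funs_dim[OF s] by (cases y) auto
qed

text \<open>
  Write the cycle as \<open>h\<close> on horizontal and \<open>v\<close> on vertical edges. The condition at a box \<open>(a, b)\<close> is
  \<open>x\<^sub>b (h a (b - 1) - h a b) = x\<^sub>a (v a b - v (a - 1) b)\<close>. Since \<open>x\<^sub>a\<close> and \<open>x\<^sub>b\<close> are coprime off the diagonal, \<open>x\<^sub>a\<close>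
  divides all differences of \<open>h\<close> along row \<open>a\<close>, and \<open>h\<close> vanishes beyond the end of the row, so \<open>x\<^sub>a\<close> divides \<open>h\<close>.
  Likewise \<open>x\<^sub>b\<close> divides \<open>v\<close> in column \<open>b\<close>, starting from above the first row. The quotients \<open>h'\<close> and \<open>v'\<close>
  satisfy \<open>v' a b - v' (a - 1) b = h' a (b - 1) - h' a b\<close>, which says that they are differences of
  one function on squares. It is obtained by summation down the columns, \<open>S a b = h' 0 b + \<dots> + h' a b\<close>.
  What remains is that \<open>S\<close> vanishes at the places around the border where there is no square.
\<close>

lemma exact_edges:
  fixes f :: "cell \<Rightarrow> 'k::field mpoly"
  assumes f: "f \<in> cell_funs n (cells 2)"
    and ker: "\<And>x. x \<in> cells (Suc 0) \<Longrightarrow> (\<Sum>y\<in>cells 2. boundary M x y * f y) = 0"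
  shows "\<exists>s\<in>cell_funs n (cells 3). \<forall>y\<in>cells 2. f y = (\<Sum>z\<in>cells 3. boundary M y z * s z)"
proof -
  define h v where "h = (\<lambda>a b. f (Hor a b))" and "v = (\<lambda>a b. f (Ver a b))"
  have h0: "h a b = 0" if "\<not> (in_shape a b \<and> in_shape a (Suc b))" for a b
    using cell_funs_zero[OF f, of "Hor a b"] that by (simp add: h_def)
  have v0: "v a b = 0" if "\<not> (in_shape a b \<and> in_shape (Suc a) b)" for a b
    using cell_funs_zero[OF f, of "Ver a b"] that by (simp add: v_def)
  have box: "mvar b * (h a (b - 1) - h a b) = mvar a * (v a b - v (a - 1) b)" if ab: "in_shape a b" for a b
  proof -
    have "1 \<le> a" "1 \<le> b"
      using ab by (auto simp: in_shape_def)
    moreover have "Box a b \<in> cells (Suc 0)"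
      using ab by (simp add: cells_def)
    ultimately have "mvar b * (h a (b - 1) - h a b) + mvar a * (v (a - 1) b - v a b) = 0"
      using ker row_Box[OF f, of a b] by (simp add: h_def v_def)
    then have "mvar b * (h a (b - 1) - h a b) = - (mvar a * (v (a - 1) b - v a b))"
      by (rule eq_neg_iff_add_eq_0[THEN iffD2])
    then show ?thesis
      by (simp add: right_diff_distrib)
  qed
  \<comment> \<open>Induction from the right end of the row towards the diagonal.\<close>
  have dvd_h: "mvar a dvd h a b" for a b
  proof (induction "lam a - b" arbitrary: b rule: less_induct)
    case less
    show ?case
    proof (cases "in_shape a b \<and> in_shape a (Suc b)")
      case True
      then have "mvar (Suc b) * (h a b - h a (Suc b)) = mvar a * (v a (Suc b) - v (a - 1) (Suc b))"
        using box[of a "Suc b"] by simp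
      moreover have "a \<noteq> Suc b" "Suc b \<le> lam a"
        using True by (auto simp: in_shape_def)
      ultimately have "mvar a dvd h a b - h a (Suc b)" "mvar a dvd h a (Suc b)"
        using mvar_coprime less[of "Suc b"] by (blast, simp)
      then have "mvar a dvd (h a b - h a (Suc b)) + h a (Suc b)"
        by (rule dvd_add)
      then show ?thesis
        by simp
    qed (simp add: h0)
  qed
  define h' where "h' = (\<lambda>a b. var_quot a (h a b))"
  have h': "h a b = mvar a * h' a b" for a b
    by (simp add: h'_def mvar_mult_var_quot[OF dvd_h])
  have h'0: "h' a b = 0" if "\<not> (in_shape a b \<and> in_shape a (Suc b))" for a b
    using h0[OF that] by (simp add: h'_def)
  have h'c: "h' a b \<in> carrier (poly_ring n)" for a b
    using cell_funs_carrier[OF f] by (simp add: h'_def h_def carrier_var_quot)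
  have box': "v a b - v (a - 1) b = mvar b * (h' a (b - 1) - h' a b)" if "in_shape a b" for a b
  proof -
    have "mvar a * (mvar b * (h' a (b - 1) - h' a b)) = mvar a * (v a b - v (a - 1) b)"
      using box[OF that] by (simp add: h' algebra_simps)
    then show ?thesis
      by simp
  qed
  have dvd_v: "mvar b dvd v a b" for a b
  proof (induction a)
    case 0
    then show ?case
      by (simp add: v0 zero_row)
  next
    case (Suc a)
    show ?case
    proof (cases "in_shape (Suc a) b \<and> in_shape (Suc (Suc a)) b")
      case True
      then have "v (Suc a) b = v a b + mvar b * (h' (Suc a) (b - 1) - h' (Suc a) b)"
        using box'[of "Suc a" b] by (simp add: algebra_simps)
      then show ?thesis
        using Suc by simp
    qed (simp add: v0)
  qed
  define v' where "v' = (\<lambda>a b. var_quot b (v a b))"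
  have v': "v a b = mvar b * v' a b" for a b
    by (simp add: v'_def mvar_mult_var_quot[OF dvd_v])
  have v'0: "v' a b = 0" if "\<not> (in_shape a b \<and> in_shape (Suc a) b)" for a b
    using v0[OF that] by (simp add: v'_def)
  have box'': "v' a b - v' (a - 1) b = h' a (b - 1) - h' a b" if "in_shape a b" for a b
  proof -
    have "mvar b * (v' a b - v' (a - 1) b) = mvar b * (h' a (b - 1) - h' a b)"
      using box'[OF that] by (simp add: v' right_diff_distrib)
    then show ?thesis
      by simp
  qed
  define S where "S = (\<lambda>a b. \<Sum>k\<le>a. h' k b)"
  have S_Suc: "S (Suc a) b = S a b + h' (Suc a) b" for a b
    by (simp add: S_def)
  have S_zero: "S 0 b = 0" for b
    by (simp add: S_def h'0 zero_row)
  have S_v: "S a (b - 1) - S a b = v' a b" if "a = 0 \<or> in_shape a b" for a b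
    using that
  proof (induction a)
    case 0
    then show ?case
      by (simp add: S_zero v'0 zero_row)
  next
    case (Suc a)
    then have in_shape: "in_shape (Suc a) b"
      by simp
    then have "a = 0 \<or> in_shape a b"
      using in_shape_up[of "Suc a" b a] by (cases a) auto
    then have "S a (b - 1) - S a b = v' a b"
      by (rule Suc.IH)
    then show ?case
      using box''[OF in_shape] by (simp add: S_Suc algebra_simps)
  qed
  \<comment> \<open>The places on the diagonal: the condition at the box \<open>(a, a)\<close> reads \<open>h' a a = v' (a - 1) a\<close>, so \<open>S\<close> does not
      change from \<open>(a - 1, a - 1)\<close> to \<open>(a, a)\<close>.\<close>
  have S_diag: "S a a = 0" if "a \<le> m" for a
    using that
  proof (induction a)
    case 0
    show ?case
      by (rule S_zero)
  next
    case (Suc a)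
    have in_shape: "in_shape (Suc a) (Suc a)"
      using Suc.prems by (intro in_shape_diag) auto
    have "h' (Suc a) a = 0" "v' (Suc a) (Suc a) = 0"
      by (auto intro!: h'0 v'0 simp: in_shape_def)
    then have "h' (Suc a) (Suc a) = v' a (Suc a)"
      using box''[OF in_shape] by simp
    moreover have "S a a - S a (Suc a) = v' a (Suc a)"
      using S_v[of a "Suc a"] in_shape in_shape_up[of "Suc a" "Suc a" a] by (cases a) auto
    ultimately have "S (Suc a) (Suc a) = S a a"
      by (simp add: S_Suc diff_eq_eq add.commute)
    then show ?case
      using Suc by simp
  qed
  \<comment> \<open>The places at the outer border, row by row and within a row from the right to the left. Beyond
      the end of row \<open>a + 1\<close> the value is inherited from row \<open>a\<close>. Along the part of row \<open>a + 1\<close> that has no box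
      below it, \<open>v'\<close> vanishes and \<open>S\<close> is constant.\<close>
  have S_outer: "S a b = 0" if "a \<le> m" "a \<le> b" "\<not> in_shape (Suc a) (Suc b)" for a b
    using that
  proof (induction a arbitrary: b)
    case 0
    show ?case
      by (rule S_zero)
  next
    case (Suc a)
    note outer_IH = Suc.IH
    from Suc.prems show ?case
    proof (induction "lam (Suc a) - b" arbitrary: b rule: less_induct)
      case less
      show ?case
      proof (cases "b < lam (Suc a)")
        case True
        have in_shape: "in_shape (Suc a) (Suc b)"
          using True less.prems by (simp add: in_shape_def)
        have "S (Suc a) (Suc b) = 0"
        proof (rule less.hyps)
          show "\<not> in_shape (Suc (Suc a)) (Suc (Suc b))"
            using less.prems in_shape_left[of "Suc (Suc a)" "Suc (Suc b)" "Suc b"] by auto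
        qed (use True less.prems in auto)
        moreover have "v' (Suc a) (Suc b) = 0"
          using less.prems by (intro v'0) auto
        ultimately show ?thesis
          using S_v[of "Suc a" "Suc b"] in_shape by simp
      next
        case False
        then have "\<not> in_shape (Suc a) (Suc b)"
          by (simp add: in_shape_def)
        then have "S a b = 0" "h' (Suc a) b = 0"
          using less.prems by (auto intro: outer_IH h'0)
        then show ?thesis
          by (simp add: S_Suc)
      qed
    qed
  qed
  define s where "s = (\<lambda>z. case z of Sq a b \<Rightarrow> (if is_cell z then S a b else 0) | _ \<Rightarrow> 0)"
  have s: "s \<in> cell_funs n (cells 3)"
  proof -
    have "S a b \<in> carrier (poly_ring n)" for a b
      by (simp add: S_def carrier_sum h'c)
    then have "s z \<in> carrier (poly_ring n)" for z
      by (cases z) (simp_all add: s_def poly_ring_closed(1))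
    moreover have "s z = 0" if "z \<notin> cells 3" for z
    proof (cases z)
      case (Sq a b)
      with that have "\<not> is_cell z"
        by (simp add: cells_def)
      with Sq show ?thesis
        by (simp add: s_def del: is_cell.simps)
    qed (simp_all add: s_def)
    ultimately show ?thesis
      by (simp add: cell_funs_def)
  qed
  have sS: "s (Sq a b) = S a b" if "a \<le> m" "a \<le> b" for a b
  proof (cases "is_cell (Sq a b)")
    case False
    have "S a b = 0"
    proof (cases "a = 0 \<or> a = b")
      case True
      then show ?thesis
        using S_zero S_diag that by auto
    next
      case False
      have "\<not> in_shape (Suc a) (Suc b)"
      proof
        assume *: "in_shape (Suc a) (Suc b)"
        then have sh': "in_shape (Suc a) b"
          using False that in_shape_left[OF *, of b] by simp
        moreover have "in_shape a b"
          using False in_shape_up[OF sh', of a] by simp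
        ultimately show False
          using * \<open>\<not> is_cell (Sq a b)\<close> by simp
      qed
      then show ?thesis
        by (rule S_outer[OF that])
    qed
    with False show ?thesis
      by (simp add: s_def)
  qed (simp add: s_def)
  have "f y = (\<Sum>z\<in>cells 3. boundary M y z * s z)" if y: "y \<in> cells 2" for y
  proof -
    consider a b where "y = Hor a b" "in_shape a b" "in_shape a (Suc b)" | a b where "y = Ver a b" "in_shape a b" "in_shape (Suc a) b"
      using y unfolding cells_cases by blast
    then show ?thesis
    proof cases
      case 1
      then have a: "1 \<le> a" "a \<le> m" "a \<le> b"
        by (auto simp: in_shape_def)
      have "(\<Sum>z\<in>cells 3. boundary M y z * s z) = mvar a * (S a b - S (a - 1) b)"
        unfolding 1 row_Hor[OF s a(1)] using sS[of a b] sS[of "a - 1" b] a by simp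
      also have "S a b - S (a - 1) b = h' a b"
        using S_Suc[of "a - 1" b] a by simp
      finally show ?thesis
        using h'[of a b] by (simp add: 1 h_def)
    next
      case 2
      then have a: "1 \<le> b" "a \<le> m" "a \<le> b" "a \<le> b - 1"
        by (auto simp: in_shape_def)
      have "(\<Sum>z\<in>cells 3. boundary M y z * s z) = mvar b * (S a (b - 1) - S a b)"
        unfolding 2 row_Ver[OF s a(1)] using sS[of a b] sS[of a "b - 1"] a by simp
      also have "S a (b - 1) - S a b = v' a b"
        using S_v[of a b] 2 by simp
      finally show ?thesis
        using v'[of a b] by (simp add: 2 v_def)
    qed
  qed
  with s show ?thesis
    by blast
qed

text \<open>
  Linear quotients. If \<open>(i, j)\<close> is the last box in reading order on which a syzygy \<open>f\<close> does not vanish, then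
  every term of \<open>f (Box i j)\<close>, multiplied by \<open>M / x\<^sub>i x\<^sub>j\<close>, must be cancelled by a multiple of some \<open>M / x\<^sub>k x\<^sub>l\<close>
  with an earlier box \<open>(k, l)\<close>. Comparing exponents of \<open>x\<^sub>i\<close> and \<open>x\<^sub>j\<close>, the term is divisible by \<open>x\<^sub>i\<close> or by \<open>x\<^sub>j\<close>,
  and the variable found has an edge of the diagram attached to it: \<open>x\<^sub>i\<close> the edge upwards, for \<open>1 < i\<close>,
  and \<open>x\<^sub>j\<close> the edge to the left, for \<open>i < j\<close>.
\<close>

lemma last_coefficient:
  fixes f :: "cell \<Rightarrow> 'k::field mpoly"
  assumes syz: "(\<Sum>y\<in>cells (Suc 0). boundary M Apex y * f y) = 0" and ij: "in_shape i j"
    and last: "\<And>k l. in_shape k l \<Longrightarrow> f (Box k l) \<noteq> 0 \<Longrightarrow> k < i \<or> k = i \<and> l \<le> j"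
    and t: "t \<in> Poly_Mapping.keys (f (Box i j))"
  shows "1 < i \<and> 0 < Poly_Mapping.lookup t i \<or> i < j \<and> 0 < Poly_Mapping.lookup t j"
proof -
  let ?e = "\<lambda>k l. Poly_Mapping.single k 1 + Poly_Mapping.single l 1 :: expo"
  define u where "u = (M - ?e i j) + t"
  define c where "c = (\<lambda>y. Poly_Mapping.lookup (boundary M Apex y * f y) u)"
  have sum0: "(\<Sum>y\<in>cells (Suc 0). c y) = 0"
    using arg_cong[OF syz, of "\<lambda>p. Poly_Mapping.lookup p u"] by (simp add: lookup_sum c_def)
  have B: "Box i j \<in> cells (Suc 0)"
    using ij by (simp add: cells_def)
  have "expo_dvd (M - ?e i j) u" "u - (M - ?e i j) = t"
    unfolding u_def expo_dvd_iff_add by (blast, simp)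
  then have "c (Box i j) = Poly_Mapping.lookup (f (Box i j)) t"
    by (simp add: c_def lookup_monom_mult)
  then have "c (Box i j) \<noteq> 0"
    using t by (simp add: in_keys_iff)
  then have "(\<Sum>y\<in>cells (Suc 0) - {Box i j}. c y) \<noteq> 0"
    using sum0 sum.remove[OF finite_cells B, of c] by auto
  then obtain y where y: "y \<in> cells (Suc 0)" "y \<noteq> Box i j" "c y \<noteq> 0"
    by (metis (no_types, lifting) DiffD1 DiffD2 singletonI sum.neutral)
  then obtain k l where kl: "y = Box k l" "in_shape k l"
    unfolding cells_cases by blast
  have fkl: "f (Box k l) \<noteq> 0" and dvd: "expo_dvd (M - ?e k l) u"
    using y(3) by (auto simp: c_def kl lookup_monom_mult split: if_splits)
  have less: "k < i \<or> k = i \<and> l < j"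
    using last[OF kl(2) fkl] y(2) by (auto simp: kl)
  \<comment> \<open>Exponents of \<open>M / x\<^sub>k x\<^sub>l\<close> and of the cancelled monomial, with \<open>M\<close> removed from both sides.\<close>
  have exps: "(if x = i then 1 else 0) + (if x = j then 1 else 0)
      \<le> Poly_Mapping.lookup t x + ((if x = k then 1 else 0) + (if x = l then 1 else 0))" for x
  proof -
    have "Poly_Mapping.lookup (M - ?e k l + ?e k l) x \<le> Poly_Mapping.lookup (u + ?e k l) x"
      using dvd by (simp add: expo_dvd_def lookup_add)
    then have "Poly_Mapping.lookup (M - ?e i j + ?e i j) x
        \<le> Poly_Mapping.lookup (M - ?e i j) x + Poly_Mapping.lookup t x + Poly_Mapping.lookup (?e k l) x"
      unfolding M_split[OF kl(2)] M_split[OF ij] by (simp add: u_def lookup_add)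
    then show ?thesis
      by (auto simp: lookup_add lookup_single when_def split: if_splits)
  qed
  show ?thesis
    using less exps[of i] exps[of j] in_shape_bounds[OF ij] in_shape_bounds[OF kl(2)]
    by (auto split: if_splits)
qed

text \<open>
  The last nonzero coefficient of a syzygy is \<open>x\<^sub>i p + x\<^sub>j q\<close> by \<open>last_coefficient\<close>. Subtracting the boundary of
  \<open>p\<close> times the edge upwards plus \<open>q\<close> times the edge to the left removes it and changes only the coefficients
  at two earlier boxes. Induction on the position of the last nonzero coefficient finishes the proof.
\<close>

lemma exact_boxes:
  fixes f :: "cell \<Rightarrow> 'k::field mpoly"
  assumes f: "f \<in> cell_funs n (cells (Suc 0))"
    and syz: "(\<Sum>y\<in>cells (Suc 0). boundary M Apex y * f y) = 0"
  shows "\<exists>g\<in>cell_funs n (cells 2). \<forall>y\<in>cells (Suc 0). f y = (\<Sum>z\<in>cells 2. boundary M y z * g z)"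
proof -
  \<comment> \<open>The rank in reading order; it is injective on the diagram because columns do not exceed \<open>n\<close>.\<close>
  define pos where "pos = (\<lambda>i j. i * Suc n + j)"
  have lex: "k < i \<or> k = i \<and> l \<le> j" if "in_shape i j" "in_shape k l" "pos k l \<le> pos i j" for i j k l
  proof -
    have b: "j \<le> n" "l \<le> n"
      using that in_shape_bounds by auto
    have "\<not> Suc i \<le> k"
    proof
      assume "Suc i \<le> k"
      then have "Suc i * Suc n \<le> k * Suc n"
        by (rule mult_le_mono1)
      then show False
        using that(3) b by (simp add: pos_def)
    qed
    then show ?thesis
      using that(3) by (cases "k = i") (auto simp: pos_def)
  qed
  have "\<exists>g\<in>cell_funs n (cells 2). \<forall>y\<in>cells (Suc 0). f y = (\<Sum>z\<in>cells 2. boundary M y z * g z)"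
    if "f \<in> cell_funs n (cells (Suc 0))" "(\<Sum>y\<in>cells (Suc 0). boundary M Apex y * f y) = 0"
      "\<And>i j. in_shape i j \<Longrightarrow> N \<le> pos i j \<Longrightarrow> f (Box i j) = 0" for N and f :: "cell \<Rightarrow> 'k mpoly"
    using that
  proof (induction N arbitrary: f)
    case 0
    then have "f y = 0" if "y \<in> cells (Suc 0)" for y
      using that unfolding cells_cases by auto
    then show ?case
      by (intro bexI[of _ "\<lambda>_. 0"]) (auto simp: cell_funs_def poly_ring_closed)
  next
    case (Suc N)
    note f = Suc.prems(1)
    show ?case
    proof (cases "\<exists>i j. in_shape i j \<and> pos i j = N")
      case False
      then have "f (Box i j) = 0" if "in_shape i j" "N \<le> pos i j" for i j
        using Suc.prems(3)[of i j] that by (metis le_antisym not_less_eq_eq)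
      then show ?thesis
        using Suc.IH Suc.prems by blast
    next
      case True
      then obtain i j where ij: "in_shape i j" "pos i j = N"
        by blast
      then have pos_ij: "1 \<le> i" "1 \<le> j" "i \<le> j"
        by (auto simp: in_shape_def)
      have neq: "i \<noteq> i - 1" "j \<noteq> j - 1"
        using pos_ij by auto
      have last: "k < i \<or> k = i \<and> l \<le> j" if "in_shape k l" "f (Box k l) \<noteq> 0" for k l
        using Suc.prems(3)[of k l] that ij lex[of i j k l] by (metis not_less_eq_eq)
      note lastc = last_coefficient[OF Suc.prems(2) ij(1) last]
      define P where "P = (\<lambda>t :: expo. 1 < i \<and> 0 < Poly_Mapping.lookup t i)"
      define p where "p = var_quot i (restrict_terms P (f (Box i j)))"
      define q where "q = var_quot j (restrict_terms (\<lambda>t. \<not> P t) (f (Box i j)))"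
      have "mvar i dvd restrict_terms P (f (Box i j))"
        by (auto simp: mvar_dvd_iff keys_restrict_terms P_def)
      moreover have "mvar j dvd restrict_terms (\<lambda>t. \<not> P t) (f (Box i j))"
        unfolding mvar_dvd_iff keys_restrict_terms P_def using lastc by blast
      ultimately have split: "f (Box i j) = mvar i * p + mvar j * q"
        by (simp add: p_def q_def mvar_mult_var_quot restrict_terms_split)
      have p0: "p = 0" if "\<not> 1 < i"
        using that by (simp add: p_def P_def restrict_terms_none)
      have q0: "q = 0" if "\<not> i < j"
      proof -
        have "restrict_terms (\<lambda>t. \<not> P t) (f (Box i j)) = 0"
          by (rule restrict_terms_none) (use lastc that in \<open>auto simp: P_def\<close>)
        then show ?thesis
          by (simp add: q_def)
      qed
      define g0 where "g0 = (\<lambda>z. if z = Ver (i - 1) j then p else if z = Hor i (j - 1) then q else 0)"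
      have pq: "p \<in> carrier (poly_ring n)" "q \<in> carrier (poly_ring n)"
        using cell_funs_carrier[OF f] by (simp_all add: p_def q_def carrier_var_quot carrier_restrict_terms)
      have "Ver (i - 1) j \<in> cells 2" if "1 < i"
        using that ij(1) in_shape_up[OF ij(1), of "i - 1"] by (simp add: cells_def)
      moreover have "Hor i (j - 1) \<in> cells 2" if "i < j"
        using that ij(1) in_shape_left[OF ij(1), of "j - 1"] by (simp add: cells_def)
      ultimately have g0: "g0 \<in> cell_funs n (cells 2)"
        using pq p0 q0 by (auto simp: cell_funs_def g0_def poly_ring_closed)
      define f' where "f' = (\<lambda>y. if y \<in> cells (Suc 0) then f y - (\<Sum>z\<in>cells 2. boundary M y z * g0 z) else 0)"
      have f': "f' \<in> cell_funs n (cells (Suc 0))"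
        using f cell_funs_carrier[OF g0] boundary_carrier
        by (auto simp: cell_funs_def f'_def cells_def intro!: carrier_minus carrier_sum poly_ring_closed(5))
      have "(\<Sum>y\<in>cells (Suc 0). boundary M Apex y * f' y)
          = (\<Sum>y\<in>cells (Suc 0). boundary M Apex y * f y)
            - (\<Sum>y\<in>cells (Suc 0). boundary M Apex y * (\<Sum>z\<in>cells 2. boundary M y z * g0 z))"
        by (simp add: f'_def right_diff_distrib sum_subtractf)
      then have syz': "(\<Sum>y\<in>cells (Suc 0). boundary M Apex y * f' y) = 0"
        using Suc.prems(2) boundary_boundary_Apex[of g0] by simp
      have f'0: "f' (Box a b) = 0" if ab: "in_shape a b" "N \<le> pos a b" for a b
      proof -
        have ab1: "1 \<le> a" "1 \<le> b"
          using ab by (auto simp: in_shape_def)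
        have order: "i < a \<or> i = a \<and> j \<le> b"
          using lex[OF ab(1) ij(1)] ab(2) ij(2) by simp
        have f'_eq: "f' (Box a b) = f (Box a b)
            - (mvar b * (g0 (Hor a (b - 1)) - g0 (Hor a b)) + mvar a * (g0 (Ver (a - 1) b) - g0 (Ver a b)))"
          using ab(1) row_Box[OF g0 ab1] by (simp add: f'_def cells_def)
        show ?thesis
        proof (cases "a = i \<and> b = j")
          case True
          then show ?thesis
            unfolding f'_eq using split neq by (simp add: g0_def algebra_simps)
        next
          case False
          have "f (Box a b) = 0"
            using last[OF ab(1)] order False by force
          moreover have "g0 (Hor a (b - 1)) = 0" "g0 (Hor a b) = 0" "g0 (Ver (a - 1) b) = 0" "g0 (Ver a b) = 0"
            using order False ab1 pos_ij by (auto simp: g0_def)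
          ultimately show ?thesis
            unfolding f'_eq by simp
        qed
      qed
      obtain g1 where g1: "g1 \<in> cell_funs n (cells 2)" "\<forall>y\<in>cells (Suc 0). f' y = (\<Sum>z\<in>cells 2. boundary M y z * g1 z)"
        using Suc.IH[OF f' syz' f'0] by blast
      have "f y = (\<Sum>z\<in>cells 2. boundary M y z * (g0 z + g1 z))" if "y \<in> cells (Suc 0)" for y
        using g1(2) that by (simp add: f'_def distrib_left sum.distrib algebra_simps)
      moreover have "(\<lambda>z. g0 z + g1 z) \<in> cell_funs n (cells 2)"
        using g0 g1(1) by (simp add: cell_funs_def poly_ring_closed)
      ultimately show ?thesis
        by (intro bexI[of _ "\<lambda>z. g0 z + g1 z"]) auto
    qed
  qed
  moreover have "f (Box i j) = 0" if "in_shape i j" "Suc (pos m n) \<le> pos i j" for i j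
  proof -
    have "i * Suc n \<le> m * Suc n" "j \<le> n"
      using in_shape_bounds[OF that(1)] mult_le_mono1 by blast+
    then show ?thesis
      using that(2) by (simp add: pos_def)
  qed
  ultimately show ?thesis
    using f syz by blast
qed

section \<open>Betti numbers of the dual ideal\<close>

lemma tdeg_M: "tdeg M = n + m"
proof -
  have "Poly_Mapping.keys M \<subseteq> {1..n}"
    using m_le_n by (auto simp: in_keys_iff M split: if_splits)
  then have "tdeg M = (\<Sum>k\<in>{1..n}. 1 + (if k \<le> m then 1 else 0))"
    by (subst tdeg_eq_sum[of "{1..n}"]) (auto simp: M intro!: sum.cong)
  also have "\<dots> = n + card ({1..n} \<inter> {k. k \<le> m})"
    unfolding sum.distrib by (simp add: sum.If_cases)
  also have "{1..n} \<inter> {k. k \<le> m} = {1..m}"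
    using m_le_n by auto
  finally show ?thesis
    by simp
qed

text \<open>
The total degree of the label of a cell.
\<close>

definition cell_degree :: "cell \<Rightarrow> int" where
  "cell_degree x = (if x = Apex then 0 else int n + int m - 3 + int (cell_dim x))"

lemma homogeneous_boundary:
  assumes "x \<in> cells i" "y \<in> cells (Suc i)"
  shows "homogeneous (cell_degree y - cell_degree x) (boundary M x y :: 'k::field mpoly)"
proof (cases "x = Apex")
  case True
  then obtain k l where kl: "y = Box k l" "in_shape k l"
    using assms by (cases y) (auto simp: cells_def)
  have "tdeg (M - (Poly_Mapping.single k 1 + Poly_Mapping.single l 1)) + 2 = n + m"
    using arg_cong[OF M_split[OF kl(2)], of tdeg] unfolding tdeg_M tdeg_add tdeg_single by simp
  then show ?thesis
    by (simp add: True kl cell_degree_def)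
next
  case False
  then show ?thesis
    using assms by (cases x; cases y) (auto simp: cells_def cell_degree_def)
qed

lemma constant_term_boundary:
  assumes "x \<in> cells i" "y \<in> cells (Suc i)"
  shows "Poly_Mapping.lookup (boundary M x y :: 'k::field mpoly) 0 = 0"
proof (rule ccontr)
  assume "Poly_Mapping.lookup (boundary M x y :: 'k mpoly) 0 \<noteq> 0"
  then have "cell_degree y - cell_degree x = 0"
    by (rule homogeneous_constant_term[OF homogeneous_boundary[OF assms]])
  moreover have "y \<noteq> Apex" "x = Apex \<or> cell_dim y = Suc (cell_dim x)"
    using assms by (auto simp: cells_def)
  ultimately show False
    using m1 m_le_n by (auto simp: cell_degree_def split: if_splits)
qed

definition dual_ideal :: "'k::field mpoly set" where
  "dual_ideal = genideal (poly_ring n) (boundary M Apex ` cells (Suc 0))"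

lemma dual_ideal_monomials:
  "dual_ideal = genideal (poly_ring n)
     (monom ` {M - (Poly_Mapping.single i 1 + Poly_Mapping.single j 1) | i j. in_shape i j})"
proof -
  have "boundary M Apex ` cells (Suc 0)
      = (monom ` {M - (Poly_Mapping.single i 1 + Poly_Mapping.single j 1) | i j. in_shape i j} :: 'a mpoly set)"
    by (force simp: image_iff cells_cases)
  then show ?thesis
    by (simp only: dual_ideal_def)
qed

lemma generators_carrier: "(boundary M Apex ` cells (Suc 0) :: 'k::field mpoly set) \<subseteq> carrier (poly_ring n)"
  using boundary_carrier[of Apex] by auto

lemma ideal_dual_ideal: "ideal (dual_ideal :: 'k::field mpoly set) (poly_ring n)"
  unfolding dual_ideal_def by (rule genideal_ideal(1)[OF generators_carrier])

lemma hom_part_dual_ideal: "p \<in> dual_ideal \<Longrightarrow> hom_part d p \<in> (dual_ideal :: 'k::field mpoly set)"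
  unfolding dual_ideal_monomials
proof (erule hom_part_genideal_monomials[rotated])
  fix g assume "g \<in> {M - (Poly_Mapping.single i 1 + Poly_Mapping.single j 1) | i j. in_shape i j}"
  then have "(monom g :: 'k mpoly) \<in> boundary M Apex ` cells (Suc 0)"
    by (force simp: image_iff cells_cases)
  then show "Poly_Mapping.keys g \<subseteq> {1..n}"
    using generators_carrier[where 'k = 'k] carrier_monom_iff by blast
qed

theorem betti_dual_ideal:
  "betti n (quot_module n (dual_ideal :: 'k::field mpoly set)) i j = card {x \<in> cells i. cell_degree x = j}"
proof (rule betti_cellular[where D = "boundary M" and ?x0.0 = Apex])
  show "ideal (dual_ideal :: 'k mpoly set) (poly_ring n)"
    by (rule ideal_dual_ideal)
  show "hom_part d p \<in> dual_ideal" if "p \<in> dual_ideal" for p :: "'k mpoly" and d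
    by (rule hom_part_dual_ideal[OF that])
  show "finite (cells i)" for i
    by simp
  show "cells 0 = {Apex}"
    using cells_cases(1) by blast
  show "cell_degree Apex = 0"
    by (simp add: cell_degree_def)
  show "boundary M x y \<in> carrier (poly_ring n) \<and> homogeneous (cell_degree y - cell_degree x) (boundary M x y :: 'k mpoly) \<and>
      Poly_Mapping.lookup (boundary M x y :: 'k mpoly) 0 = 0" if "x \<in> cells i" "y \<in> cells (Suc i)" for i x y
    using that homogeneous_boundary constant_term_boundary boundary_carrier by (auto simp: cells_def)
  show "(dual_ideal :: 'k mpoly set) = {\<Sum>y\<in>cells 1. boundary M Apex y * f y | f. f \<in> cell_funs n (cells 1) } "
  proof -
    have "(dual_ideal :: 'k mpoly set) = {\<Sum>y\<in>cells 1. boundary M Apex y * f y | f. \<forall>y\<in>cells 1. f y \<in> carrier (poly_ring n)}"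
      unfolding dual_ideal_def One_nat_def
      using generators_carrier by (intro genideal_eq_combinations) auto
    also have "\<dots> = {\<Sum>y\<in>cells 1. boundary M Apex y * f y | f. f \<in> cell_funs n (cells 1)}"
    proof (intro equalityI subsetI)
      fix p :: "'k mpoly"
      assume "p \<in> {\<Sum>y\<in>cells 1. boundary M Apex y * f y | f. \<forall>y\<in>cells 1. f y \<in> carrier (poly_ring n)}"
      then obtain f where f: "p = (\<Sum>y\<in>cells 1. boundary M Apex y * f y)" "\<forall>y\<in>cells 1. f y \<in> carrier (poly_ring n)"
        by blast
      let ?g = "\<lambda>y. if y \<in> cells 1 then f y else 0"
      have pg: "p = (\<Sum>y\<in>cells 1. boundary M Apex y * ?g y)" "?g \<in> cell_funs n (cells 1)"
        using f by (simp_all add: cell_funs_def)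
      show "p \<in> {\<Sum>y\<in>cells 1. boundary M Apex y * f y | f. f \<in> cell_funs n (cells 1)}"
        by (rule CollectI, rule exI[of _ ?g], rule conjI) (rule pg)+
    qed (auto simp: cell_funs_def)
    finally show ?thesis .
  qed
next
  fix i and f :: "cell \<Rightarrow> 'k mpoly" and x
  assume f: "f \<in> cell_funs n (cells (Suc (Suc i)))" and x: "x \<in> cells i"
  consider "i = 0" | "i = 1" | "2 \<le> i"
    by linarith
  then show "(\<Sum>y\<in>cells (Suc i). boundary M x y * (\<Sum>z\<in>cells (Suc (Suc i)). boundary M y z * f z)) = 0"
  proof cases
    case 1
    then show ?thesis
      using x boundary_boundary_Apex[of f] by (simp add: cells_cases numeral_2_eq_2)
  next
    case 2
    then show ?thesis
      using x f boundary_boundary_Box[of f x] by (simp add: numeral_2_eq_2 numeral_3_eq_3)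
  next
    case 3
    then show ?thesis
      by (simp add: cells_empty)
  qed
next
  fix i and f :: "cell \<Rightarrow> 'k mpoly"
  assume f: "f \<in> cell_funs n (cells (Suc i))"
    and ker: "\<And>x. x \<in> cells i \<Longrightarrow> (\<Sum>y\<in>cells (Suc i). boundary M x y * f y) = 0"
  consider "i = 0" | "i = 1" | "i = 2" | "3 \<le> i"
    by linarith
  then show "\<exists>g\<in>cell_funs n (cells (Suc (Suc i))).
      \<forall>y\<in>cells (Suc i). f y = (\<Sum>z\<in>cells (Suc (Suc i)). boundary M y z * g z)"
  proof cases
    case 1
    have "(\<Sum>y\<in>cells (Suc 0). boundary M Apex y * f y) = 0"
      using ker[of Apex] unfolding 1 cells_cases(1) by blast
    from exact_boxes[OF f[unfolded 1] this] show ?thesis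
      by (simp only: 1 numeral_2_eq_2)
  next
    case 2
    show ?thesis
      using exact_edges[unfolded numeral_2_eq_2 numeral_3_eq_3,
          OF f[unfolded 2 One_nat_def] ker[unfolded 2 One_nat_def]]
      by (simp only: 2 One_nat_def)
  next
    case 3
    have "f y = 0" for y
      by (rule exact_squares[unfolded numeral_2_eq_2 numeral_3_eq_3,
            OF f[unfolded 3 numeral_2_eq_2] ker[unfolded 3 numeral_2_eq_2]])
    then show ?thesis
      by (intro bexI[of _ "\<lambda>_. 0"]) (simp_all add: cell_funs_def poly_ring_closed(1))
  next
    case 4
    then show ?thesis
      by (intro bexI[of _ "\<lambda>_. 0"]) (simp_all add: cell_funs_def poly_ring_closed(1) cells_empty)
  qed
qed

text \<open>
  If \<open>lam 2 \<ge> 3\<close>, the square at \<open>(1, 2)\<close> exists. Conversely a square reaches into a row \<open>a + 1 \<ge> 2\<close> and there up to a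
  column \<open>b + 1 \<ge> 3\<close>, and row 2 is at least as long as that row.
\<close>

lemma squares_exist_iff: "cells 3 \<noteq> {} \<longleftrightarrow> lam 2 \<noteq> 2"
proof
  assume "cells 3 \<noteq> {}"
  then obtain a b where "in_shape a b" "in_shape (Suc a) b" "in_shape (Suc a) (Suc b)"
    unfolding ex_in_conv[symmetric] cells_cases by blast
  then have "1 \<le> a" "Suc a \<le> m" "Suc a \<le> b" "Suc b \<le> lam (Suc a)"
    by (auto simp: in_shape_def)
  then show "lam 2 \<noteq> 2"
    using antitone[of 2 "Suc a"] by auto
next
  assume "lam 2 \<noteq> 2"
  moreover have "2 \<le> lam 2"
    using in_shape_diag[of 2] m1 by (simp add: in_shape_def)
  ultimately have "in_shape 2 2" "in_shape 2 3"
    using m1 by (auto simp: in_shape_def)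
  then have "in_shape 1 2" "in_shape (Suc 1) 2" "in_shape (Suc 1) (Suc 2)"
    using in_shape_up[of 2 2 1] by (simp_all add: numeral_2_eq_2[symmetric] numeral_3_eq_3[symmetric])
  then have "Sq 1 2 \<in> cells 3"
    by (simp add: cells_def)
  then show "cells 3 \<noteq> {}"
    by blast
qed

text \<open>
  Every cell of dimension \<open>i > 0\<close> has degree \<open>n + m - 3 + i\<close>, so there is one degree in each homological
  degree, and only the existence of squares depends on the diagram.
\<close>

lemma betti_nonzero_iff:
  "betti n (quot_module n (dual_ideal :: 'k::field mpoly set)) i j \<noteq> 0 \<longleftrightarrow>
     i = 0 \<and> j = 0 \<or> 1 \<le> i \<and> i \<le> (if lam 2 = 2 then 2 else 3) \<and> j = int n + int m - 3 + int i"
proof -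
  have "betti n (quot_module n (dual_ideal :: 'k mpoly set)) i j \<noteq> 0 \<longleftrightarrow> (\<exists>x\<in>cells i. cell_degree x = j)"
    by (auto simp: betti_dual_ideal)
  also have "\<dots> \<longleftrightarrow> cells i \<noteq> {} \<and> j = (if i = 0 then 0 else int n + int m - 3 + int i)"
  proof -
    have "cell_degree x = (if i = 0 then 0 else int n + int m - 3 + int i)" if "x \<in> cells i" for x
      using that by (cases x) (auto simp: cells_def cell_degree_def)
    then show ?thesis
      by auto
  qed
  also have "cells i \<noteq> {} \<longleftrightarrow> i \<le> (if lam 2 = 2 then 2 else 3)"
  proof -
    have "in_shape 1 1" "in_shape 1 2"
      using in_shape_diag[of 1] in_shape_diag[of 2] in_shape_up[of 2 2 1] m1 by auto
    then have cells: "Apex \<in> cells 0" "Box 1 1 \<in> cells 1" "Hor 1 1 \<in> cells 2"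
      by (simp_all add: cells_def numeral_2_eq_2)
    consider "i = 0" | "i = 1" | "i = 2" | "i = 3" | "4 \<le> i"
      by linarith
    then show ?thesis
    proof cases
      case 1
      with cells(1) show ?thesis by auto
    next
      case 2
      with cells(2) show ?thesis by auto
    next
      case 3
      with cells(3) show ?thesis by auto
    next
      case 4
      then show ?thesis by (simp add: squares_exist_iff)
    next
      case 5
      then show ?thesis by (simp add: cells_empty)
    qed
  qed
  finally show ?thesis
    by auto
qed

lemma regularity_dual_ideal:
  "regularity n (quot_module n (dual_ideal :: 'k::field mpoly set)) = int n + int m - 3"
proof -
  have "{j - int i | i j. betti n (quot_module n (dual_ideal :: 'k mpoly set)) i j \<noteq> 0} = {0, int n + int m - 3}"
  proof (intro equalityI subsetI)
    fix r assume "r \<in> {j - int i | i j. betti n (quot_module n (dual_ideal :: 'k mpoly set)) i j \<noteq> 0}"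
    then show "r \<in> {0, int n + int m - 3}"
      unfolding betti_nonzero_iff by auto
  next
    fix r assume "r \<in> {0, int n + int m - 3}"
    then consider "r = 0 - int 0" | "r = (int n + int m - 3 + int 1) - int 1"
      by auto
    moreover have "betti n (quot_module n (dual_ideal :: 'k mpoly set)) 0 0 \<noteq> 0"
      "betti n (quot_module n (dual_ideal :: 'k mpoly set)) 1 (int n + int m - 3 + int 1) \<noteq> 0"
      unfolding betti_nonzero_iff by simp_all
    ultimately show "r \<in> {j - int i | i j. betti n (quot_module n (dual_ideal :: 'k mpoly set)) i j \<noteq> 0}"
      by cases blast+
  qed
  then show ?thesis
    using m1 m_le_n by (simp add: regularity_def)
qed

lemma proj_dim_dual_ideal:
  "proj_dim n (quot_module n (dual_ideal :: 'k::field mpoly set)) = (if lam 2 = 2 then 2 else 3)"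
proof -
  have "(\<exists>j. betti n (quot_module n (dual_ideal :: 'k mpoly set)) i j \<noteq> 0)
      \<longleftrightarrow> i \<le> (if lam 2 = 2 then 2 else 3)" for i
    unfolding betti_nonzero_iff by (cases "i = 0") auto
  then have "{i. \<exists>j. betti n (quot_module n (dual_ideal :: 'k mpoly set)) i j \<noteq> 0} = {..(if lam 2 = 2 then 2 else 3)}"
    by (simp add: atMost_def)
  then show ?thesis
    unfolding proj_dim_def by (simp only:) (intro Max_eqI; simp)
qed

lemma linear_resolution_dual_ideal: "linear_resolution n (dual_ideal :: 'k::field mpoly set)"
proof -
  let ?d = "int n + int m - 2"
  let ?J = "dual_ideal :: 'k mpoly set"
  have J: "?J \<subseteq> carrier (poly_ring n)"
    using ideal_poly_ringD(2)[OF ideal_dual_ideal] by blast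
  have "boundary M Apex ` cells (Suc 0) \<subseteq> {f \<in> ?J. homogeneous ?d f}"
  proof
    fix f :: "'k mpoly" assume f: "f \<in> boundary M Apex ` cells (Suc 0)"
    then obtain y where y: "y \<in> cells (Suc 0)" "f = boundary M Apex y"
      by blast
    have "cell_degree y - cell_degree Apex = ?d"
      using y(1) by (auto simp: cells_cases cell_degree_def)
    then have "homogeneous ?d f"
      using homogeneous_boundary[of Apex 0 y] y by (simp add: cells_cases)
    moreover have "f \<in> ?J"
      unfolding dual_ideal_def using genideal_ideal(2)[OF generators_carrier] f by blast
    ultimately show "f \<in> {f \<in> ?J. homogeneous ?d f}"
      by simp
  qed
  moreover have sub: "{f \<in> ?J. homogeneous ?d f} \<subseteq> carrier (poly_ring n)"
    using J by blast
  ultimately have "boundary M Apex ` cells (Suc 0) \<subseteq> genideal (poly_ring n) {f \<in> ?J. homogeneous ?d f}"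
    using genideal_ideal(2)[OF sub] by blast
  then have "?J \<subseteq> genideal (poly_ring n) {f \<in> ?J. homogeneous ?d f}"
    unfolding dual_ideal_def[where 'k = 'k, symmetric] by (subst dual_ideal_def) (rule genideal_least[OF genideal_ideal(1)[OF sub]])
  moreover have "genideal (poly_ring n) {f \<in> ?J. homogeneous ?d f} \<subseteq> ?J"
    by (rule genideal_least[OF ideal_dual_ideal]) blast
  ultimately have "generated_in_degree n ?d ?J"
    unfolding generated_in_degree_def by (rule equalityI)
  moreover have "betti n (quot_module n ?J) i j = 0" if "1 \<le> i" "j \<noteq> ?d + int i - 1" for i j
    using betti_nonzero_iff[of i j, where 'k = 'k] that by auto
  ultimately show ?thesis
    unfolding linear_resolution_def by blast
qed

end

theorem corollary4p11:
  fixes m n :: nat and lam :: "nat \<Rightarrow> nat" and I :: "'k::field mpoly set"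
  assumes "\<And>i j. 1 \<le> i \<Longrightarrow> i \<le> j \<Longrightarrow> j \<le> m \<Longrightarrow> lam j \<le> lam i"
    and "m \<le> lam m"
    and "n = lam 1"
    and "I = specialized_ferrers_ideal n m lam"
    and "m > 1"
  shows
    "(regularity n (quot_module n (lcm_dual n I)) = int (tdeg (lcm_gens I)) - 3 \<and>
      int (tdeg (lcm_gens I)) - 3 = int (lam 1) + int m - 3 \<and>
      int (lam 1) + int m - 3 = int n + int m - 3) \<and>
     ((lam 2 \<noteq> 2 \<longrightarrow> proj_dim n (quot_module n (lcm_dual n I)) = 3) \<and>
      (lam 2 = 2 \<longrightarrow> proj_dim n (quot_module n (lcm_dual n I)) = 2)) \<and>
     linear_resolution n (lcm_dual n I)"
proof -
  let ?e = "\<lambda>i j. Poly_Mapping.single i 1 + Poly_Mapping.single j 1 :: expo"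
  define G where "G = {?e i j | i j. 1 \<le> i \<and> i \<le> m \<and> i \<le> j \<and> j \<le> lam i}"
  have bound: "i \<le> n \<and> j \<le> n" if "1 \<le> i" "i \<le> m" "i \<le> j" "j \<le> lam i" for i j
    using assms(1)[of 1 i] assms(3) that by auto
  have m_le_n: "m \<le> n"
    using bound[of m m] assms by auto
  have G_keys: "Poly_Mapping.keys g \<subseteq> {1..n}" if "g \<in> G" for g
    using that bound by (auto simp: G_def in_keys_iff lookup_add lookup_single when_def split: if_splits)
  have "tdeg g = 2" if "g \<in> G" for g
    using that by (auto simp: G_def tdeg_add)
  then have G_antichain: "s = t" if "s \<in> G" "t \<in> G" "expo_dvd s t" for s t
    using that expo_dvd_same_degree by auto
  have "{mvar i * mvar j | i j. 1 \<le> i \<and> i \<le> m \<and> i \<le> j \<and> j \<le> lam i} = (monom ` G :: 'k mpoly set)"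
    unfolding G_def mvar_def monom_add[symmetric] by blast
  then have "I = genideal (poly_ring n) (monom ` G)"
    by (simp add: assms(4) specialized_ferrers_ideal_def)
  then have min_gens: "min_gens I = G"
    using min_gens_genideal[OF G_keys G_antichain] by simp
  have "G \<subseteq> (\<lambda>(i, j). ?e i j) ` ({..n} \<times> {..n})"
    using bound by (force simp: G_def)
  then have "finite G"
    by (rule finite_subset) simp
  then have lookup_lcm: "Poly_Mapping.lookup (lcm_gens I) k = Max (insert 0 ((\<lambda>t. Poly_Mapping.lookup t k) ` G))" for k
    by (simp add: lcm_gens_def min_gens lookup_expo_lcm)
  have lookup_e: "Poly_Mapping.lookup (?e i j) k = (if i = k then 1 else 0) + (if j = k then 1 else 0)" for i j k
    by (simp add: lookup_add lookup_single when_def)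
  \<comment> \<open>The exponent 2 is attained at \<open>x\<^sub>k x\<^sub>k\<close> for \<open>k \<le> m\<close>, the exponent 1 at \<open>x\<^sub>1 x\<^sub>k\<close> for the other variables.\<close>
  interpret shifted_diagram n m lam "lcm_gens I"
  proof
    fix k
    define c :: nat where "c = (if 1 \<le> k \<and> k \<le> m then 2 else if 1 \<le> k \<and> k \<le> n then 1 else 0)"
    have "Max (insert 0 ((\<lambda>t. Poly_Mapping.lookup t k) ` G)) = c"
    proof (rule Max_eqI)
      show "finite (insert 0 ((\<lambda>t. Poly_Mapping.lookup t k) ` G))"
        using \<open>finite G\<close> by simp
      fix y assume "y \<in> insert 0 ((\<lambda>t. Poly_Mapping.lookup t k) ` G)"
      then consider "y = 0" | i j where "y = Poly_Mapping.lookup (?e i j) k" "1 \<le> i" "i \<le> m" "i \<le> j" "j \<le> lam i"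
        unfolding G_def by blast
      then show "y \<le> c"
      proof cases
        case 2
        then show ?thesis
          using bound[of i j] unfolding lookup_e by (auto simp: c_def)
      qed simp
    next
      have "1 \<le> k \<and> k \<le> m \<or> m < k \<and> k \<le> n \<or> c = 0"
        by (auto simp: c_def)
      then consider "1 \<le> k" "k \<le> m" | "m < k" "k \<le> n" | "c = 0"
        by blast
      then show "c \<in> insert 0 ((\<lambda>t. Poly_Mapping.lookup t k) ` G)"
      proof cases
        case 1
        have "k \<le> lam k"
          using 1 assms(1)[of k m] assms(2) by auto
        then have "?e k k \<in> G"
          unfolding G_def using 1 by blast
        moreover have "Poly_Mapping.lookup (?e k k) k = c"
          unfolding lookup_e using 1 by (simp add: c_def)
        ultimately show ?thesis
          by blast
      next
        case 2
        then have "1 \<le> (1::nat) \<and> 1 \<le> m \<and> 1 \<le> k \<and> k \<le> lam 1"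
          using assms by auto
        then have "?e 1 k \<in> G"
          unfolding G_def by blast
        moreover have "Poly_Mapping.lookup (?e 1 k) k = c"
          unfolding lookup_e using 2 assms(5) by (simp add: c_def)
        ultimately show ?thesis
          by blast
      qed simp
    qed
    then show "Poly_Mapping.lookup (lcm_gens I) k = (if 1 \<le> k \<and> k \<le> m then 2 else if 1 \<le> k \<and> k \<le> n then 1 else 0)"
      by (simp add: lookup_lcm c_def)
  qed (use assms in auto)
  have "{monom (lcm_gens I - t) | t. t \<in> G}
      = (monom ` {lcm_gens I - ?e i j | i j. in_shape i j} :: 'k mpoly set)"
    unfolding G_def in_shape_def by blast
  then have "lcm_dual n I = dual_ideal"
    by (simp only: lcm_dual_def min_gens dual_ideal_monomials)
  then show ?thesis
    using regularity_dual_ideal[where 'k = 'k] proj_dim_dual_ideal[where 'k = 'k]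
      linear_resolution_dual_ideal[where 'k = 'k] tdeg_M assms(3)
    by simp
qed

end
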